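(* Let $E$ be a locally compact Hausdorff space with a countable basis. Let $(N_n)_{n\ge1}$ be a sequence of point processes on $E$ for which there are integers $k_n\to\infty$ and point processes $(N_{i,n})_{1\le i\le k_n,\,n\ge1}$ on $E$ such that $\lim_{n\to\infty}\max_{i\le k_n}P(N_{i,n}(B)>0)=0$ for every $B\in\mathcal B$, and $\lim_{n\to\infty}\big|E(e^{-N_n(f)})-\prod_{i=1}^{k_n}E(e^{-N_{i,n}(f)})\big|=0$ for every $f\in C_K^+(E)$. Put $\lambda_n=\sum_{i=1}^{k_n}P\circ N_{i,n}^{-1}$. Then $N_n\stackrel d\to N$ for some point process $N$ if and only if there exists a measure $\lambda$ on $M_p(E)$ satisfying $\lambda(\{o\})=0$ and $\int_{M_p(E)}(1-e^{-\mu(B)})\lambda(d\mu)<\infty$ for all $B\in\mathcal B$, such that $$\int_{M_p(E)}(1-e^{-\mu(f)})\,\lambda_n(d\mu)\to\int_{M_p(E)}(1-e^{-\mu(f)})\,\lambda(d\mu)\qquad\text{for all } f\in C_K^+(E).$$ In this case, $N$ is an infinitely divisible point process with canonical measure $\lambda$.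
   Context: $\mathcal B$ is the class of relatively compact Borel subsets of $E$. $M_p(E)$ is the set of Radon measures on $E$ taking values in $\mathbb Z_+$ on sets of $\mathcal B$, endowed with the topology of vague convergence ($\mu_n\to\mu$ iff $\mu_n(f)\to\mu(f)$ for all $f\in C_K^+(E)$, where $\mu(f)=\int f\,d\mu$ and $C_K^+(E)$ is the set of continuous compactly supported $f:E\to[0,\infty)$) and its Borel $\sigma$-field; $o$ denotes the null measure. A point process on $E$ is a random element of $M_p(E)$; $N_n\stackrel d\to N$ means weak convergence of the laws on $M_p(E)$. A point process $N$ is infinitely divisible if for every $n\ge1$ it is equal in distribution to a sum of $n$ i.i.d. point processes; equivalently, there is a (unique) measure $\lambda$ on $M_p(E)$, called the canonical measure of $N$, with $\lambda(\{o\})=0$, $\int(1-e^{-\mu(B)})\lambda(d\mu)<\infty$ for all $B\in\mathcal B$, and $E(e^{-N(f)})=\exp\{-\int_{M_p(E)}(1-e^{-\mu(f)})\lambda(d\mu)\}$ for all measurable $f:E\to[0,\infty)$. *)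

theory Defs
  imports "HOL-Probability.Probability"
begin

definition bounded_borel :: "'a::topological_space set set" where
  "bounded_borel = {B \<in> sets borel. compact (closure B)}"

definition CK_plus :: "('a::topological_space \<Rightarrow> real) set" where
  "CK_plus = {f. continuous_on UNIV f \<and> (\<forall>x. 0 \<le> f x) \<and> compact (closure {x. f x \<noteq> 0})}"

(* Usual point process convention: a Radon measure is a Borel measure that is finite on compact
   sets. On a locally compact Hausdorff space with a countable base such a measure is
   automatically regular. *)
definition radon_measure :: "'a::topological_space measure \<Rightarrow> bool" where
  "radon_measure \<mu> \<longleftrightarrow> sets \<mu> = sets borel \<and> (\<forall>K. compact K \<longrightarrow> emeasure \<mu> K < \<infinity>)"

definition Mp :: "'a::topological_space measure set" where
  "Mp = {\<mu>. radon_measure \<mu> \<and> (\<forall>B\<in>bounded_borel. \<exists>n::nat. emeasure \<mu> B = of_nat n)}"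

(* \<mu>(f) for a nonnegative f; the value may be infinite unless f is in CK_plus. *)
definition mint :: "'a measure \<Rightarrow> ('a \<Rightarrow> real) \<Rightarrow> ennreal" where
  "mint \<mu> f = (\<integral>\<^sup>+x. ennreal (f x) \<partial>\<mu>)"

(* The coarsest topology on Mp that makes all maps \<mu> \<mapsto> \<mu>(f), f in CK_plus, continuous. *)
definition vague_topology :: "'a::topological_space measure topology" where
  "vague_topology =
     topology_generated_by {{\<mu> \<in> Mp. mint \<mu> f \<in> U} | f U. f \<in> CK_plus \<and> open U}"

definition Mp_borel :: "'a::topological_space measure measure" where
  "Mp_borel = sigma Mp {U. openin vague_topology U}"

definition point_process :: "'b measure \<Rightarrow> ('b \<Rightarrow> 'a::topological_space measure) \<Rightarrow> bool" where
  "point_process P N \<longleftrightarrow> prob_space P \<and> N \<in> measurable P Mp_borel"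

definition law :: "'b measure \<Rightarrow> ('b \<Rightarrow> 'a::topological_space measure) \<Rightarrow> 'a measure measure" where
  "law P N = distr P Mp_borel N"

definition vague_weak_conv ::
    "(nat \<Rightarrow> 'a::topological_space measure measure) \<Rightarrow> 'a measure measure \<Rightarrow> bool" where
  "vague_weak_conv L L' \<longleftrightarrow>
     (\<forall>g. continuous_map vague_topology euclideanreal g \<and> bounded (g ` Mp) \<longrightarrow>
        (\<lambda>n. \<integral>\<mu>. g \<mu> \<partial>(L n)) \<longlonglongrightarrow> (\<integral>\<mu>. g \<mu> \<partial>L'))"

definition conv_in_dist ::
    "(nat \<Rightarrow> 'b measure) \<Rightarrow> (nat \<Rightarrow> 'b \<Rightarrow> 'a::topological_space measure) \<Rightarrow>
     'c measure \<Rightarrow> ('c \<Rightarrow> 'a measure) \<Rightarrow> bool" where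
  "conv_in_dist P X Q N \<longleftrightarrow> vague_weak_conv (\<lambda>n. law (P n) (X n)) (law Q N)"

(* exp (- x) on [0, \<infinity>], with exp (- \<infinity>) = 0. *)
definition exp_neg :: "ennreal \<Rightarrow> real" where
  "exp_neg x = (if x = \<infinity> then 0 else exp (- enn2real x))"

definition laplace :: "'b measure \<Rightarrow> ('b \<Rightarrow> 'a measure) \<Rightarrow> ('a \<Rightarrow> real) \<Rightarrow> real" where
  "laplace P N f = (\<integral>\<omega>. exp_neg (mint (N \<omega>) f) \<partial>P)"

(* The integral of 1 - exp (- \<mu>(f)) with respect to \<nu>, possibly infinite. *)
definition laplace_exponent :: "'a measure measure \<Rightarrow> ('a \<Rightarrow> real) \<Rightarrow> ennreal" where
  "laplace_exponent \<nu> f = (\<integral>\<^sup>+\<mu>. ennreal (1 - exp_neg (mint \<mu> f)) \<partial>\<nu>)"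

(* The measure on the \<sigma>-algebra of S with value (\<Sum>i\<in>I. m i A) at A; see emeasure_sum_measure. *)
definition sum_measure :: "'a measure \<Rightarrow> ('i \<Rightarrow> 'a measure) \<Rightarrow> 'i set \<Rightarrow> 'a measure" where
  "sum_measure S m I = measure_of (space S) (sets S) (\<lambda>A. \<Sum>i\<in>I. emeasure (m i) A)"

lemma space_sum_measure [simp]: "space (sum_measure S m I) = space S"
  and sets_sum_measure [simp]: "sets (sum_measure S m I) = sets S"
  by (simp_all add: sum_measure_def)

lemma emeasure_sum_measure:
  fixes S :: "'a measure" and m :: "'i \<Rightarrow> 'a measure"
  assumes "\<And>i. i \<in> I \<Longrightarrow> sets (m i) = sets S" and "A \<in> sets S"
  shows "emeasure (sum_measure S m I) A = (\<Sum>i\<in>I. emeasure (m i) A)"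
proof -
  have "countably_additive (sets S) (\<lambda>A. \<Sum>i\<in>I. emeasure (m i) A)"
    unfolding countably_additive_def
  proof (intro allI impI)
    fix F :: "nat \<Rightarrow> 'a set"
    assume F: "range F \<subseteq> sets S" "disjoint_family F" "(\<Union>i. F i) \<in> sets S"
    have "(\<Sum>n. \<Sum>i\<in>I. emeasure (m i) (F n)) = (\<Sum>i\<in>I. \<Sum>n. emeasure (m i) (F n))"
      by (rule suminf_sum) simp
    also have "\<dots> = (\<Sum>i\<in>I. emeasure (m i) (\<Union>n. F n))"
      using F assms(1) by (intro sum.cong refl suminf_emeasure) auto
    finally show "(\<Sum>n. \<Sum>i\<in>I. emeasure (m i) (F n)) = (\<Sum>i\<in>I. emeasure (m i) (\<Union>n. F n))" .
  qed
  moreover have "positive (sets S) (\<lambda>A. \<Sum>i\<in>I. emeasure (m i) A)"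
    by (simp add: positive_def)
  ultimately show ?thesis
    unfolding sum_measure_def
    using assms(2) by (simp add: emeasure_measure_of_sigma sets.sigma_algebra_axioms)
qed

(* n i.i.d. point processes are realised on sequences of measures: every joint law of n of them
   lives there, so fixing this sample space loses no generality. *)
definition infinitely_divisible ::
    "'b measure \<Rightarrow> ('b \<Rightarrow> 'a::topological_space measure) \<Rightarrow> bool" where
  "infinitely_divisible P N \<longleftrightarrow> point_process P N \<and>
     (\<forall>n\<ge>1. \<exists>(Q :: (nat \<Rightarrow> 'a measure) measure) (X :: nat \<Rightarrow> (nat \<Rightarrow> 'a measure) \<Rightarrow> 'a measure).
        prob_space Q \<and> (\<forall>i<n. point_process Q (X i)) \<and>
        prob_space.indep_vars Q (\<lambda>_. Mp_borel) X {..<n} \<and>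
        (\<forall>i<n. \<forall>j<n. law Q (X i) = law Q (X j)) \<and>
        law P N = law Q (\<lambda>\<omega>. sum_measure borel (\<lambda>i. X i \<omega>) {..<n}))"

(* The null measure o is null_measure borel. *)
definition admissible_measure :: "'a::topological_space measure measure \<Rightarrow> bool" where
  "admissible_measure \<nu> \<longleftrightarrow>
     sets \<nu> = sets Mp_borel \<and> emeasure \<nu> {null_measure borel} = 0 \<and>
     (\<forall>B\<in>bounded_borel. (\<integral>\<^sup>+\<mu>. ennreal (1 - exp_neg (emeasure \<mu> B)) \<partial>\<nu>) < \<infinity>)"

definition canonical_measure ::
    "'b measure \<Rightarrow> ('b \<Rightarrow> 'a::topological_space measure) \<Rightarrow> 'a measure measure \<Rightarrow> bool" where
  "canonical_measure P N \<nu> \<longleftrightarrow> admissible_measure \<nu> \<and>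
     (\<forall>f \<in> borel_measurable borel. (\<forall>x. 0 \<le> f x) \<longrightarrow>
        laplace P N f = exp_neg (laplace_exponent \<nu> f))"

end

(* All limits are extracted without embedding the space of point measures into a Polish space: by
   Tychonoff, a family of bounded real sequences converges along one refined filter, and the
   limiting functional is represented by a measure through Daniell's theorem. On E this yields
   relative compactness in the vague topology; on M_p(E), where the Daniell condition follows from
   that compactness and a tightness estimate, it yields the continuity theorem for Laplace
   functionals.
   Because the array is null, prod_i E exp(-N_{i,n}(f)) and exp(-psi_n(f)), where psi_n(f) is the
   integral of 1 - exp(-mu(f)) against lambda_n, are asymptotically equal, so convergence of N_n
   means convergence of psi_n to some psi. With test functions H_m increasing to infinity, the
   canonical measure is the sum over m of the limits of the finite measures
   (exp(-mu(H_m)) - exp(-mu(H_{m+1}))) lambda_n(dmu); these weights add up to the indicator of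
   mu <> o, and the sum over m of the exponents telescopes to psi because point measures are
   integer valued. The m-th root of the limit law arises from the array in which every N_{i,n} is
   replaced by o with probability 1 - 1/m. *)
theory Submission
  imports Defs
begin

section \<open>Daniell integrals\<close>

text \<open>Two obstacles shape the proof. First, lambda_n has total mass \<open>k n\<close>, which
  tends to infinity, and psi may belong to an infinite measure, so lambda_n has to be cut into
  pieces that converge. The weights have the form exp(-mu(H_m)) - exp(-mu(H_{m+1})) because
  multiplication by exp(-mu(f)) again gives a difference of Laplace functionals: the transforms of
  the pieces are differences of values of psi_n and converge together with psi_n. Second, mass may
  escape in a limit. On M_p(E) it is held back by continuity of the limit functional along f/j,
  which comes from the limit law when the canonical measure is built, and from finiteness of the
  exponents when the limit law is built. Integrality survives vague limits, and it forces a
  configuration charging the support of f to have mass at least 1 there. Its factor exp(-mu(H_m)) is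
  then at most exp(-m) once H_m equals m on that support, which kills the remainder of the
  telescoping sum; the same fact compares exponents of different test functions.\<close>

locale daniell_integral =
  fixes \<Omega> :: "'x set" and L :: "('x \<Rightarrow> real) set" and I :: "('x \<Rightarrow> real) \<Rightarrow> real"
  assumes one: "(\<lambda>_. 1) \<in> L"
    and add: "\<phi> \<in> L \<Longrightarrow> \<psi> \<in> L \<Longrightarrow> (\<lambda>x. \<phi> x + \<psi> x) \<in> L"
    and scale: "\<phi> \<in> L \<Longrightarrow> (\<lambda>x. c * \<phi> x) \<in> L"
    and max: "\<phi> \<in> L \<Longrightarrow> \<psi> \<in> L \<Longrightarrow> (\<lambda>x. max (\<phi> x) (\<psi> x)) \<in> L"
    and bounded: "\<phi> \<in> L \<Longrightarrow> \<exists>C. \<forall>x\<in>\<Omega>. \<bar>\<phi> x\<bar> \<le> C"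
    and I_add: "\<phi> \<in> L \<Longrightarrow> \<psi> \<in> L \<Longrightarrow> I (\<lambda>x. \<phi> x + \<psi> x) = I \<phi> + I \<psi>"
    and I_scale: "\<phi> \<in> L \<Longrightarrow> I (\<lambda>x. c * \<phi> x) = c * I \<phi>"
    and I_nonneg: "\<phi> \<in> L \<Longrightarrow> (\<And>x. x \<in> \<Omega> \<Longrightarrow> 0 \<le> \<phi> x) \<Longrightarrow> 0 \<le> I \<phi>"
    and I_cont: "(\<And>j. u j \<in> L) \<Longrightarrow> (\<And>x. x \<in> \<Omega> \<Longrightarrow> decseq (\<lambda>j. u j x)) \<Longrightarrow>
      (\<And>x. x \<in> \<Omega> \<Longrightarrow> (\<lambda>j. u j x) \<longlonglongrightarrow> 0) \<Longrightarrow> (\<lambda>j. I (u j :: 'x \<Rightarrow> real)) \<longlonglongrightarrow> 0"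
begin

lemma const: "(\<lambda>_. c) \<in> L"
  using scale[OF one, of c] by simp

lemma diff: "\<phi> \<in> L \<Longrightarrow> \<psi> \<in> L \<Longrightarrow> (\<lambda>x. \<phi> x - \<psi> x) \<in> L"
  using add[of \<phi> "\<lambda>x. -1 * \<psi> x"] scale[of \<psi> "-1"] by simp

lemma min: assumes "\<phi> \<in> L" "\<psi> \<in> L" shows "(\<lambda>x. min (\<phi> x) (\<psi> x)) \<in> L"
proof -
  have "(\<lambda>x. \<phi> x + \<psi> x - max (\<phi> x) (\<psi> x)) = (\<lambda>x. min (\<phi> x) (\<psi> x))"
    by (auto simp: max_def min_def)
  then show ?thesis using diff[OF add[OF assms] max[OF assms]] by simp
qed

lemma I_diff: "\<phi> \<in> L \<Longrightarrow> \<psi> \<in> L \<Longrightarrow> I (\<lambda>x. \<phi> x - \<psi> x) = I \<phi> - I \<psi>"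
  using I_add[of \<phi> "\<lambda>x. -1 * \<psi> x"] scale[of \<psi> "-1"] I_scale[of \<psi> "-1"] by simp

lemma I_mono: "\<phi> \<in> L \<Longrightarrow> \<psi> \<in> L \<Longrightarrow> (\<And>x. x \<in> \<Omega> \<Longrightarrow> \<phi> x \<le> \<psi> x) \<Longrightarrow> I \<phi> \<le> I \<psi>"
  using I_nonneg[of "\<lambda>x. \<psi> x - \<phi> x"] I_diff[of \<psi> \<phi>] diff[of \<psi> \<phi>] by simp

lemma I_cong: "\<phi> \<in> L \<Longrightarrow> \<psi> \<in> L \<Longrightarrow> (\<And>x. x \<in> \<Omega> \<Longrightarrow> \<phi> x = \<psi> x) \<Longrightarrow> I \<phi> = I \<psi>"
  by (intro antisym I_mono) auto

lemma sum: "(\<And>i. i < (n::nat) \<Longrightarrow> \<phi> i \<in> L) \<Longrightarrow> (\<lambda>x. \<Sum>i<n. \<phi> i x) \<in> L"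
  by (induction n) (auto intro: const add)

lemma I_sum: "(\<And>i. i < (n::nat) \<Longrightarrow> \<phi> i \<in> L) \<Longrightarrow> I (\<lambda>x. \<Sum>i<n. \<phi> i x) = (\<Sum>i<n. I (\<phi> i))"
proof (induction n)
  case 0
  show ?case using I_scale[OF one, of 0] by simp
next
  case (Suc n)
  then show ?case using I_add[OF sum[of n \<phi>], of "\<phi> n"] by simp
qed

text \<open>Half-open vertical sections make these sets a semiring: intersections are again regions
  and differences split into two of them. Caratheodory's theorem can then be applied to subgraphs
  instead of to functions.\<close>

definition region :: "('x \<Rightarrow> real) \<Rightarrow> ('x \<Rightarrow> real) \<Rightarrow> ('x \<times> real) set" where
  "region \<phi> \<psi> = {(x, t). x \<in> \<Omega> \<and> \<phi> x \<le> t \<and> t < \<psi> x}"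

definition regions :: "('x \<times> real) set set" where
  "regions = {region \<phi> \<psi> | \<phi> \<psi>. \<phi> \<in> L \<and> \<psi> \<in> L}"

lemma regionsI: "\<phi> \<in> L \<Longrightarrow> \<psi> \<in> L \<Longrightarrow> region \<phi> \<psi> \<in> regions"
  by (auto simp: regions_def)

text \<open>Given by Lebesgue measure for arbitrary sets, not by the bounding functions, so that
  additivity over disjoint unions holds fibre by fibre.\<close>

definition height :: "('x \<times> real) set \<Rightarrow> 'x \<Rightarrow> real" where
  "height A x = measure lborel {t. (x, t) \<in> A}"

text \<open>The choice does not matter: \<open>I\<close> only depends on the values on \<open>\<Omega>\<close>.\<close>

definition volume :: "('x \<times> real) set \<Rightarrow> ennreal" where
  "volume A = ennreal (I (SOME \<eta>. \<eta> \<in> L \<and> (\<forall>x\<in>\<Omega>. \<eta> x = height A x)))"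

lemma region_section: "x \<in> \<Omega> \<Longrightarrow> {t. (x, t) \<in> region \<phi> \<psi>} = {\<phi> x ..< \<psi> x}"
  by (auto simp: region_def)

lemma height_region: "x \<in> \<Omega> \<Longrightarrow> height (region \<phi> \<psi>) x = max 0 (\<psi> x - \<phi> x)"
  by (auto simp: height_def region_section max_def)

lemma volume_eq:
  assumes "\<eta> \<in> L" "\<And>x. x \<in> \<Omega> \<Longrightarrow> \<eta> x = height A x"
  shows "volume A = ennreal (I \<eta>)"
proof -
  let ?P = "\<lambda>\<eta>. \<eta> \<in> L \<and> (\<forall>x\<in>\<Omega>. \<eta> x = height A x)"
  have "?P (SOME \<eta>. ?P \<eta>)" by (rule someI[of ?P \<eta>]) (use assms in auto)
  then have "I (SOME \<eta>. ?P \<eta>) = I \<eta>" using assms by (intro I_cong) auto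
  then show ?thesis by (simp add: volume_def)
qed

lemma volume_region: "\<phi> \<in> L \<Longrightarrow> \<psi> \<in> L \<Longrightarrow> volume (region \<phi> \<psi>) = ennreal (I (\<lambda>x. max 0 (\<psi> x - \<phi> x)))"
  by (intro volume_eq max const diff) (auto simp: height_region)

lemma regions_height:
  assumes "A \<in> regions"
  obtains \<eta> where "\<eta> \<in> L" "\<And>x. x \<in> \<Omega> \<Longrightarrow> \<eta> x = height A x"
    "\<And>x. x \<in> \<Omega> \<Longrightarrow> {t. (x, t) \<in> A} \<in> sets lborel"
    "\<And>x. x \<in> \<Omega> \<Longrightarrow> emeasure lborel {t. (x, t) \<in> A} \<noteq> \<infinity>"
proof -
  obtain \<phi> \<psi> where A: "A = region \<phi> \<psi>" "\<phi> \<in> L" "\<psi> \<in> L" using assms by (auto simp: regions_def)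
  have fin: "emeasure lborel {a ..< b} \<noteq> \<infinity>" for a b :: real by (cases "a \<le> b") auto
  show thesis
  proof (rule that)
    show "(\<lambda>x. max 0 (\<psi> x - \<phi> x)) \<in> L" using A by (intro max const diff)
  qed (use fin A in \<open>auto simp: region_section height_region\<close>)
qed

lemma semiring: "semiring_of_sets (\<Omega> \<times> UNIV) regions"
proof
  show "regions \<subseteq> Pow (\<Omega> \<times> UNIV)" by (auto simp: regions_def region_def)
  show "{} \<in> regions"
    unfolding regions_def using one by (auto intro!: exI[of _ "\<lambda>_. 1"] simp: region_def)
next
  fix a b assume "a \<in> regions" "b \<in> regions"
  then obtain \<phi> \<psi> \<phi>' \<psi>' where ab: "a = region \<phi> \<psi>" "b = region \<phi>' \<psi>'" 
    and L: "\<phi> \<in> L" "\<psi> \<in> L" "\<phi>' \<in> L" "\<psi>' \<in> L"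
    unfolding regions_def by auto
  have "a \<inter> b = region (\<lambda>x. max (\<phi> x) (\<phi>' x)) (\<lambda>x. min (\<psi> x) (\<psi>' x))"
    by (auto simp: ab region_def)
  then show "a \<inter> b \<in> regions" by (auto intro!: regionsI L max min)
  \<comment> \<open>The parts of \<open>a\<close> below and above \<open>b\<close>. The maximum with
    \<phi>' in \<open>?d\<close> keeps them disjoint over points where \<psi>' < \<phi>' and the
    section of \<open>b\<close> is empty.\<close>
  let ?c = "region \<phi> (\<lambda>x. min (\<psi> x) (\<phi>' x))"
  let ?d = "region (\<lambda>x. max (\<phi> x) (max (\<phi>' x) (\<psi>' x))) \<psi>"
  have "a - b = \<Union>{?c, ?d}" by (auto simp: ab region_def)
  moreover have "disjoint {?c, ?d}" by (auto simp: disjoint_def region_def)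
  moreover have "{?c, ?d} \<subseteq> regions" by (auto intro!: regionsI L max min)
  ultimately show "\<exists>C\<subseteq>regions. finite C \<and> disjoint C \<and> a - b = \<Union> C"
    by (intro exI[of _ "{?c, ?d}"]) auto
qed

text \<open>Countable additivity of Lebesgue measure sums the heights pointwise on \<Omega>. The
  remainders of this series belong to \<open>L\<close> and decrease to 0, which is exactly the
  situation of \<open>I_cont\<close>.\<close>

lemma volume_countably_additive: "countably_additive regions volume"
  unfolding countably_additive_def
proof (intro allI impI)
  fix A :: "nat \<Rightarrow> ('x \<times> real) set"
  assume A: "range A \<subseteq> regions" "disjoint_family A" "(\<Union>i. A i) \<in> regions"
  have "\<exists>\<eta>. \<eta> \<in> L \<and> (\<forall>x\<in>\<Omega>. \<eta> x = height (A i) x \<and> {t. (x, t) \<in> A i} \<in> sets lborel)" for i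
    using A(1) by (metis regions_height rangeI subsetD)
  then obtain \<eta> where \<eta>: "\<And>i. \<eta> i \<in> L" "\<And>i x. x \<in> \<Omega> \<Longrightarrow> \<eta> i x = height (A i) x"
    "\<And>i x. x \<in> \<Omega> \<Longrightarrow> {t. (x, t) \<in> A i} \<in> sets lborel" by metis
  obtain \<eta>0 where \<eta>0: "\<eta>0 \<in> L" "\<And>x. x \<in> \<Omega> \<Longrightarrow> \<eta>0 x = height (\<Union>i. A i) x"
    "\<And>x. x \<in> \<Omega> \<Longrightarrow> emeasure lborel {t. (x, t) \<in> (\<Union>i. A i)} \<noteq> \<infinity>"
    using regions_height[OF A(3)] by metis
  have sums: "(\<lambda>i. \<eta> i x) sums \<eta>0 x" if x: "x \<in> \<Omega>" for x
  proof -
    have eq: "{t. (x, t) \<in> (\<Union>i. A i)} = (\<Union>i. {t. (x, t) \<in> A i})" by auto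
    have "(\<lambda>i. measure lborel {t. (x, t) \<in> A i}) sums measure lborel (\<Union>i. {t. (x, t) \<in> A i})"
      using A(2) \<eta>(3)[OF x] \<eta>0(3)[OF x] unfolding eq
      by (intro measure_UNION) (auto simp: disjoint_family_on_def)
    then show ?thesis unfolding \<eta>(2)[OF x] \<eta>0(2)[OF x] height_def eq .
  qed
  let ?u = "\<lambda>n x. \<eta>0 x - (\<Sum>i<n. \<eta> i x)"
  have "(\<lambda>n. I (?u n)) \<longlonglongrightarrow> 0"
  proof (rule I_cont)
    show "?u n \<in> L" for n by (intro diff \<eta>0 sum \<eta>)
    show "decseq (\<lambda>n. ?u n x)" if "x \<in> \<Omega>" for x
      using \<eta>(2)[OF that] by (intro decseq_SucI) (simp add: height_def)
    show "(\<lambda>n. ?u n x) \<longlonglongrightarrow> 0" if "x \<in> \<Omega>" for x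
      using tendsto_diff[OF tendsto_const[of "\<eta>0 x"] sums[OF that, unfolded sums_def]] by simp
  qed
  moreover have "I (?u n) = I \<eta>0 - (\<Sum>i<n. I (\<eta> i))" for n
    by (simp add: I_diff I_sum \<eta>0 sum \<eta>)
  ultimately have "(\<lambda>n. I \<eta>0 - (I \<eta>0 - (\<Sum>i<n. I (\<eta> i)))) \<longlonglongrightarrow> I \<eta>0 - 0"
    by (intro tendsto_diff) simp_all
  then have s: "(\<lambda>i. I (\<eta> i)) sums I \<eta>0" by (simp add: sums_def)
  have nn: "0 \<le> I (\<eta> i)" for i using \<eta>(2) by (intro I_nonneg \<eta>) (simp add: height_def)
  have "(\<Sum>i. volume (A i)) = (\<Sum>i. ennreal (I (\<eta> i)))"
    using \<eta> by (intro suminf_cong volume_eq) auto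
  also have "\<dots> = ennreal (I \<eta>0)"
    using s nn by (simp add: suminf_ennreal2 sums_iff)
  also have "\<dots> = volume (\<Union>i. A i)" using \<eta>0 by (intro volume_eq[symmetric]) auto
  finally show "(\<Sum>i. volume (A i)) = volume (\<Union>i. A i)" .
qed

text \<open>A measure on \<Omega> times the line is built first, in which the subgraph of a
  nonnegative member of \<open>L\<close> has the volume given by \<open>I\<close>. The desired
  measure is read off on unit cylinders, and a layer-cake argument recovers \<open>I\<close> as its
  integral.\<close>

theorem daniell_representation:
  obtains M where "space M = \<Omega>" "sets M = sigma_sets \<Omega> {{x\<in>\<Omega>. 0 < \<phi> x} | \<phi>. \<phi> \<in> L}"
    "finite_measure M" "\<And>\<phi>. \<phi> \<in> L \<Longrightarrow> integrable M \<phi>" "\<And>\<phi>. \<phi> \<in> L \<Longrightarrow> (\<integral>x. \<phi> x \<partial>M) = I \<phi>"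
proof -
  interpret semiring_of_sets "\<Omega> \<times> UNIV" regions by (rule semiring)
  have "region (\<lambda>_. 1) (\<lambda>_. 1) = {}" by (auto simp: region_def)
  then have "positive regions volume"
    unfolding positive_def using volume_region[OF one one] I_scale[OF one, of 0] by simp
  from caratheodory[OF this volume_countably_additive]
  obtain \<mu> where \<mu>: "\<And>A. A \<in> regions \<Longrightarrow> \<mu> A = volume A"
    "measure_space (\<Omega> \<times> UNIV) (sigma_sets (\<Omega> \<times> UNIV) regions) \<mu>" by auto
  define V where "V = measure_of (\<Omega> \<times> UNIV) (sigma_sets (\<Omega> \<times> UNIV) regions) \<mu>"
  have sub: "sigma_sets (\<Omega> \<times> UNIV) regions \<subseteq> Pow (\<Omega> \<times> UNIV)"
    using sigma_sets_into_sp[OF space_closed] by blast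
  have sV: "sets V = sigma_sets (\<Omega> \<times> UNIV) regions" "space V = \<Omega> \<times> UNIV"
    using sub by (simp_all add: V_def sigma_sets_sigma_sets_eq space_closed)
  have eV: "emeasure V A = volume A" if "A \<in> regions" for A
    using \<mu> that unfolding V_def
    by (subst emeasure_measure_of_sigma) (auto simp: measure_space_def)
  define G where "G = {{x\<in>\<Omega>. 0 < \<phi> x} | \<phi>. \<phi> \<in> L}"
  have G: "G \<subseteq> Pow \<Omega>" by (auto simp: G_def)
  define strip where "strip = region (\<lambda>_. 0) (\<lambda>_. 1)"
  have strip: "strip \<in> sets V" unfolding sV strip_def
    by (intro sigma_sets.Basic) (rule regionsI[OF const const])
  \<comment> \<open>The measure of \<open>A\<close> is the volume of \<open>A \<times> {0..<1}\<close>.\<close>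
  define M where "M = distr (restrict_space V strip) (sigma \<Omega> G) fst"
  have sM: "space M = \<Omega>" "sets M = sigma_sets \<Omega> G" using G by (auto simp: M_def)
  have meas: "fst \<in> measurable (restrict_space V strip) (sigma \<Omega> G)"
  proof (rule measurable_sigma_sets[OF _ G])
    show "sets (sigma \<Omega> G) = sigma_sets \<Omega> G" using G by simp
    show "fst \<in> space (restrict_space V strip) \<rightarrow> \<Omega>"
      by (auto simp: space_restrict_space sV)
    fix A assume "A \<in> G"
    then obtain \<phi> where A: "A = {x\<in>\<Omega>. 0 < \<phi> x}" "\<phi> \<in> L" by (auto simp: G_def)
    \<comment> \<open>The functions \<open>min 1 (real j * \<phi> x)\<close> increase to the
      indicator of \<phi> > 0, so the cylinder over a generating set is a countable union of
      regions.\<close>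
    have "fst -` A \<inter> strip = (\<Union>j::nat. region (\<lambda>_. 0) (\<lambda>x. min 1 (real j * \<phi> x)))"
    proof (intro set_eqI iffI)
      fix p assume "p \<in> fst -` A \<inter> strip"
      then have p: "fst p \<in> \<Omega>" "0 < \<phi> (fst p)" "0 \<le> snd p" "snd p < 1"
        by (auto simp: A strip_def region_def)
      obtain j :: nat where "snd p / \<phi> (fst p) < real j" using reals_Archimedean2 by blast
      then have "snd p < real j * \<phi> (fst p)" using p by (simp add: field_simps)
      then show "p \<in> (\<Union>j::nat. region (\<lambda>_. 0) (\<lambda>x. min 1 (real j * \<phi> x)))"
        using p by (auto simp: region_def case_prod_beta)
    next
      fix p assume "p \<in> (\<Union>j::nat. region (\<lambda>_. 0) (\<lambda>x. min 1 (real j * \<phi> x)))"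
      then obtain j :: nat where j: "fst p \<in> \<Omega>" "0 \<le> snd p" "snd p < 1" "snd p < real j * \<phi> (fst p)"
        by (auto simp: region_def)
      then have "0 < real j * \<phi> (fst p)" by linarith
      then have "0 < \<phi> (fst p)" by (simp add: zero_less_mult_iff)
      then show "p \<in> fst -` A \<inter> strip"
        using j by (cases p) (auto simp: A strip_def region_def)
    qed
    also have "\<dots> \<in> sets V" unfolding sV
      using A by (intro sigma_sets.Union sigma_sets.Basic) (auto intro!: regionsI const min scale)
    finally show "fst -` A \<inter> space (restrict_space V strip) \<in> sets (restrict_space V strip)"
      using strip sets.sets_into_space[OF strip] 
      by (auto simp: sets_restrict_space_iff space_restrict_space Int_absorb2)
  qed
  have eM: "emeasure M A = emeasure V ((fst -` A) \<inter> strip)" "(fst -` A) \<inter> strip \<in> sets V" if "A \<in> sets M" for A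
  proof -
    have sp: "space (restrict_space V strip) = strip"
      using sets.sets_into_space[OF strip] by (auto simp: space_restrict_space)
    have "A \<in> sets (sigma \<Omega> G)" using that by (simp add: M_def)
    then show "(fst -` A) \<inter> strip \<in> sets V"
      using measurable_sets[OF meas, of A] strip by (auto simp: sp sets_restrict_space_iff)
    show "emeasure M A = emeasure V ((fst -` A) \<inter> strip)"
      using \<open>A \<in> sets (sigma \<Omega> G)\<close> strip unfolding M_def
      by (subst emeasure_distr[OF meas]) (auto simp: sp emeasure_restrict_space)
  qed
  have vol1: "emeasure V (region (\<lambda>_. 0) \<eta>) = ennreal (I \<eta>)"
    if "\<eta> \<in> L" "\<And>x. x \<in> \<Omega> \<Longrightarrow> 0 \<le> \<eta> x" for \<eta>
  proof -
    have "emeasure V (region (\<lambda>_. 0) \<eta>) = ennreal (I (\<lambda>x. max 0 (\<eta> x - 0)))"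
      using that const by (subst eV) (auto simp: regionsI volume_region)
    also have "I (\<lambda>x. max 0 (\<eta> x - 0)) = I \<eta>" using that by (intro I_cong max const diff) auto
    finally show ?thesis .
  qed
  have "emeasure M (space M) = emeasure V strip"
  proof -
    have "fst -` \<Omega> \<inter> strip = strip" by (auto simp: strip_def region_def)
    then show ?thesis using eM(1)[of \<Omega>] sM by (metis sets.top)
  qed
  also have "\<dots> = ennreal (I (\<lambda>_. 1))" unfolding strip_def using one by (intro vol1) auto
  finally interpret finite_measure M by (intro finite_measureI) simp
  have pos_sets: "{x\<in>\<Omega>. a < \<phi> x} \<in> sets M" if "\<phi> \<in> L" for \<phi> a
  proof -
    have "{x\<in>\<Omega>. a < \<phi> x} = {x\<in>\<Omega>. 0 < \<phi> x - a}" by auto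
    also have "\<dots> \<in> G" unfolding G_def
      by (intro CollectI exI[of _ "\<lambda>x. \<phi> x - a"] conjI refl diff[OF that const])
    finally show ?thesis unfolding sM by (rule sigma_sets.Basic)
  qed
  have bm: "\<phi> \<in> borel_measurable M" if "\<phi> \<in> L" for \<phi>
    using pos_sets[OF that] by (intro borel_measurableI_greater) (auto simp: sM)
  have int: "integrable M \<phi>" if "\<phi> \<in> L" for \<phi>
  proof -
    obtain C where "\<forall>x\<in>\<Omega>. \<bar>\<phi> x\<bar> \<le> C" using bounded[OF \<open>\<phi> \<in> L\<close>] by auto
    then show ?thesis
      using bm[OF that] by (intro integrable_const_bound[of _ C] AE_I2) (auto simp: sM)
  qed
  \<comment> \<open>Both sides lie between the Riemann sums of the distribution function of \<open>\<phi>\<close>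
    with mesh \<open>1 / K\<close>, whose difference telescopes.\<close>
  have layer: "I \<phi> = (\<integral>x. \<phi> x \<partial>M)"
    if \<phi>: "\<phi> \<in> L" and b: "\<And>x. x \<in> \<Omega> \<Longrightarrow> 0 \<le> \<phi> x" "\<And>x. x \<in> \<Omega> \<Longrightarrow> \<phi> x \<le> 1" for \<phi>
  proof -
    have bound: "\<bar>I \<phi> - (\<integral>x. \<phi> x \<partial>M)\<bar> \<le> measure M \<Omega> / real K" if K: "K > 0" for K :: nat
    proof -
      \<comment> \<open>The part of K \<phi> between the levels k and k + 1, squeezed between the
        indicators of \<phi> > (k + 1) / K and \<phi> > k / K.\<close>
      define \<eta> where "\<eta> k x = min 1 (max 0 (real K * \<phi> x - real k))" for k :: nat and x
      define a where "a k = measure M {x\<in>\<Omega>. real k / real K < \<phi> x}" for k :: nat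
      have \<eta>L: "\<eta> k \<in> L" for k unfolding \<eta>_def by (intro min max const diff scale \<phi>)
      have \<eta>b: "0 \<le> \<eta> k x" "\<eta> k x \<le> 1" for k x by (auto simp: \<eta>_def)
      have dec: "\<phi> x = (1 / real K) * (\<Sum>k<K. \<eta> k x)" if "x \<in> \<Omega>" for x
      proof -
        have "(\<Sum>k<n. \<eta> k x) = min (real n) (real K * \<phi> x)" for n
          using b(1)[OF that] by (induction n) (auto simp: \<eta>_def min_def max_def)
        then show ?thesis using K b(2)[OF that] by simp
      qed
      have aux: "\<eta> k x = 0" if "\<not> real k / real K < \<phi> x" for k x
        using that K by (simp add: \<eta>_def field_simps)
      have aux1: "\<eta> k x = 1" if "real (Suc k) / real K < \<phi> x" for k x
        using that K by (simp add: \<eta>_def field_simps)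
      have up: "I (\<eta> k) \<le> a k" for k
      proof -
        have "region (\<lambda>_. 0) (\<eta> k) \<subseteq> (fst -` {x\<in>\<Omega>. real k / real K < \<phi> x}) \<inter> strip"
        proof
          fix p assume p: "p \<in> region (\<lambda>_. 0) (\<eta> k)"
          obtain x t where xt: "p = (x, t)" "x \<in> \<Omega>" "0 \<le> t" "t < \<eta> k x"
            using p by (auto simp: region_def)
          then have "real k / real K < \<phi> x" using aux[of k x] by linarith
          then show "p \<in> (fst -` {x\<in>\<Omega>. real k / real K < \<phi> x}) \<inter> strip"
            using xt \<eta>b(2)[of k x] by (simp add: region_def strip_def)
        qed
        then have "ennreal (I (\<eta> k)) \<le> emeasure M {x\<in>\<Omega>. real k / real K < \<phi> x}"
          using eM[OF pos_sets[OF \<phi>]] vol1[OF \<eta>L \<eta>b(1)] by (metis emeasure_mono)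
        then show ?thesis by (simp add: emeasure_eq_measure a_def)
      qed
      have lo: "a (Suc k) \<le> I (\<eta> k)" for k
      proof -
        have "(fst -` {x\<in>\<Omega>. real (Suc k) / real K < \<phi> x}) \<inter> strip \<subseteq> region (\<lambda>_. 0) (\<eta> k)"
          using aux1[of k] by (auto simp: region_def strip_def)
        moreover have "region (\<lambda>_. 0) (\<eta> k) \<in> sets V" unfolding sV 
          using \<eta>L const by (intro sigma_sets.Basic regionsI)
        ultimately have "emeasure M {x\<in>\<Omega>. real (Suc k) / real K < \<phi> x} \<le> ennreal (I (\<eta> k))"
          using eM[OF pos_sets[OF \<phi>]] vol1[OF \<eta>L \<eta>b(1)] by (metis emeasure_mono)
        moreover have "0 \<le> I (\<eta> k)" by (intro I_nonneg \<eta>L \<eta>b)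
        ultimately show ?thesis by (simp add: emeasure_eq_measure a_def)
      qed
      have ind: "integrable M (indicator {x\<in>\<Omega>. c < \<phi> x} :: 'x \<Rightarrow> real)"
        "(\<integral>x. indicator {x\<in>\<Omega>. c < \<phi> x} x \<partial>M) = measure M {x\<in>\<Omega>. c < \<phi> x}" for c
        using pos_sets[OF \<phi>, of c] sets.sets_into_space[OF pos_sets[OF \<phi>, of c]]
        by (auto simp: emeasure_eq_measure Int_absorb2 intro!: integrable_real_indicator)
      have up': "(\<integral>x. \<eta> k x \<partial>M) \<le> a k" for k
        unfolding a_def ind(2)[symmetric] using aux[of k] \<eta>b(2)[of k]
        by (intro integral_mono int \<eta>L ind) (auto simp: indicator_def sM)
      have lo': "a (Suc k) \<le> (\<integral>x. \<eta> k x \<partial>M)" for k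
        unfolding a_def ind(2)[symmetric] using aux1[of k] \<eta>b(1)[of k]
        by (intro integral_mono int \<eta>L ind) (auto simp: indicator_def sM)
      have "I \<phi> = I (\<lambda>x. (1 / real K) * (\<Sum>k<K. \<eta> k x))"
        using dec by (intro I_cong \<phi> scale sum \<eta>L) auto
      also have "\<dots> = (1 / real K) * (\<Sum>k<K. I (\<eta> k))"
        by (simp only: I_scale[OF sum[OF \<eta>L]] I_sum[OF \<eta>L])
      finally have 1: "I \<phi> = (1 / real K) * (\<Sum>k<K. I (\<eta> k))" .
      have "(\<integral>x. \<phi> x \<partial>M) = (\<integral>x. (1 / real K) * (\<Sum>k<K. \<eta> k x) \<partial>M)"
        using dec by (intro Bochner_Integration.integral_cong) (auto simp: sM)
      also have "\<dots> = (1 / real K) * (\<Sum>k<K. (\<integral>x. \<eta> k x \<partial>M))"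
        using int[OF \<eta>L] by simp
      finally have 2: "(\<integral>x. \<phi> x \<partial>M) = (1 / real K) * (\<Sum>k<K. (\<integral>x. \<eta> k x \<partial>M))" .
      have "\<bar>I \<phi> - (\<integral>x. \<phi> x \<partial>M)\<bar> = (1 / real K) * \<bar>\<Sum>k<K. (I (\<eta> k) - (\<integral>x. \<eta> k x \<partial>M))\<bar>"
        unfolding 1 2 by (simp add: sum_subtractf abs_mult flip: right_diff_distrib diff_divide_distrib)
      also have "\<dots> \<le> (1 / real K) * (\<Sum>k<K. a k - a (Suc k))"
        using up lo up' lo'
        by (intro mult_left_mono order_trans[OF sum_abs] sum_mono) (auto simp: abs_le_iff intro: diff_mono)
      also have "(\<Sum>k<K. a k - a (Suc k)) = a 0 - a K" by (rule sum_lessThan_telescope')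
      also have "\<dots> \<le> measure M \<Omega>"
      proof -
        have "a 0 \<le> measure M \<Omega>"
          unfolding a_def using sets.top[of M] by (intro finite_measure_mono) (auto simp: sM(1))
        moreover have "0 \<le> a K" by (simp add: a_def)
        ultimately show ?thesis by linarith
      qed
      finally show ?thesis using K by (simp add: divide_right_mono)
    qed
    have "(\<lambda>K. measure M \<Omega> / real K) \<longlonglongrightarrow> 0" by (rule lim_const_over_n)
    then have "\<bar>I \<phi> - (\<integral>x. \<phi> x \<partial>M)\<bar> \<le> 0"
      by (rule tendsto_lowerbound) (use bound in \<open>auto intro: eventually_sequentiallyI[of 1]\<close>)
    then show ?thesis by simp
  qed
  have "(\<integral>x. \<phi> x \<partial>M) = I \<phi>" if \<phi>: "\<phi> \<in> L" for \<phi>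
  proof -
    obtain C0 where C0: "\<forall>x\<in>\<Omega>. \<bar>\<phi> x\<bar> \<le> C0" using bounded[OF \<phi>] by auto
    define C where "C = \<bar>C0\<bar> + 1"
    have C: "C > 0" "\<bar>\<phi> x\<bar> \<le> C" if "x \<in> \<Omega>" for x using C0 that by (fastforce simp: C_def)+
    have C0: "C > 0" by (simp add: C_def)
    \<comment> \<open>\<open>layer\<close> treats values in the unit interval only. \<open>C\<close>
      is positive even for \<phi> = 0, so this affine image of \<phi> is defined and can be undone
      by linearity.\<close>
    let ?g = "\<lambda>x. (1 / (2 * C)) * (\<phi> x + C)"
    have g: "?g \<in> L" by (intro scale add const \<phi>)
    have "I ?g = (\<integral>x. ?g x \<partial>M)"
      using C C0 by (intro layer g) (force simp: field_simps abs_le_iff)+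
    moreover have "I ?g = (1 / (2 * C)) * (I \<phi> + I (\<lambda>_. C))"
      by (simp only: I_scale[OF add[OF \<phi> const]] I_add[OF \<phi> const])
    moreover have "(\<integral>x. ?g x \<partial>M) = (1 / (2 * C)) * ((\<integral>x. \<phi> x \<partial>M) + (\<integral>x. C \<partial>M))"
      using int[OF \<phi>] int[OF const[of C]] by (subst integral_mult_right_zero, subst Bochner_Integration.integral_add) simp_all
    moreover have "I (\<lambda>_. C) = (\<integral>x. C \<partial>M)"
    proof -
      have "I (\<lambda>_. 1) = (\<integral>x. 1 \<partial>M)" by (intro layer one) auto
      then show ?thesis using I_scale[OF one, of C] by simp
    qed
    ultimately show ?thesis using C0 by simp
  qed
  with that[of M] sM int finite_measure_axioms show thesis by (auto simp: G_def)
qed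

end

text \<open>A substitute for extracting a subsequence when the set \<open>S\<close> is uncountable.\<close>

lemma filter_subnet:
  fixes T :: "'n \<Rightarrow> 'f \<Rightarrow> real"
  assumes "F \<noteq> bot" "\<And>f. f \<in> S \<Longrightarrow> eventually (\<lambda>n. \<bar>T n f\<bar> \<le> C f) F"
  obtains G where "G \<le> F" "G \<noteq> bot" "\<And>f. f \<in> S \<Longrightarrow> \<exists>l. ((\<lambda>n. T n f) \<longlongrightarrow> l) G"
proof -
  \<comment> \<open>The bounds hold only eventually along \<open>F\<close>. Clipping places every
    \<open>T' n\<close> in one compact cube, and for each single \<open>f\<close> the clipped values
    agree with the original ones eventually.\<close>
  define T' where "T' n f = max (- \<bar>C f\<bar>) (min \<bar>C f\<bar> (T n f))" for n f
  define K where "K = PiE UNIV (\<lambda>f. {- \<bar>C f\<bar> .. \<bar>C f\<bar>})"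
  have "compactin (product_topology (\<lambda>_. euclidean) UNIV) K"
    unfolding K_def compactin_PiE by auto
  then have "compact K" by (simp add: euclidean_product_topology compactin_euclidean_iff)
  moreover have "filtermap T' F \<noteq> bot" using assms(1) by (simp add: filtermap_bot_iff)
  moreover have "eventually (\<lambda>x. x \<in> K) (filtermap T' F)"
    unfolding eventually_filtermap by (intro always_eventually) (auto simp: K_def T'_def)
  ultimately obtain c where c: "inf (nhds c) (filtermap T' F) \<noteq> bot"
    unfolding compact_filter by blast
  \<comment> \<open>Refining \<open>F\<close> by the neighbourhoods of the cluster point turns
    clustering into convergence; properness of \<open>G\<close> is the cluster property
    itself.\<close>
  define G where "G = inf F (filtercomap T' (nhds c))"
  have Gbot: "G \<noteq> bot"
  proof
    assume "G = bot"
    then have "eventually (\<lambda>_. False) G" by simp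
    then obtain P Q where PQ: "eventually P F" "eventually Q (filtercomap T' (nhds c))" "\<And>x. P x \<Longrightarrow> Q x \<Longrightarrow> False"
      unfolding G_def eventually_inf by auto
    from PQ(2) obtain R where R: "eventually R (nhds c)" "\<And>x. R (T' x) \<Longrightarrow> Q x"
      by (auto simp: eventually_filtercomap)
    have "eventually (\<lambda>y. \<not> R y) (filtermap T' F)"
      unfolding eventually_filtermap using PQ(1) by eventually_elim (use PQ(3) R(2) in blast)
    with R(1) have "eventually (\<lambda>_. False) (inf (nhds c) (filtermap T' F))"
      unfolding eventually_inf by blast
    with c show False by (simp add: trivial_limit_def)
  qed
  have "filterlim T' (nhds c) G"
    unfolding G_def by (rule filterlim_mono[OF filterlim_filtercomap order_refl]) simp
  then have lim': "((\<lambda>n. T' n f) \<longlongrightarrow> c f) G" for f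
    by (rule continuous_on_tendsto_compose[OF continuous_on_product_coordinates]) auto
  have "G \<le> F" by (simp add: G_def)
  have lim: "((\<lambda>n. T n f) \<longlongrightarrow> c f) G" if "f \<in> S" for f
  proof (rule Lim_transform_eventually[OF lim'])
    have "eventually (\<lambda>n. \<bar>T n f\<bar> \<le> C f) G" using assms(2)[OF that] \<open>G \<le> F\<close> by (rule filter_leD[rotated])
    then show "eventually (\<lambda>n. T' n f = T n f) G"
      by eventually_elim (auto simp: T'_def)
  qed
  show thesis by (rule that[OF \<open>G \<le> F\<close> Gbot]) (use lim in auto)
qed

section \<open>Test functions and point measures\<close>

lemma exp_neg_ennreal [simp]: "0 \<le> x \<Longrightarrow> exp_neg (ennreal x) = exp (- x)"
  by (simp add: exp_neg_def)

lemma exp_neg_top [simp]: "exp_neg top = 0"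
  by (simp add: exp_neg_def)

lemma exp_neg_0 [simp]: "exp_neg 0 = 1"
  by (simp add: exp_neg_def)

lemma exp_neg_nonneg [simp]: "0 \<le> exp_neg x"
  by (simp add: exp_neg_def)

lemma exp_neg_le_1 [simp]: "exp_neg x \<le> 1"
  by (simp add: exp_neg_def)

lemma exp_neg_antimono: "x \<le> y \<Longrightarrow> exp_neg y \<le> exp_neg x"
  by (cases x; cases y) (auto simp: top_unique)

lemma exp_neg_add: "exp_neg (x + y) = exp_neg x * exp_neg y"
  by (cases x; cases y) (auto simp: exp_add[symmetric] simp flip: ennreal_plus)

lemma exp_neg_sum: "exp_neg (\<Sum>i\<in>A. x i) = (\<Prod>i\<in>A. exp_neg (x i))"
  by (induction A rule: infinite_finite_induct) (auto simp: exp_neg_add)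

text \<open>Since \<open>exp_neg\<close> is given by cases, its continuity, also at infinity, is
  reduced to openness of preimages of rays; this equivalence and the next make these preimages
  explicit.\<close>

lemma exp_neg_greater_iff:
  "a < exp_neg x \<longleftrightarrow> a < 0 \<or> (a = 0 \<and> x < top) \<or> (0 < a \<and> a < 1 \<and> x < ennreal (- ln a))"
proof (cases x)
  case (real r)
  have "a < exp (- r) \<longleftrightarrow> r < - ln a" if "0 < a"
    using that ln_less_cancel_iff[of a "exp (-r)"] by auto
  moreover have "a < 1" if "a < exp (- r)" 
    using that real exp_le_one_iff[of "-r"] by linarith
  moreover have "ennreal r < ennreal (- ln a) \<longleftrightarrow> r < - ln a" if "0 < a" "a < 1"
    using that real by (intro ennreal_less_iff) auto
  moreover have "0 < exp (-r)" by simp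
  ultimately show ?thesis using real by (smt (verit) exp_neg_ennreal ennreal_less_top)
qed auto

lemma exp_neg_less_iff:
  "exp_neg x < a \<longleftrightarrow> 1 < a \<or> (0 < a \<and> a \<le> 1 \<and> ennreal (- ln a) < x)"
proof (cases x)
  case (real r)
  have "exp (- r) < a \<longleftrightarrow> - ln a < r" if "0 < a"
    using that ln_less_cancel_iff[of "exp (-r)" a] by auto
  moreover have "0 < a" if "exp (- r) < a" 
    using that exp_gt_zero[of "-r"] by linarith
  moreover have "ennreal (- ln a) < ennreal r \<longleftrightarrow> - ln a < r" if "0 < a" "a \<le> 1"
    using that by (intro ennreal_less_iff) auto
  moreover have "exp (-r) \<le> 1" using real by simp
  ultimately show ?thesis using real by (smt (verit) exp_neg_ennreal)
qed auto

lemma continuous_on_exp_neg: "continuous_on UNIV exp_neg"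
proof (rule continuous_on_generate_topology[OF open_generated_order])
  fix B :: "real set" assume "B \<in> range (\<lambda>a. {..<a}) \<union> range (\<lambda>a. {a<..})"
  then obtain a where "B = {..<a} \<or> B = {a<..}" by auto
  then have "open (exp_neg -` B)"
  proof
    assume B: "B = {a<..}"
    have "exp_neg -` B = (if a < 0 then UNIV else if a = 0 then {..<top} else if a < 1 then {..<ennreal (- ln a)} else {})"
      using exp_neg_greater_iff[of a] by (auto simp: B)
    then show ?thesis by simp
  next
    assume B: "B = {..<a}"
    have "exp_neg -` B = (if 1 < a then UNIV else if 0 < a then {ennreal (- ln a)<..} else {})"
      using exp_neg_less_iff[of _ a] by (auto simp: B)
    then show ?thesis by simp
  qed
  then show "\<exists>C. open C \<and> C \<inter> UNIV = exp_neg -` B \<inter> UNIV" by auto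
qed

lemma tendsto_exp_neg: "(f \<longlongrightarrow> x) F \<Longrightarrow> ((\<lambda>n. exp_neg (f n)) \<longlongrightarrow> exp_neg x) F"
  by (rule continuous_on_tendsto_compose[OF continuous_on_exp_neg]) auto

lemma Mp_sets: "\<mu> \<in> Mp \<Longrightarrow> sets \<mu> = sets borel"
  by (auto simp: Mp_def radon_measure_def)

lemma Mp_space: "\<mu> \<in> Mp \<Longrightarrow> space \<mu> = UNIV"
  using sets_eq_imp_space_eq[OF Mp_sets, of \<mu>] by simp

lemma CK_plusD:
  assumes "f \<in> CK_plus"
  shows "continuous_on UNIV f" "0 \<le> f x" "compact (closure {x. f x \<noteq> 0})"
  using assms by (auto simp: CK_plus_def)

lemma CK_plus_measurable: "f \<in> CK_plus \<Longrightarrow> f \<in> borel_measurable borel"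
  by (rule borel_measurable_continuous_onI[OF CK_plusD(1)])

lemma CK_plus_measurable_Mp: "f \<in> CK_plus \<Longrightarrow> \<mu> \<in> Mp \<Longrightarrow> f \<in> borel_measurable \<mu>"
  using CK_plus_measurable Mp_sets by (metis measurable_cong_sets)

lemma CK_plus_open_support: "f \<in> CK_plus \<Longrightarrow> open {x. f x \<noteq> 0}"
  by (intro open_Collect_neq CK_plusD(1) continuous_on_const)

lemma CK_plus_support_bounded: "f \<in> CK_plus \<Longrightarrow> {x. f x \<noteq> 0} \<in> bounded_borel"
  using CK_plus_open_support CK_plusD(3) by (auto simp: bounded_borel_def)

lemma compact_bounded_borel: "compact (K :: 'a::t2_space set) \<Longrightarrow> K \<in> bounded_borel"
  by (auto simp: bounded_borel_def compact_imp_closed closure_closed)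

lemma CK_plusI:
  fixes f :: "'a::t2_space \<Rightarrow> real"
  assumes "continuous_on UNIV f" "\<And>x. 0 \<le> f x" "compact K" "{x. f x \<noteq> 0} \<subseteq> K"
  shows "f \<in> CK_plus"
proof -
  have "closure {x. f x \<noteq> 0} \<subseteq> K"
    using assms by (intro closure_minimal compact_imp_closed)
  then have "closure {x. f x \<noteq> 0} = K \<inter> closure {x. f x \<noteq> 0}" by auto
  then have "compact (closure {x. f x \<noteq> 0})"
    using compact_Int_closed[OF assms(3) closed_closure, of "{x. f x \<noteq> 0}"] by simp
  then show ?thesis using assms by (auto simp: CK_plus_def)
qed

lemma CK_plus_dominated:
  fixes f g :: "'a::t2_space \<Rightarrow> real"
  assumes "g \<in> CK_plus" "continuous_on UNIV f" "\<And>x. 0 \<le> f x" "\<And>x. g x = 0 \<Longrightarrow> f x = 0"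
  shows "f \<in> CK_plus"
proof (rule CK_plusI[OF assms(2,3) CK_plusD(3)[OF assms(1)]])
  show "{x. f x \<noteq> 0} \<subseteq> closure {x. g x \<noteq> 0}"
    using assms(4) closure_subset[of "{x. g x \<noteq> 0}"] by blast
qed

lemma CK_plus_zero: "(\<lambda>_. 0) \<in> CK_plus"
  by (simp add: CK_plus_def)

lemma CK_plus_scale: "0 \<le> c \<Longrightarrow> f \<in> CK_plus \<Longrightarrow> (\<lambda>x::'a::t2_space. c * f x) \<in> CK_plus"
  by (rule CK_plus_dominated[of f])
    (auto intro: continuous_on_mult continuous_on_const CK_plusD(1)[of f] simp: CK_plusD(2))

lemma CK_plus_divide: "f \<in> CK_plus \<Longrightarrow> (\<lambda>x::'a::t2_space. f x / real n) \<in> CK_plus"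
  using CK_plus_scale[of "1 / real n" f] by simp

lemma CK_plus_add:
  assumes "f \<in> CK_plus" "g \<in> CK_plus" shows "(\<lambda>x::'a::t2_space. f x + g x) \<in> CK_plus"
proof (rule CK_plusI)
  show "compact (closure {x. f x \<noteq> 0} \<union> closure {x. g x \<noteq> 0})"
    by (rule compact_Un[OF CK_plusD(3)[OF assms(1)] CK_plusD(3)[OF assms(2)]])
  show "{x. f x + g x \<noteq> 0} \<subseteq> closure {x. f x \<noteq> 0} \<union> closure {x. g x \<noteq> 0}"
    using closure_subset[of "{x. f x \<noteq> 0}"] closure_subset[of "{x. g x \<noteq> 0}"] by fastforce
qed (use assms in \<open>auto intro!: continuous_on_add CK_plusD(1)[of f] CK_plusD(1)[of g] simp: CK_plusD(2)\<close>)

lemma CK_plus_max: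
  assumes "f \<in> CK_plus" "g \<in> CK_plus" shows "(\<lambda>x::'a::t2_space. max (f x) (g x)) \<in> CK_plus"
proof (rule CK_plus_dominated[OF CK_plus_add[OF assms]])
  show "max (f x) (g x) = 0" if "f x + g x = 0" for x
    using that CK_plusD(2)[OF assms(1), of x] CK_plusD(2)[OF assms(2), of x] by simp
qed (use assms in \<open>auto intro!: continuous_on_max CK_plusD(1)[of f] CK_plusD(1)[of g] simp: le_max_iff_disj CK_plusD(2)\<close>)

lemma CK_plus_bounded:
  fixes f :: "'a::t2_space \<Rightarrow> real"
  assumes "f \<in> CK_plus" obtains C where "0 < C" "\<And>x. f x \<le> C"
proof -
  have "compact (f ` closure {x. f x \<noteq> 0})"
    by (rule compact_continuous_image[OF continuous_on_subset[OF CK_plusD(1)[OF assms] subset_UNIV] CK_plusD(3)[OF assms]])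
  then obtain C where C: "\<And>x. x \<in> closure {x. f x \<noteq> 0} \<Longrightarrow> \<bar>f x\<bar> \<le> C"
    by (fastforce dest!: compact_imp_bounded simp: bounded_iff)
  have "f x \<le> \<bar>C\<bar> + 1" for x
    using C[of x] closure_subset[of "{x. f x \<noteq> 0}"] by (cases "f x = 0") force+
  then show thesis by (intro that[of "\<bar>C\<bar> + 1"]) auto
qed

lemma Mp_finite: "\<mu> \<in> Mp \<Longrightarrow> B \<in> bounded_borel \<Longrightarrow> emeasure \<mu> B < \<infinity>"
  unfolding Mp_def by (auto simp: of_nat_less_top)

lemma integrable_dominated_CK:
  fixes g :: "'a::t2_space \<Rightarrow> real"
  assumes "\<mu> \<in> Mp" "g \<in> CK_plus" "f \<in> borel_measurable borel" "\<And>x. \<bar>f x\<bar> \<le> g x"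
  shows "integrable \<mu> f"
proof -
  obtain C where C: "0 < C" "\<And>x. g x \<le> C" using CK_plus_bounded[OF assms(2)] by metis
  let ?S = "{x. g x \<noteq> 0}"
  have S: "?S \<in> sets \<mu>" "emeasure \<mu> ?S < \<infinity>"
    using CK_plus_support_bounded[OF assms(2)] Mp_finite[OF assms(1)] Mp_sets[OF assms(1)]
    by (auto simp: bounded_borel_def)
  show ?thesis
  proof (rule Bochner_Integration.integrable_bound)
    show "integrable \<mu> (\<lambda>x. C * indicator ?S x :: real)"
      using S by (intro integrable_mult_right integrable_real_indicator) auto
    show "f \<in> borel_measurable \<mu>"
      using assms(3) Mp_sets[OF assms(1)] by (metis measurable_cong_sets)
    have "\<bar>f x\<bar> \<le> C * indicator ?S x" for x
      using assms(4)[of x] C(2)[of x] by (auto simp: indicator_def)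
    then show "AE x in \<mu>. norm (f x) \<le> norm (C * indicator ?S x :: real)"
      using C by (intro AE_I2) (auto simp: abs_mult)
  qed
qed

lemma integrable_CK: "\<mu> \<in> Mp \<Longrightarrow> (f :: 'a::t2_space \<Rightarrow> real) \<in> CK_plus \<Longrightarrow> integrable \<mu> f"
  by (rule integrable_dominated_CK[of _ f]) (auto simp: CK_plus_measurable CK_plusD)

lemma mint_CK: "\<mu> \<in> Mp \<Longrightarrow> (f :: 'a::t2_space \<Rightarrow> real) \<in> CK_plus \<Longrightarrow> mint \<mu> f = ennreal (\<integral>x. f x \<partial>\<mu>)"
  unfolding mint_def by (intro nn_integral_eq_integral integrable_CK) (auto simp: CK_plusD)

lemma integral_CK_nonneg: "(f :: 'a::t2_space \<Rightarrow> real) \<in> CK_plus \<Longrightarrow> 0 \<le> (\<integral>x. f x \<partial>\<mu>)"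
  by (intro integral_nonneg_AE) (auto simp: CK_plusD)

lemma mint_CK_finite: "\<mu> \<in> Mp \<Longrightarrow> (f :: 'a::t2_space \<Rightarrow> real) \<in> CK_plus \<Longrightarrow> mint \<mu> f < top"
  by (simp add: mint_CK)

lemma exp_neg_CK: "\<mu> \<in> Mp \<Longrightarrow> (f :: 'a::t2_space \<Rightarrow> real) \<in> CK_plus \<Longrightarrow> exp_neg (mint \<mu> f) = exp (- (\<integral>x. f x \<partial>\<mu>))"
  by (simp add: mint_CK integral_CK_nonneg)

lemma mint_mono: "(\<And>x. f x \<le> g x) \<Longrightarrow> mint \<mu> f \<le> mint \<mu> g"
  unfolding mint_def by (intro nn_integral_mono ennreal_leI)

lemma mint_add:
  assumes "\<mu> \<in> Mp" "f \<in> borel_measurable borel" "g \<in> borel_measurable borel" "\<And>x. 0 \<le> f x" "\<And>x. 0 \<le> g x"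
  shows "mint \<mu> (\<lambda>x. f x + g x) = mint \<mu> f + mint \<mu> g"
proof -
  have [measurable]: "f \<in> borel_measurable \<mu>" "g \<in> borel_measurable \<mu>"
    using assms Mp_sets[OF assms(1)] by (metis measurable_cong_sets)+
  show ?thesis using assms unfolding mint_def by (simp add: nn_integral_add)
qed

lemma exp_neg_mint_add:
  "\<mu> \<in> Mp \<Longrightarrow> f \<in> CK_plus \<Longrightarrow> g \<in> CK_plus \<Longrightarrow> exp_neg (mint \<mu> (\<lambda>x. f x + g x)) = exp_neg (mint \<mu> f) * exp_neg (mint \<mu> g)"
  by (simp add: mint_add CK_plus_measurable CK_plusD exp_neg_add)

lemma mint_CK_eq_0_iff:
  assumes "\<mu> \<in> Mp" "f \<in> CK_plus"
  shows "mint \<mu> f = 0 \<longleftrightarrow> emeasure \<mu> {x. f x \<noteq> 0} = 0"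
proof -
  have "(\<lambda>x. ennreal (f x)) \<in> borel_measurable \<mu>" using CK_plus_measurable_Mp[OF assms(2,1)] by measurable
  moreover have "{x. ennreal (f x) \<noteq> 0} = {x. f x \<noteq> 0}"
    using CK_plusD(2)[OF assms(2)] by (auto simp: ennreal_eq_0_iff order_antisym_conv)
  ultimately show ?thesis using Mp_space[OF assms(1)] by (simp add: mint_def nn_integral_0_iff)
qed

lemma topspace_vague [simp]: "topspace vague_topology = Mp"
proof -
  have "Mp \<in> {{\<mu> \<in> Mp. mint \<mu> f \<in> U} | f U. f \<in> CK_plus \<and> open U}"
    using CK_plus_zero by (intro CollectI exI[of _ "\<lambda>_. 0"] exI[of _ UNIV]) auto
  then show ?thesis unfolding vague_topology_def by auto
qed

lemma vague_subset: "{U. openin vague_topology U} \<subseteq> Pow Mp"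
  using openin_subset[of vague_topology] by auto

lemma space_Mp_borel [simp]: "space Mp_borel = Mp"
  by (simp add: Mp_borel_def space_measure_of_conv)

lemma sets_Mp_borel: "sets Mp_borel = sigma_sets Mp {U. openin vague_topology U}"
  by (simp add: Mp_borel_def sets_measure_of[OF vague_subset])

lemma openin_vague_mint: "f \<in> CK_plus \<Longrightarrow> open U \<Longrightarrow> openin vague_topology {\<mu> \<in> Mp. mint \<mu> f \<in> U}"
  unfolding vague_topology_def by (intro topology_generated_by_Basis) auto

lemma continuous_map_exp_neg_mint:
  "f \<in> CK_plus \<Longrightarrow> continuous_map vague_topology euclideanreal (\<lambda>\<mu>. exp_neg (mint \<mu> f))"
  unfolding continuous_map_def
  using openin_vague_mint[of f "exp_neg -` _"] open_vimage[OF _ continuous_on_exp_neg]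
  by (auto simp: vimage_def)

lemma continuous_map_measurable:
  "continuous_map vague_topology euclideanreal g \<Longrightarrow> g \<in> borel_measurable Mp_borel"
  unfolding Mp_borel_def continuous_map_def using vague_subset
  by (intro borel_measurableI) (auto simp: space_measure_of_conv vimage_def Int_def conj_commute intro!: sigma_sets.Basic)

lemma measurable_exp_neg_mint: "f \<in> CK_plus \<Longrightarrow> (\<lambda>\<mu>. exp_neg (mint \<mu> f)) \<in> borel_measurable Mp_borel"
  by (intro continuous_map_measurable continuous_map_exp_neg_mint)

lemma measurable_mint_CK: "f \<in> CK_plus \<Longrightarrow> (\<lambda>\<mu>. mint \<mu> f) \<in> borel_measurable Mp_borel"
  using openin_vague_mint[of f] vague_subset
  by (intro borel_measurableI) (auto simp: sets_Mp_borel vimage_def Int_def conj_commute intro!: sigma_sets.Basic)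

section \<open>Urysohn functions and exhaustion on a locally compact space\<close>

locale lcsc_space =
  fixes E_type :: "'a::{t2_space, second_countable_topology} itself"
  assumes locally_compact: "locally_compact_space (euclidean :: 'a topology)"
begin

lemma Hausdorff_space: "Hausdorff_space (euclidean :: 'a topology)"
  unfolding Hausdorff_space_def disjnt_def
  by (auto dest!: hausdorff)

lemma compact_neighbourhood:
  assumes "compact (K :: 'a set)" "open V" "K \<subseteq> V"
  obtains U where "open U" "K \<subseteq> U" "compact (closure U)" "closure U \<subseteq> V"
proof -
  have nb: "\<exists>U. open U \<and> x \<in> U \<and> compact (closure U) \<and> closure U \<subseteq> V" if "x \<in> V" for x
  proof -
    have "neighbourhood_base_of (\<lambda>A. compactin euclidean A \<and> closedin euclidean A) (euclidean :: 'a topology)"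
      using locally_compact Hausdorff_space
      by (subst locally_compact_space_neighbourhood_base_closedin[symmetric]) auto
    then obtain U A where UA: "open U" "compact A" "closed A" "x \<in> U" "U \<subseteq> A" "A \<subseteq> V"
      using \<open>x \<in> V\<close> assms(2) unfolding neighbourhood_base_of
      by (auto simp: open_openin[symmetric] closed_closedin[symmetric]) (metis)
    have "closure U \<subseteq> A" using UA closure_minimal by blast
    moreover have "compact (closure U)"
      using compact_Int_closed[OF UA(2) closed_closure, of U] calculation by (simp add: Int_absorb1)
    ultimately show ?thesis using UA by blast
  qed
  then obtain U where U: "\<And>x. x \<in> V \<Longrightarrow> open (U x) \<and> x \<in> U x \<and> compact (closure (U x)) \<and> closure (U x) \<subseteq> V"
    by metis
  have "K \<subseteq> (\<Union>x\<in>K. U x)" using U assms(3) by blast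
  from compactE_image[OF assms(1) _ this] U assms(3)
  obtain F where F: "F \<subseteq> K" "finite F" "K \<subseteq> (\<Union>x\<in>F. U x)" by blast
  show thesis
  proof (rule that)
    have "closure (\<Union>x\<in>F. U x) = (\<Union>x\<in>F. closure (U x))"
      using F(2) by (induction F) (auto simp: closure_Un)
    then show "compact (closure (\<Union>x\<in>F. U x))" "closure (\<Union>x\<in>F. U x) \<subseteq> V"
      using F U assms(3) by (auto intro!: compact_UN) blast+
    show "open (\<Union>x\<in>F. U x)" using F U assms(3) by (intro open_UN) blast
  qed (rule F(3))
qed

lemma bump:
  assumes "compact (K :: 'a set)" "open V" "K \<subseteq> V"
  obtains f where "f \<in> CK_plus" "\<And>x. f x \<le> 1" "\<And>x. x \<in> K \<Longrightarrow> f x = 1"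
    "closure {x. f x \<noteq> 0} \<subseteq> V"
proof -
  obtain U where U: "open U" "K \<subseteq> U" "compact (closure U)" "closure U \<subseteq> V"
    using compact_neighbourhood[OF assms] by metis
  have "completely_regular_space (euclidean :: 'a topology)"
    using locally_compact_regular_imp_completely_regular_space[OF locally_compact] Hausdorff_space by simp
  moreover have "compactin euclidean K" using assms by simp
  moreover have "closedin euclidean (- U)" using U by auto
  moreover have "disjnt K (- U)" using U by (auto simp: disjnt_def)
  ultimately obtain g :: "'a \<Rightarrow> real" where g: "continuous_map euclidean euclideanreal g" "g ` (- U) \<subseteq> {0}" "g ` K \<subseteq> {1}"
    by (rule Urysohn_completely_regular_compact_closed_alt)
  have cg: "continuous_on UNIV g" using g(1) by simp
  \<comment> \<open>The separating function is controlled only on \<open>K\<close> and off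
    \<open>U\<close>; clipping bounds it in between and keeps those values.\<close>
  define f where "f x = min 1 (max 0 (g x))" for x
  have sub: "{x. f x \<noteq> 0} \<subseteq> U" using g(2) by (auto simp: f_def)
  show thesis
  proof (rule that)
    show "f \<in> CK_plus"
    proof (rule CK_plusI[OF _ _ U(3)])
      show "continuous_on UNIV f" unfolding f_def by (intro continuous_intros cg)
    qed (use sub closure_subset[of U] in \<open>auto simp: f_def\<close>)
    show "closure {x. f x \<noteq> 0} \<subseteq> V" using closure_mono[OF sub] U(4) by auto
  qed (use g(3) in \<open>auto simp: f_def\<close>)
qed

text \<open>Countably many relatively compact basis sets cover the space. Bumps equal to 1 on their
  closures are combined by running maxima, which makes the sequence monotone. Being test functions,
  the \<open>h m\<close> can enter Laplace functionals where indicators of compact sets could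
  not.\<close>

lemma exhaustion:
  obtains h :: "nat \<Rightarrow> 'a \<Rightarrow> real" where "\<And>m. h m \<in> CK_plus" "\<And>m x. h m x \<le> 1" "\<And>x. incseq (\<lambda>m. h m x)"
    "\<And>K. compact K \<Longrightarrow> \<exists>m0. \<forall>m\<ge>m0. \<forall>x\<in>K. h m x = 1"
proof -
  obtain B :: "'a set set" where B: "countable B" "topological_basis B"
    using ex_countable_basis by auto
  define C where "C = insert {} {U \<in> B. compact (closure U)}"
  have "countable C" "C \<noteq> {}" using B by (auto simp: C_def)
  then obtain V :: "nat \<Rightarrow> 'a set" where V: "range V = C"
    using range_from_nat_into[OF \<open>C \<noteq> {}\<close> \<open>countable C\<close>] by metis
  have cV: "open (V i)" "compact (closure (V i))" for i :: nat
  proof -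
    have "V i \<in> C" using V by auto
    then show "open (V i)" "compact (closure (V i))"
      using topological_basis_open[OF B(2)] by (auto simp: C_def)
  qed
  have cover: "\<exists>i. x \<in> V i" for x
  proof -
    obtain U where U: "open U" "{x} \<subseteq> U" "compact (closure U)"
      by (rule compact_neighbourhood[of "{x}" UNIV]) auto
    then obtain W where W: "W \<in> B" "x \<in> W" "W \<subseteq> U" using topological_basisE[OF B(2)] by (metis insert_subset)
    have "closure W = closure U \<inter> closure W" using closure_mono[OF W(3)] by auto
    then have "compact (closure W)" using compact_Int_closed[OF U(3) closed_closure, of W] by simp
    then have "W \<in> range V" using W unfolding V C_def by auto
    then show ?thesis using W by auto
  qed
  have "\<exists>g. g \<in> CK_plus \<and> (\<forall>x. g x \<le> 1) \<and> (\<forall>x\<in>closure (V i). g x = 1)" for i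
    using bump[OF cV(2) open_UNIV, of i] by (metis top_greatest)
  then obtain g where g: "\<And>i. g i \<in> CK_plus" "\<And>i x. g i x \<le> 1" "\<And>i x. x \<in> closure (V i) \<Longrightarrow> g i x = 1"
    by metis
  define h where "h = rec_nat (g 0) (\<lambda>m k x. max (k x) (g (Suc m) x))"
  have h: "h 0 = g 0" "h (Suc m) = (\<lambda>x. max (h m x) (g (Suc m) x))" for m by (simp_all add: h_def)
  have h_ge: "g i x \<le> h m x" if "i \<le> m" for i m x
    using that by (induction m) (auto simp: h le_Suc_eq)
  have h1: "h m x \<le> 1" for m x by (induction m) (auto simp: h g)
  show thesis
  proof (rule that)
    show "h m \<in> CK_plus" for m by (induction m) (auto simp: h intro: g CK_plus_max)
    show "incseq (\<lambda>m. h m x)" for x by (intro incseq_SucI) (simp add: h)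
    show "\<exists>m0. \<forall>m\<ge>m0. \<forall>x\<in>K. h m x = 1" if K: "compact K" for K
    proof -
      have "K \<subseteq> (\<Union>i. V i)" using cover by blast
      then obtain F where F: "finite F" "K \<subseteq> (\<Union>i\<in>F. V i)"
        by (rule compactE_image[OF K cV(1)])
      show ?thesis
      proof (intro exI allI impI ballI)
        fix m x assume m: "Max (insert 0 F) \<le> m" and x: "x \<in> K"
        then obtain i where i: "i \<in> F" "x \<in> V i" using F by auto
        then have "i \<le> m" using m F(1) by simp
        then show "h m x = 1" using h_ge[of i m x] h1[of m x] g(3)[of x i] i closure_subset[of "V i"] by force
      qed
    qed
  qed (rule h1)
qed

end

section \<open>The vague topology\<close>

context lcsc_space
begin

definition finite_max :: "('a \<Rightarrow> real) list \<Rightarrow> 'a \<Rightarrow> real" where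
  "finite_max gs x = foldr (\<lambda>g. max (g x)) gs 0"

lemma finite_max_simps [simp]: "finite_max [] = (\<lambda>_. 0)" "finite_max (g # gs) = (\<lambda>x. max (g x) (finite_max gs x))"
  by (simp_all add: finite_max_def fun_eq_iff)

lemma finite_max_CK: "set gs \<subseteq> CK_plus \<Longrightarrow> finite_max gs \<in> CK_plus"
  by (induction gs) (auto intro: CK_plus_zero CK_plus_max)

lemma finite_max_ge: "g \<in> set gs \<Longrightarrow> g x \<le> finite_max gs x"
  by (induction gs) auto

lemma finite_max_le: "0 \<le> c \<Longrightarrow> (\<And>g. g \<in> set gs \<Longrightarrow> g x \<le> c) \<Longrightarrow> finite_max gs x \<le> c"
  by (induction gs) auto

lemma finite_max_mono: "set gs \<subseteq> set hs \<Longrightarrow> finite_max gs x \<le> finite_max hs x"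
proof (rule finite_max_le)
  show "0 \<le> finite_max hs x" by (induction hs) auto
qed (auto intro: finite_max_ge)

text \<open>Nonnegative rational multiples of bumps between pairs of basis sets suffice: for 0 \<le>
  r < f x, a rational level q in between is exceeded by \<open>f\<close> on a basis set V around x,
  and q times a bump that is 1 near x and vanishes off V stays below \<open>f\<close>.\<close>

lemma countable_lower_bumps:
  obtains S :: "('a \<Rightarrow> real) set" where "countable S" "S \<subseteq> CK_plus" "(\<lambda>_. 0) \<in> S"
    "\<And>f x r. f \<in> CK_plus \<Longrightarrow> r < f x \<Longrightarrow> \<exists>g\<in>S. (\<forall>y. g y \<le> f y) \<and> r < g x"
proof -
  obtain B :: "'a set set" where B: "countable B" "topological_basis B"
    using ex_countable_basis by auto
  have "\<exists>\<phi>. \<phi> \<in> CK_plus \<and> (\<forall>x. \<phi> x \<le> 1) \<and> (\<forall>x\<in>closure U. \<phi> x = 1) \<and> closure {x. \<phi> x \<noteq> 0} \<subseteq> V"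
    if "U \<in> B" "V \<in> B" "compact (closure U)" "closure U \<subseteq> V" for U V
  proof -
    have "open V" using topological_basis_open[OF B(2)] that by auto
    from bump[OF that(3) this that(4)] show ?thesis by metis
  qed
  then obtain \<phi> where \<phi>: "\<And>U V. U \<in> B \<Longrightarrow> V \<in> B \<Longrightarrow> compact (closure U) \<Longrightarrow> closure U \<subseteq> V \<Longrightarrow>
      \<phi> U V \<in> CK_plus \<and> (\<forall>x. \<phi> U V x \<le> 1) \<and> (\<forall>x\<in>closure U. \<phi> U V x = 1) \<and> closure {x. \<phi> U V x \<noteq> 0} \<subseteq> V"
    by metis
  define T where "T = {(q :: real, U, V). q \<in> \<rat> \<and> 0 \<le> q \<and> U \<in> B \<and> V \<in> B \<and> compact (closure U) \<and> closure U \<subseteq> V}"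
  define S where "S = insert (\<lambda>_. 0) ((\<lambda>(q, U, V) x. q * \<phi> U V x) ` T)"
  have "countable T"
    by (rule countable_subset[of _ "\<rat> \<times> B \<times> B"]) (auto simp: T_def B countable_rat)
  then have "countable S" by (simp add: S_def)
  moreover have "S \<subseteq> CK_plus" using \<phi> by (auto simp: S_def T_def intro: CK_plus_zero CK_plus_scale)
  moreover have "(\<lambda>_. 0) \<in> S" by (simp add: S_def)
  moreover have "\<exists>g\<in>S. (\<forall>y. g y \<le> f y) \<and> r < g x" if f: "f \<in> CK_plus" and r: "r < f x" for f x r
  proof (cases "r < 0")
    case True
    then show ?thesis using f by (intro bexI[of _ "\<lambda>_. 0"]) (auto simp: S_def CK_plusD)
  next
    case False
    obtain q where q: "q \<in> \<rat>" "r < q" "q < f x" using Rats_dense_in_real[OF r] by auto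
    have "open {y. q < f y}" using f by (intro open_Collect_less CK_plusD(1) continuous_on_const)
    then obtain V where V: "V \<in> B" "x \<in> V" "V \<subseteq> {y. q < f y}"
      using q topological_basisE[OF B(2), of "{y. q < f y}" x] by auto
    have "open V" using topological_basis_open[OF B(2)] V by auto
    then obtain U' where U': "open U'" "{x} \<subseteq> U'" "compact (closure U')" "closure U' \<subseteq> V"
      using V by (rule_tac compact_neighbourhood[of "{x}" V]) auto
    then obtain U where U: "U \<in> B" "x \<in> U" "U \<subseteq> U'"
      using topological_basisE[OF B(2), of U' x] by auto
    have cl: "closure U \<subseteq> closure U'" using U by (intro closure_mono)
    have "compact (closure U)" using compact_Int_closed[OF U'(3) closed_closure, of U] cl by (simp add: Int_absorb1)
    with U V U' cl q False have T: "(q, U, V) \<in> T" by (auto simp: T_def)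
    then have p: "\<phi> U V \<in> CK_plus" "\<And>x. \<phi> U V x \<le> 1" "\<phi> U V x = 1" "closure {x. \<phi> U V x \<noteq> 0} \<subseteq> V"
      using \<phi>[of U V] U closure_subset[of U] by (auto simp: T_def)
    have "q * \<phi> U V y \<le> f y" for y
    proof (cases "y \<in> V")
      case True
      then have "q * \<phi> U V y \<le> q * 1" using p q False by (intro mult_left_mono) auto
      also have "\<dots> \<le> f y" using True V by auto
      finally show ?thesis .
    next
      case False
      then have "\<phi> U V y = 0" using p(4) closure_subset[of "{x. \<phi> U V x \<noteq> 0}"] by blast
      then show ?thesis using f by (simp add: CK_plusD)
    qed
    then show ?thesis using T q p(3)
      by (intro bexI[of _ "\<lambda>x. q * \<phi> U V x"]) (auto simp: S_def intro!: rev_image_eqI[of "(q, U, V)"])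
  qed
  ultimately show thesis by (rule that)
qed

lemma mint_SUP:
  assumes "\<mu> \<in> Mp" "incseq u" "\<And>n. u n \<in> CK_plus" "\<And>x. (\<lambda>n. u n x) \<longlonglongrightarrow> f x"
  shows "mint \<mu> f = (SUP n. mint \<mu> (u n))"
proof -
  have "(\<lambda>n. mint \<mu> (u n)) \<longlonglongrightarrow> mint \<mu> f"
    unfolding mint_def
    using assms by (intro nn_integral_LIMSEQ)
      (auto simp: incseq_def le_fun_def ennreal_leI CK_plus_measurable_Mp intro: measurable_compose[OF CK_plus_measurable_Mp measurable_ennreal])
  moreover have "(\<lambda>n. mint \<mu> (u n)) \<longlonglongrightarrow> (SUP n. mint \<mu> (u n))"
    using assms(2) by (intro LIMSEQ_SUP) (auto simp: incseq_def le_fun_def intro!: mint_mono)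
  ultimately show ?thesis by (rule LIMSEQ_unique)
qed

text \<open>By the last property, and by its application to \<open>d k - f\<close> for \<open>f \<le> d k\<close>, the integrals of
  the \<open>d k\<close> determine the vague topology.\<close>

lemma countable_test_functions:
  obtains d :: "nat \<Rightarrow> 'a \<Rightarrow> real" where "\<And>k. d k \<in> CK_plus" "\<exists>k. d k = (\<lambda>_. 0)"
    "\<And>f. f \<in> CK_plus \<Longrightarrow> \<exists>k. \<forall>x. f x \<le> d k x"
    "\<And>f \<mu>. f \<in> CK_plus \<Longrightarrow> \<mu> \<in> Mp \<Longrightarrow> mint \<mu> f = (SUP k\<in>{k. \<forall>x. d k x \<le> f x}. mint \<mu> (d k))"
proof -
  obtain S :: "('a \<Rightarrow> real) set" where S: "countable S" "S \<subseteq> CK_plus" "(\<lambda>_. 0) \<in> S"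
    "\<And>f x r. f \<in> CK_plus \<Longrightarrow> r < f x \<Longrightarrow> \<exists>g\<in>S. (\<forall>y. g y \<le> f y) \<and> r < g x"
    using countable_lower_bumps by metis
  obtain h :: "nat \<Rightarrow> 'a \<Rightarrow> real" where h: "\<And>m. h m \<in> CK_plus"
    "\<And>K. compact K \<Longrightarrow> \<exists>m0. \<forall>m\<ge>m0. \<forall>x\<in>K. h m x = 1"
    using exhaustion by metis
  \<comment> \<open>Finite maxima of lower bumps give increasing approximations from below;
    multiples of the exhausting functions give a member above any test function.\<close>
  define D where "D = finite_max ` lists S \<union> range (\<lambda>(n::nat, m) x. real n * h m x)"
  have "countable D" unfolding D_def using S(1) by auto
  moreover have "D \<noteq> {}" by (auto simp: D_def)
  ultimately obtain d :: "nat \<Rightarrow> 'a \<Rightarrow> real" where d: "range d = D"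
    using range_from_nat_into by metis
  have DCK: "D \<subseteq> CK_plus"
    using S(2) h by (auto simp: D_def lists_eq_set intro!: finite_max_CK CK_plus_scale)
  have dom: "\<exists>k. \<forall>x. f x \<le> d k x" if f: "f \<in> CK_plus" for f
  proof -
    obtain C where C: "0 < C" "\<And>x. f x \<le> C" using CK_plus_bounded[OF f] by metis
    obtain n :: nat where n: "C \<le> real n" using real_arch_simple by auto
    obtain m where m: "\<forall>x\<in>closure {x. f x \<noteq> 0}. h m x = 1" using h(2)[OF CK_plusD(3)[OF f]] by auto
    have le: "f x \<le> real n * h m x" for x
    proof (cases "f x = 0")
      case True
      then show ?thesis using CK_plusD(2)[OF h(1)] by simp
    next
      case False
      then have "h m x = 1" using m closure_subset[of "{x. f x \<noteq> 0}"] by auto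
      then show ?thesis using C(2)[of x] n by simp
    qed
    have "(\<lambda>x. real n * h m x) \<in> range d" unfolding d D_def by auto
    then obtain k where "d k = (\<lambda>x. real n * h m x)" by (metis imageE)
    then show ?thesis using le by (intro exI[of _ k]) simp
  qed
  have sup: "mint \<mu> f = (SUP k\<in>{k. \<forall>x. d k x \<le> f x}. mint \<mu> (d k))" if f: "f \<in> CK_plus" and \<mu>: "\<mu> \<in> Mp" for f \<mu>
  proof (rule antisym)
    define Sf where "Sf = {g \<in> S. \<forall>y. g y \<le> f y}"
    have "countable Sf" "Sf \<noteq> {}" using S f by (auto simp: Sf_def CK_plusD)
    then obtain g :: "nat \<Rightarrow> 'a \<Rightarrow> real" where g: "range g = Sf" using range_from_nat_into by metis
    define u where "u n = finite_max (map g [0..<n])" for n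
    have gS: "g i \<in> S" "g i y \<le> f y" for i y using g by (auto simp: Sf_def)
    have uD: "u n \<in> D" for n using gS
      unfolding D_def u_def by (intro UnI1 image_eqI[OF refl]) (auto simp: lists_eq_set)
    have ule: "u n x \<le> f x" for n x
      unfolding u_def using gS f by (intro finite_max_le) (auto simp: CK_plusD)
    have inc: "incseq u" unfolding u_def
      by (intro incseq_SucI le_funI finite_max_mono) auto
    have lim: "(\<lambda>n. u n x) \<longlonglongrightarrow> f x" for x
    proof (rule order_tendstoI)
      fix r assume "r < f x"
      then obtain g' where "g' \<in> Sf" "r < g' x" using S(4)[OF f] unfolding Sf_def by blast
      then obtain i where i: "r < g i x" using g by (metis imageE)
      have "r < u n x" if "n \<ge> Suc i" for n
        using i that finite_max_ge[of "g i" "map g [0..<n]" x] by (auto simp: u_def)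
      then show "eventually (\<lambda>n. r < u n x) sequentially" by (rule eventually_sequentiallyI)
    next
      fix a assume "f x < a"
      then show "eventually (\<lambda>n. u n x < a) sequentially"
        by (intro always_eventually allI le_less_trans[OF ule])
    qed
    have "mint \<mu> f = (SUP n. mint \<mu> (u n))"
      using uD DCK by (intro mint_SUP \<mu> inc lim) auto
    also have "\<dots> \<le> (SUP k\<in>{k. \<forall>x. d k x \<le> f x}. mint \<mu> (d k))"
    proof (rule SUP_least)
      fix n
      obtain k where "d k = u n" using uD[of n] d by (metis imageE)
      then show "mint \<mu> (u n) \<le> (SUP k\<in>{k. \<forall>x. d k x \<le> f x}. mint \<mu> (d k))"
        using ule by (intro SUP_upper2[of k]) auto
    qed
    finally show "mint \<mu> f \<le> (SUP k\<in>{k. \<forall>x. d k x \<le> f x}. mint \<mu> (d k))" .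
    show "(SUP k\<in>{k. \<forall>x. d k x \<le> f x}. mint \<mu> (d k)) \<le> mint \<mu> f"
      by (intro SUP_least mint_mono) auto
  qed
  have dCK: "d k \<in> CK_plus" for k using d DCK by auto
  have "(\<lambda>_. 0) \<in> range d"
    unfolding d D_def by (intro UnI1 image_eqI[of _ _ "[]"]) auto
  then have "\<exists>k. d k = (\<lambda>_. 0)" by (metis imageE)
  then show thesis by (rule that[OF dCK _ dom sup])
qed

definition test_functions :: "(nat \<Rightarrow> 'a \<Rightarrow> real) \<Rightarrow> bool" where
  "test_functions d \<longleftrightarrow> (\<forall>k. d k \<in> CK_plus) \<and> (\<exists>k. d k = (\<lambda>_. 0)) \<and>
    (\<forall>f\<in>CK_plus. \<exists>k. \<forall>x. f x \<le> d k x) \<and>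
    (\<forall>f\<in>CK_plus. \<forall>\<mu>\<in>Mp. mint \<mu> f = (SUP k\<in>{k. \<forall>x. d k x \<le> f x}. mint \<mu> (d k)))"

definition coordinate :: "nat \<Rightarrow> 'a \<Rightarrow> real" where
  "coordinate = (SOME d. test_functions d)"

lemma test_functions_coordinate: "test_functions coordinate"
proof -
  obtain d :: "nat \<Rightarrow> 'a \<Rightarrow> real" where d: "\<And>k. d k \<in> CK_plus" "\<exists>k. d k = (\<lambda>_. 0)"
    "\<And>f. f \<in> CK_plus \<Longrightarrow> \<exists>k. \<forall>x. f x \<le> d k x"
    "\<And>f \<mu>. f \<in> CK_plus \<Longrightarrow> \<mu> \<in> Mp \<Longrightarrow> mint \<mu> f = (SUP k\<in>{k. \<forall>x. d k x \<le> f x}. mint \<mu> (d k))"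
    by (rule countable_test_functions) (rule that)
  have "test_functions d"
    unfolding test_functions_def by (intro conjI ballI allI d) assumption+
  then show ?thesis unfolding coordinate_def by (rule someI[of test_functions d])
qed

lemma coordinate:
  shows "coordinate k \<in> CK_plus"
    and "\<exists>k. coordinate k = (\<lambda>_. 0)"
    and "f \<in> CK_plus \<Longrightarrow> \<exists>k. \<forall>x. f x \<le> coordinate k x"
    and "f \<in> CK_plus \<Longrightarrow> \<mu> \<in> Mp \<Longrightarrow> mint \<mu> f = (SUP k\<in>{k. \<forall>x. coordinate k x \<le> f x}. mint \<mu> (coordinate k))"
  using test_functions_coordinate unfolding test_functions_def by blast+

text \<open>A map into a countable product of lines; every vaguely open set is the preimage of an
  open set there. Measurability and convergence can therefore be checked on countably many
  integrals.\<close>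

definition coordinates :: "'a measure \<Rightarrow> nat \<Rightarrow> real" where
  "coordinates \<mu> k = (\<integral>x. coordinate k x \<partial>\<mu>)"

text \<open>A strict lower bound passes from a supremum to one of its members. Negative
  \<open>a\<close> is settled by the zero coordinate, because conversion to \<open>ennreal\<close>
  would replace \<open>a\<close> by 0.\<close>

lemma integral_greater_iff:
  assumes f: "f \<in> CK_plus" and \<mu>: "\<mu> \<in> Mp"
  shows "a < (\<integral>x. f x \<partial>\<mu>) \<longleftrightarrow> (\<exists>k. (\<forall>x. coordinate k x \<le> f x) \<and> a < coordinates \<mu> k)"
proof
  assume a: "a < (\<integral>x. f x \<partial>\<mu>)"
  show "\<exists>k. (\<forall>x. coordinate k x \<le> f x) \<and> a < coordinates \<mu> k"
  proof (cases "a < 0")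
    case True
    obtain k where "coordinate k = (\<lambda>_. 0)" using coordinate(2) by auto
    then have "\<forall>x. coordinate k x \<le> f x" using f by (simp add: CK_plusD)
    moreover have "0 \<le> coordinates \<mu> k" unfolding coordinates_def by (rule integral_CK_nonneg[OF coordinate(1)])
    ultimately show ?thesis using True by (intro exI[of _ k]) auto
  next
    case False
    then have "ennreal a < mint \<mu> f" using a \<mu> f by (simp add: mint_CK ennreal_lessI)
    then obtain k where k: "\<forall>x. coordinate k x \<le> f x" "ennreal a < mint \<mu> (coordinate k)"
      unfolding coordinate(4)[OF f \<mu>] less_SUP_iff by auto
    then show ?thesis using False \<mu> coordinate(1)
      by (intro exI[of _ k]) (auto simp: mint_CK coordinates_def ennreal_less_iff)
  qed
next
  assume "\<exists>k. (\<forall>x. coordinate k x \<le> f x) \<and> a < coordinates \<mu> k"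
  then obtain k where k: "\<forall>x. coordinate k x \<le> f x" "a < coordinates \<mu> k" by auto
  have "coordinates \<mu> k \<le> (\<integral>x. f x \<partial>\<mu>)"
    unfolding coordinates_def using k by (intro integral_mono integrable_CK \<mu> coordinate f) auto
  then show "a < (\<integral>x. f x \<partial>\<mu>)" using k by simp
qed

text \<open>\<open>L\<close> is chosen before the measure and the bound: only then do the conditions
  on the right define an open set of the product space that is the same for all measures.\<close>

lemma integral_less_iff:
  assumes f: "f \<in> CK_plus" and h: "\<And>x. f x \<le> coordinate m x"
  shows "\<exists>L. \<forall>\<mu>\<in>Mp. \<forall>b.
    (\<integral>x. f x \<partial>\<mu>) < b \<longleftrightarrow> (\<exists>l\<in>L. coordinates \<mu> m - coordinates \<mu> l < b)"
proof -
  define g where "g x = coordinate m x - f x" for x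
  have g: "g \<in> CK_plus"
  proof (rule CK_plus_dominated[OF coordinate(1)[of m]])
    show "continuous_on UNIV g" unfolding g_def
      by (intro continuous_on_diff CK_plusD(1) f coordinate)
    show "g x = 0" if "coordinate m x = 0" for x 
      using that h[of x] CK_plusD(2)[OF f, of x] by (simp add: g_def)
  qed (use h in \<open>simp add: g_def\<close>)
  show ?thesis
  proof (intro exI[of _ "{l. \<forall>x. coordinate l x \<le> g x}"] ballI allI)
    fix \<mu> :: "'a measure" and b assume \<mu>: "\<mu> \<in> Mp"
    have "(\<integral>x. g x \<partial>\<mu>) = coordinates \<mu> m - (\<integral>x. f x \<partial>\<mu>)"
      unfolding g_def coordinates_def
      by (intro Bochner_Integration.integral_diff integrable_CK \<mu> f coordinate)
    then have "(\<integral>x. f x \<partial>\<mu>) < b \<longleftrightarrow> coordinates \<mu> m - b < (\<integral>x. g x \<partial>\<mu>)" by auto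
    then show "(\<integral>x. f x \<partial>\<mu>) < b \<longleftrightarrow> (\<exists>l\<in>{l. \<forall>x. coordinate l x \<le> g x}. coordinates \<mu> m - coordinates \<mu> l < b)"
      unfolding integral_greater_iff[OF g \<mu>] by (auto simp: algebra_simps)
  qed
qed

lemma open_coordinate [intro]: "open {x :: nat \<Rightarrow> real. a < x k}" "open {x :: nat \<Rightarrow> real. x k - x l < a}"
  by (intro open_Collect_less continuous_intros continuous_on_product_coordinates)+

text \<open>Unions and finite intersections pass through preimages, so only subbasic sets matter.
  There the integral is enclosed in an open interval, and both ends are tested by open conditions on
  the coordinates.\<close>

lemma vague_pullback:
  assumes "openin vague_topology (U :: 'a measure set)"
  obtains V where "open V" "U = {\<mu> \<in> Mp. coordinates \<mu> \<in> V}"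
proof -
  have "generate_topology_on {{\<mu> \<in> Mp. mint \<mu> f \<in> U} | f U. f \<in> CK_plus \<and> open U} U"
    using assms unfolding vague_topology_def openin_topology_generated_by_iff .
  then have "\<exists>V. open V \<and> U = {\<mu> \<in> Mp. coordinates \<mu> \<in> V}"
  proof induction
    case Empty
    show ?case by (rule exI[of _ "{}"]) auto
  next
    case (Int a b)
    then obtain V W where "open V" "open W" "a = {\<mu> \<in> Mp. coordinates \<mu> \<in> V}" "b = {\<mu> \<in> Mp. coordinates \<mu> \<in> W}"
      by auto
    then show ?case by (intro exI[of _ "V \<inter> W"]) auto
  next
    case (UN K)
    then have "\<forall>k\<in>K. \<exists>V. open V \<and> k = {\<mu> \<in> Mp. coordinates \<mu> \<in> V}" by blast
    from bchoice[OF this] obtain V where "\<forall>k\<in>K. open (V k) \<and> k = {\<mu> \<in> Mp. coordinates \<mu> \<in> V k}" ..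
    then have "open (\<Union>k\<in>K. V k) \<and> \<Union>K = {\<mu> \<in> Mp. coordinates \<mu> \<in> (\<Union>k\<in>K. V k)}" by blast
    then show ?case by blast
  next
    case (Basis s)
    then obtain f W where s: "s = {\<mu> \<in> Mp. mint \<mu> f \<in> W}" "f \<in> CK_plus" "open W" by auto
    obtain m where m: "\<And>x. f x \<le> coordinate m x" using coordinate(3)[OF s(2)] by auto
    obtain L where "\<forall>\<mu>\<in>Mp. \<forall>b.
      (\<integral>x. f x \<partial>\<mu>) < b \<longleftrightarrow> (\<exists>l\<in>L. coordinates \<mu> m - coordinates \<mu> l < b)"
      using integral_less_iff[OF s(2) m] ..
    note L = this[rule_format]
    define W' where "W' = ennreal -` W"
    have oW': "open W'" unfolding W'_def using s(3) by (intro open_vimage continuous_on_ennreal continuous_on_id)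
    define VL where "VL a = (\<Union>k\<in>{k. \<forall>x. coordinate k x \<le> f x}. {x :: nat \<Rightarrow> real. a < x k})" for a
    define VU where "VU b = (\<Union>l\<in>L. {x :: nat \<Rightarrow> real. x m - x l < b})" for b
    define V where "V = (\<Union>(a, b)\<in>{(a, b). {a<..<b} \<subseteq> W'}. VL a \<inter> VU b)"
    have "open (VL a)" "open (VU b)" for a b
      unfolding VL_def VU_def by (auto intro: open_UN)
    then have "open V" unfolding V_def by (auto intro!: open_UN open_Int)
    moreover have "mint \<mu> f \<in> W \<longleftrightarrow> coordinates \<mu> \<in> V" if \<mu>: "\<mu> \<in> Mp" for \<mu>
    proof -
      have "mint \<mu> f \<in> W \<longleftrightarrow> (\<integral>x. f x \<partial>\<mu>) \<in> W'" using s(2) \<mu> by (simp add: W'_def mint_CK)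
      also have "\<dots> \<longleftrightarrow> (\<exists>a b. {a<..<b} \<subseteq> W' \<and> a < (\<integral>x. f x \<partial>\<mu>) \<and> (\<integral>x. f x \<partial>\<mu>) < b)"
      proof
        assume "(\<integral>x. f x \<partial>\<mu>) \<in> W'"
        then obtain e where "e > 0" "ball (\<integral>x. f x \<partial>\<mu>) e \<subseteq> W'" using oW' open_contains_ball by metis
        then show "\<exists>a b. {a<..<b} \<subseteq> W' \<and> a < (\<integral>x. f x \<partial>\<mu>) \<and> (\<integral>x. f x \<partial>\<mu>) < b"
          by (intro exI[of _ "(\<integral>x. f x \<partial>\<mu>) - e"] exI[of _ "(\<integral>x. f x \<partial>\<mu>) + e"]) (simp add: ball_eq_greaterThanLessThan)
      qed auto
      also have "\<dots> \<longleftrightarrow> coordinates \<mu> \<in> V"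
        unfolding integral_greater_iff[OF s(2) \<mu>] L[OF \<mu>] V_def VL_def VU_def by blast
      finally show ?thesis .
    qed
    ultimately show ?case by (intro exI[of _ V]) (auto simp: s(1))
  qed
  then show thesis using that by auto
qed

text \<open>Vaguely open sets include uncountable unions of subbasic sets, so testing the latter
  does not suffice by itself. Pulling back from a countable product, where coordinatewise
  measurability is enough, removes the difficulty.\<close>

lemma measurable_Mp_borelI:
  assumes "\<And>\<omega>. \<omega> \<in> space M \<Longrightarrow> X \<omega> \<in> (Mp :: 'a measure set)"
    and "\<And>f. f \<in> CK_plus \<Longrightarrow> (\<lambda>\<omega>. mint (X \<omega>) f) \<in> borel_measurable M"
  shows "X \<in> measurable M Mp_borel"
proof (rule measurable_sigma_sets[OF sets_Mp_borel vague_subset])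
  show "X \<in> space M \<rightarrow> Mp" using assms(1) by auto
  have "(\<lambda>\<omega>. enn2real (mint (X \<omega>) (coordinate k))) \<in> borel_measurable M" for k
    using assms(2)[OF coordinate(1)] by measurable
  then have "(\<lambda>\<omega>. coordinates (X \<omega>) k) \<in> borel_measurable M" for k
    by (rule measurable_cong[THEN iffD1, rotated])
      (simp add: assms(1) mint_CK coordinate(1) coordinates_def integral_CK_nonneg)
  then have m: "(\<lambda>\<omega>. coordinates (X \<omega>)) \<in> borel_measurable M"
    by (rule measurable_coordinatewise_then_product)
  fix U :: "'a measure set" assume "U \<in> {U. openin vague_topology U}"
  then obtain V where V: "open V" "U = {\<mu> \<in> Mp. coordinates \<mu> \<in> V}" using vague_pullback by auto
  have "X -` U \<inter> space M = (\<lambda>\<omega>. coordinates (X \<omega>)) -` V \<inter> space M" using V assms(1) by auto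
  also have "\<dots> \<in> sets M" using m V(1) by (intro measurable_sets[OF m]) auto
  finally show "X -` U \<inter> space M \<in> sets M" .
qed

text \<open>Stated for arbitrary filters because cluster points arise along refined filters.
  Convergence of the coordinates forces the measures into every vague neighbourhood of the
  limit.\<close>

lemma tendsto_continuous_map:
  fixes g :: "'a measure \<Rightarrow> real"
  assumes g: "continuous_map vague_topology euclideanreal g" and \<mu>: "\<mu> \<in> Mp" "\<And>n. \<nu> n \<in> Mp"
    and lim: "\<And>f. f \<in> CK_plus \<Longrightarrow> ((\<lambda>n. \<integral>x. f x \<partial>\<nu> n) \<longlongrightarrow> (\<integral>x. f x \<partial>\<mu>)) F"
  shows "((\<lambda>n. g (\<nu> n)) \<longlongrightarrow> g \<mu>) F"
proof (rule topological_tendstoI)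
  fix S :: "real set" assume S: "open S" "g \<mu> \<in> S"
  have nhd: "eventually (\<lambda>n. \<nu> n \<in> U) F" if U: "openin vague_topology U" "\<mu> \<in> U" for U
  proof -
    obtain V where V: "open V" "U = {\<mu> \<in> Mp. coordinates \<mu> \<in> V}" using vague_pullback[OF U(1)] by metis
    have "((\<lambda>n. coordinates (\<nu> n)) \<longlongrightarrow> coordinates \<mu>) F"
      using lim[OF coordinate(1)]
        limitin_componentwise[of "\<lambda>_::nat. euclideanreal" UNIV "\<lambda>n. coordinates (\<nu> n)" "coordinates \<mu>" F]
      by (simp add: coordinates_def euclidean_product_topology)
    then show ?thesis using V U(2) \<mu>(2) by (auto dest: topological_tendstoD)
  qed
  have "openin vague_topology {x \<in> Mp. g x \<in> S}"
    using g S by (auto simp: continuous_map_def)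
  from nhd[OF this] have "eventually (\<lambda>n. \<nu> n \<in> {x \<in> Mp. g x \<in> S}) F" using S \<mu> by simp
  then show "eventually (\<lambda>n. g (\<nu> n) \<in> S) F" by eventually_elim auto
qed

end

section \<open>Sums of measures and uniqueness of Laplace functionals\<close>

text \<open>Writing the outer sum as an integral over a counting measure treats finite and countable
  sums of measures at once and turns the supremum step into monotone convergence.\<close>

lemma nn_integral_measure_sum:
  fixes N :: "'x measure" and m :: "'i \<Rightarrow> 'x measure"
  assumes sets: "\<And>i. i \<in> J \<Longrightarrow> sets (m i) = sets N"
    and emeasure: "\<And>A. A \<in> sets N \<Longrightarrow> emeasure N A = (\<integral>\<^sup>+i. emeasure (m i) A \<partial>count_space J)"
    and f: "f \<in> borel_measurable N"
  shows "(\<integral>\<^sup>+x. f x \<partial>N) = (\<integral>\<^sup>+i. (\<integral>\<^sup>+x. f x \<partial>m i) \<partial>count_space J)"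
proof -
  have ms: "g \<in> borel_measurable (m i)" if "g \<in> borel_measurable N" "i \<in> J" for g :: "'x \<Rightarrow> ennreal" and i
    using that sets by (metis measurable_cong_sets)
  have sp: "space (m i) = space N" if "i \<in> J" for i using sets[OF that] by (rule sets_eq_imp_space_eq)
  show ?thesis using f
  proof (induction rule: borel_measurable_induct)
    case (cong f g)
    then have "(\<integral>\<^sup>+i. (\<integral>\<^sup>+x. f x \<partial>m i) \<partial>count_space J) = (\<integral>\<^sup>+i. (\<integral>\<^sup>+x. g x \<partial>m i) \<partial>count_space J)"
      using sp by (intro nn_integral_cong) simp
    with cong show ?case by (simp cong: nn_integral_cong)
  next
    case (set A)
    have "(\<integral>\<^sup>+i. (\<integral>\<^sup>+x. indicator A x \<partial>m i) \<partial>count_space J) = (\<integral>\<^sup>+i. emeasure (m i) A \<partial>count_space J)"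
      using set sets by (intro nn_integral_cong) simp
    then show ?case using set emeasure by simp
  next
    case (mult u c)
    have "(\<integral>\<^sup>+i. (\<integral>\<^sup>+x. c * u x \<partial>m i) \<partial>count_space J) = (\<integral>\<^sup>+i. c * (\<integral>\<^sup>+x. u x \<partial>m i) \<partial>count_space J)"
      using ms[OF \<open>u \<in> borel_measurable N\<close>] by (intro nn_integral_cong nn_integral_cmult) simp
    then show ?case using mult by (simp add: nn_integral_cmult)
  next
    case (add u v)
    have "(\<integral>\<^sup>+i. (\<integral>\<^sup>+x. v x + u x \<partial>m i) \<partial>count_space J)
        = (\<integral>\<^sup>+i. (\<integral>\<^sup>+x. v x \<partial>m i) + (\<integral>\<^sup>+x. u x \<partial>m i) \<partial>count_space J)"
      using ms[OF \<open>u \<in> borel_measurable N\<close>] ms[OF \<open>v \<in> borel_measurable N\<close>] by (intro nn_integral_cong nn_integral_add) simp_all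
    then show ?case using add by (simp add: nn_integral_add)
  next
    case (seq U)
    have eq: "(SUP j. U j) x = (SUP j. U j x)" for x by (simp add: image_comp)
    have "(\<integral>\<^sup>+x. (SUP j. U j) x \<partial>N) = (SUP j. (\<integral>\<^sup>+x. U j x \<partial>N))"
      unfolding eq using seq by (intro nn_integral_monotone_convergence_SUP) auto
    also have "\<dots> = (SUP j. (\<integral>\<^sup>+i. (\<integral>\<^sup>+x. U j x \<partial>m i) \<partial>count_space J))"
      using seq by simp
    also have "\<dots> = (\<integral>\<^sup>+i. (SUP j. (\<integral>\<^sup>+x. U j x \<partial>m i)) \<partial>count_space J)"
      by (intro nn_integral_monotone_convergence_SUP[symmetric] incseq_SucI le_funI nn_integral_mono)
        (use incseq_SucD[OF \<open>incseq U\<close>] in \<open>auto simp: le_fun_def\<close>)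
    also have "\<dots> = (\<integral>\<^sup>+i. (\<integral>\<^sup>+x. (SUP j. U j) x \<partial>m i) \<partial>count_space J)"
      unfolding eq using seq(1)
      by (intro nn_integral_cong nn_integral_monotone_convergence_SUP[symmetric] \<open>incseq U\<close> ms) auto
    finally show ?case .
  qed
qed

lemma countable_measure_sum:
  fixes S :: "'x measure"
  assumes sets: "\<And>i::nat. sets (m i) = sets S"
  obtains N where "sets N = sets S" "\<And>A. A \<in> sets S \<Longrightarrow> emeasure N A = (\<Sum>i. emeasure (m i) A)"
    "\<And>f. f \<in> borel_measurable S \<Longrightarrow> (\<integral>\<^sup>+x. f x \<partial>N) = (\<Sum>i. \<integral>\<^sup>+x. f x \<partial>m i)"
proof -
  define N where "N = measure_of (space S) (sets S) (\<lambda>A. \<Sum>i. emeasure (m i) A)"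
  have sN: "sets N = sets S" by (simp add: N_def)
  have eN: "emeasure N A = (\<Sum>i. emeasure (m i) A)" if "A \<in> sets S" for A
    unfolding N_def
  proof (rule emeasure_measure_of_sigma)
    show "countably_additive (sets S) (\<lambda>A. \<Sum>i. emeasure (m i) A)"
      unfolding countably_additive_def
    proof (intro allI impI)
      fix F :: "nat \<Rightarrow> 'x set"
      assume F: "range F \<subseteq> sets S" "disjoint_family F" "(\<Union>i. F i) \<in> sets S"
      have "(\<Sum>n. \<Sum>i. emeasure (m i) (F n)) = (\<Sum>i. \<Sum>n. emeasure (m i) (F n))"
        using nn_integral_suminf[of "\<lambda>i n. emeasure (m i) (F n)" "count_space UNIV"]
        by (simp add: nn_integral_count_space_nat)
      also have "\<dots> = (\<Sum>i. emeasure (m i) (\<Union>n. F n))"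
        using F sets by (intro suminf_cong suminf_emeasure) auto
      finally show "(\<Sum>n. \<Sum>i. emeasure (m i) (F n)) = (\<Sum>i. emeasure (m i) (\<Union>n. F n))" .
    qed
  qed (use that in \<open>auto simp: positive_def sets.sigma_algebra_axioms\<close>)
  have "(\<integral>\<^sup>+x. f x \<partial>N) = (\<Sum>i. \<integral>\<^sup>+x. f x \<partial>m i)" if "f \<in> borel_measurable S" for f
  proof -
    have "f \<in> borel_measurable N" using that sN by (metis measurable_cong_sets)
    then show ?thesis
      using nn_integral_measure_sum[of UNIV m N f] sets sN eN by (simp add: nn_integral_count_space_nat)
  qed
  with sN eN show thesis by (rule that)
qed

lemma nn_integral_sum_measure:
  assumes "finite J" "\<And>i. i \<in> J \<Longrightarrow> sets (m i) = sets S" "f \<in> borel_measurable S"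
  shows "(\<integral>\<^sup>+x. f x \<partial>sum_measure S m J) = (\<Sum>i\<in>J. \<integral>\<^sup>+x. f x \<partial>m i)"
proof -
  have "f \<in> borel_measurable (sum_measure S m J)" 
    using assms(3) by (metis measurable_cong_sets sets_sum_measure)
  then show ?thesis
    using nn_integral_measure_sum[of J m "sum_measure S m J" f] assms
    by (simp add: nn_integral_count_space_finite emeasure_sum_measure)
qed

lemma ramp_tendsto_indicator:
  "(\<lambda>n. min 1 (real n * max 0 (y - a))) \<longlonglongrightarrow> indicat_real {a<..} y"
proof (cases "a < y")
  case True
  obtain N :: nat where N: "1 / (y - a) < real N" using reals_Archimedean2 by blast
  have "min 1 (real n * max 0 (y - a)) = 1" if "n \<ge> N" for n
  proof -
    have "1 / (y - a) \<le> real n" using N that by linarith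
    then show ?thesis using True by (simp add: field_simps)
  qed
  then show ?thesis using True by (intro tendsto_eventually eventually_sequentiallyI[of N]) auto
qed simp

context lcsc_space
begin

definition lap :: "('a \<Rightarrow> real) \<Rightarrow> 'a measure \<Rightarrow> real" where
  "lap f \<mu> = exp_neg (mint \<mu> f)"

lemma lap_bounds [simp]: "0 \<le> lap f \<mu>" "lap f \<mu> \<le> 1" "\<bar>lap f \<mu>\<bar> \<le> 1"
  by (simp_all add: lap_def)

lemma lap_zero [simp]: "lap (\<lambda>_. 0) \<mu> = 1"
  by (simp add: lap_def mint_def)

lemma measurable_lap: "f \<in> CK_plus \<Longrightarrow> lap f \<in> borel_measurable Mp_borel"
  unfolding lap_def by (rule measurable_exp_neg_mint)

lemma continuous_map_lap: "f \<in> CK_plus \<Longrightarrow> continuous_map vague_topology euclideanreal (lap f)"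
  unfolding lap_def by (rule continuous_map_exp_neg_mint)

lemma lap_add: "\<mu> \<in> Mp \<Longrightarrow> f \<in> CK_plus \<Longrightarrow> g \<in> CK_plus \<Longrightarrow> lap (\<lambda>x. f x + g x) \<mu> = lap f \<mu> * lap g \<mu>"
  unfolding lap_def by (rule exp_neg_mint_add)

lemma laplace_eq_lap: "laplace P N f = (\<integral>\<omega>. lap f (N \<omega>) \<partial>P)"
  by (simp add: laplace_def lap_def)

text \<open>On test functions \<open>mint\<close> is finite and hence recovered from
  \<open>lap\<close> by a logarithm. A \<sigma>-field that measures every \<open>lap f\<close>
  therefore measures all the integrals that generate the Borel field.\<close>

lemma sets_Mp_borel_subset:
  assumes G: "G \<subseteq> Pow Mp" and lap: "\<And>f a. f \<in> CK_plus \<Longrightarrow> {\<mu> \<in> Mp. a < lap f \<mu>} \<in> sigma_sets Mp G"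
  shows "sets Mp_borel \<subseteq> sigma_sets Mp G"
proof -
  have "(\<lambda>\<mu>. \<mu>) \<in> measurable (sigma Mp G) Mp_borel"
  proof (rule measurable_Mp_borelI)
    fix f :: "'a \<Rightarrow> real" assume f: "f \<in> CK_plus"
    have "lap f \<in> borel_measurable (sigma Mp G)"
      using lap[OF f] G by (intro borel_measurableI_greater) (simp add: space_measure_of_conv)
    then have "(\<lambda>\<mu>. ennreal (- ln (lap f \<mu>))) \<in> borel_measurable (sigma Mp G)" by measurable
    then show "(\<lambda>\<mu>. mint \<mu> f) \<in> borel_measurable (sigma Mp G)"
      by (rule measurable_cong[THEN iffD1, rotated])
        (simp add: space_measure_of_conv lap_def f mint_CK integral_CK_nonneg)
  qed (simp add: space_measure_of_conv)
  from measurable_sets[OF this] show ?thesis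
    using G sets.sets_into_space[of _ "Mp_borel :: 'a measure measure"]
    by (auto simp: space_measure_of_conv Int_absorb2)
qed

text \<open>Products of functions \<open>lap f\<close> are of the same form, so equality of
  transforms extends to polynomials in finitely many of them, by Bernstein approximation to
  continuous functions, and by ramps to indicators of superlevel sets, whose finite intersections
  are a generating \<pi>-system.\<close>

theorem laplace_unique:
  fixes M1 M2 :: "'a measure measure"
  assumes fin: "finite_measure M1" "finite_measure M2"
    and sets: "sets M1 = sets Mp_borel" "sets M2 = sets Mp_borel"
    and eq: "\<And>f. f \<in> CK_plus \<Longrightarrow> (\<integral>\<mu>. lap f \<mu> \<partial>M1) = (\<integral>\<mu>. lap f \<mu> \<partial>M2)"
  shows "M1 = M2"
proof -
  interpret M1: finite_measure M1 by fact
  interpret M2: finite_measure M2 by fact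
  have sp: "space M1 = Mp" "space M2 = Mp"
    using sets[THEN sets_eq_imp_space_eq] by simp_all
  have meas: "f \<in> borel_measurable M1" "f \<in> borel_measurable M2" 
    if "f \<in> borel_measurable Mp_borel" for f :: "'a measure \<Rightarrow> real"
    using that sets by (metis measurable_cong_sets)+
  have int: "integrable M1 f" "integrable M2 f" 
    if "f \<in> borel_measurable Mp_borel" "\<And>\<mu>. \<bar>f \<mu>\<bar> \<le> C" for f :: "'a measure \<Rightarrow> real" and C
    using M1.integrable_const_bound[of f C] M2.integrable_const_bound[of f C] meas[OF that(1)] that(2)
    by simp_all
  \<comment> \<open>Equality is demanded after multiplication by every \<open>lap f\<close>. This
    builds in stability under multiplication by \<open>lap g\<close>, so that factors can be added
    one at a time.\<close>
  define V where "V = {\<phi> :: 'a measure \<Rightarrow> real. \<phi> \<in> borel_measurable Mp_borel \<and> (\<exists>C. \<forall>\<mu>. \<bar>\<phi> \<mu>\<bar> \<le> C) \<and>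
    (\<forall>f\<in>CK_plus. (\<integral>\<mu>. \<phi> \<mu> * lap f \<mu> \<partial>M1) = (\<integral>\<mu>. \<phi> \<mu> * lap f \<mu> \<partial>M2))}"
  have bnd: "\<bar>\<phi> \<mu> * lap f \<mu>\<bar> \<le> C" if "\<bar>\<phi> \<mu>\<bar> \<le> C" for \<phi> f \<mu> C
  proof -
    have "\<bar>\<phi> \<mu>\<bar> * lap f \<mu> \<le> C * 1" using that by (intro mult_mono) auto
    then show ?thesis by (simp add: abs_mult)
  qed
  have V_bd: "\<exists>C. \<forall>\<mu>. \<bar>\<phi> \<mu>\<bar> \<le> C" if "\<phi> \<in> V" for \<phi> using that by (simp add: V_def)
  have V_int: "integrable M1 (\<lambda>\<mu>. \<phi> \<mu> * lap f \<mu>)" "integrable M2 (\<lambda>\<mu>. \<phi> \<mu> * lap f \<mu>)" if "\<phi> \<in> V" "f \<in> CK_plus" for \<phi> f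
  proof -
    obtain C where C: "\<And>\<mu>. \<bar>\<phi> \<mu>\<bar> \<le> C" using V_bd[OF \<open>\<phi> \<in> V\<close>] by auto
    have "(\<lambda>\<mu>. \<phi> \<mu> * lap f \<mu>) \<in> borel_measurable Mp_borel"
      using that measurable_lap[OF that(2)] by (auto simp: V_def)
    then show "integrable M1 (\<lambda>\<mu>. \<phi> \<mu> * lap f \<mu>)" "integrable M2 (\<lambda>\<mu>. \<phi> \<mu> * lap f \<mu>)"
      by (rule int, use bnd[of \<phi>, OF C] in blast)+
  qed
  have V_one: "(\<lambda>_. 1) \<in> V" using eq by (auto simp: V_def)
  have V_add: "(\<lambda>\<mu>. \<phi> \<mu> + \<psi> \<mu>) \<in> V" if "\<phi> \<in> V" "\<psi> \<in> V" for \<phi> \<psi>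
  proof -
    obtain C D where CD: "\<And>\<mu>. \<bar>\<phi> \<mu>\<bar> \<le> C" "\<And>\<mu>. \<bar>\<psi> \<mu>\<bar> \<le> D"
      using V_bd[OF \<open>\<phi> \<in> V\<close>] V_bd[OF \<open>\<psi> \<in> V\<close>] by auto
    have "\<bar>\<phi> \<mu> + \<psi> \<mu>\<bar> \<le> C + D" for \<mu> using CD[of \<mu>] by linarith
    moreover have "(\<integral>\<mu>. (\<phi> \<mu> + \<psi> \<mu>) * lap f \<mu> \<partial>M1) = (\<integral>\<mu>. (\<phi> \<mu> + \<psi> \<mu>) * lap f \<mu> \<partial>M2)" if f: "f \<in> CK_plus" for f
      using V_int[OF \<open>\<phi> \<in> V\<close> f] V_int[OF \<open>\<psi> \<in> V\<close> f] \<open>\<phi> \<in> V\<close> \<open>\<psi> \<in> V\<close> f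
      by (simp add: distrib_right V_def)
    ultimately show ?thesis using that by (auto simp: V_def)
  qed
  have V_scale: "(\<lambda>\<mu>. c * \<phi> \<mu>) \<in> V" if "\<phi> \<in> V" for \<phi> c
  proof -
    obtain C where C: "\<And>\<mu>. \<bar>\<phi> \<mu>\<bar> \<le> C" using V_bd[OF \<open>\<phi> \<in> V\<close>] by auto
    have "\<bar>c * \<phi> \<mu>\<bar> \<le> \<bar>c\<bar> * C" for \<mu> using C[of \<mu>] by (simp add: abs_mult mult_left_mono)
    then show ?thesis using that by (auto simp: V_def mult.assoc)
  qed
  have V_lap: "(\<lambda>\<mu>. \<phi> \<mu> * lap g \<mu>) \<in> V" if "\<phi> \<in> V" "g \<in> CK_plus" for \<phi> g
  proof -
    obtain C where C: "\<And>\<mu>. \<bar>\<phi> \<mu>\<bar> \<le> C" using V_bd[OF \<open>\<phi> \<in> V\<close>] by auto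
    have "(\<integral>\<mu>. (\<phi> \<mu> * lap g \<mu>) * lap f \<mu> \<partial>M1) = (\<integral>\<mu>. (\<phi> \<mu> * lap g \<mu>) * lap f \<mu> \<partial>M2)" if f: "f \<in> CK_plus" for f
    proof -
      have "(\<integral>\<mu>. (\<phi> \<mu> * lap g \<mu>) * lap f \<mu> \<partial>M) = (\<integral>\<mu>. \<phi> \<mu> * lap (\<lambda>x. g x + f x) \<mu> \<partial>M)" if "space M = Mp" for M
        using that by (intro Bochner_Integration.integral_cong) (auto simp: lap_add f \<open>g \<in> CK_plus\<close>)
      then show ?thesis using \<open>\<phi> \<in> V\<close> CK_plus_add[OF \<open>g \<in> CK_plus\<close> f] by (simp add: sp V_def)
    qed
    then show ?thesis using that measurable_lap[OF that(2)] bnd[of \<phi>, OF C] by (auto simp: V_def)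
  qed
  have V_lim: "\<phi> \<in> V" if u: "\<And>n. u n \<in> V" "\<And>n \<mu>. \<bar>u n \<mu>\<bar> \<le> C" "\<And>\<mu>. (\<lambda>n. u n \<mu>) \<longlonglongrightarrow> \<phi> \<mu>" 
    for u :: "nat \<Rightarrow> 'a measure \<Rightarrow> real" and \<phi> C
  proof -
    have m: "\<phi> \<in> borel_measurable Mp_borel"
      using u(1) by (intro borel_measurable_LIMSEQ_real[OF u(3)]) (auto simp: V_def)
    have "\<bar>\<phi> \<mu>\<bar> \<le> C" for \<mu>
      using u(2) by (intro LIMSEQ_le_const2[OF tendsto_rabs[OF u(3)]]) auto
    moreover have "(\<integral>\<mu>. \<phi> \<mu> * lap f \<mu> \<partial>M1) = (\<integral>\<mu>. \<phi> \<mu> * lap f \<mu> \<partial>M2)" if f: "f \<in> CK_plus" for f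
    proof -
      have lim: "(\<lambda>n. \<integral>\<mu>. u n \<mu> * lap f \<mu> \<partial>M) \<longlonglongrightarrow> (\<integral>\<mu>. \<phi> \<mu> * lap f \<mu> \<partial>M)" 
        if M: "finite_measure M" "sets M = sets Mp_borel" for M
      proof (rule integral_dominated_convergence)
        interpret finite_measure M by fact
        have mM: "\<psi> \<in> borel_measurable M" if "\<psi> \<in> borel_measurable Mp_borel" for \<psi> :: "'a measure \<Rightarrow> real"
          using that M(2) by (metis measurable_cong_sets)
        show "(\<lambda>\<mu>. \<phi> \<mu> * lap f \<mu>) \<in> borel_measurable M" "(\<lambda>\<mu>. u n \<mu> * lap f \<mu>) \<in> borel_measurable M" for n
          using u(1)[of n] by (auto simp: V_def intro!: mM borel_measurable_times m measurable_lap f)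
        show "integrable M (\<lambda>_. C)" by simp
        show "AE \<mu> in M. (\<lambda>n. u n \<mu> * lap f \<mu>) \<longlonglongrightarrow> \<phi> \<mu> * lap f \<mu>"
          using u(3) by (intro AE_I2 tendsto_intros)
        show "AE \<mu> in M. norm (u n \<mu> * lap f \<mu>) \<le> C" for n
          using bnd[OF u(2)] by (intro AE_I2) simp
      qed
      have "(\<integral>\<mu>. u n \<mu> * lap f \<mu> \<partial>M1) = (\<integral>\<mu>. u n \<mu> * lap f \<mu> \<partial>M2)" for n
        using u(1)[of n] f by (auto simp: V_def)
      then show ?thesis
        using lim[OF fin(1) sets(1)] lim[OF fin(2) sets(2)] by (simp add: LIMSEQ_unique)
    qed
    ultimately show ?thesis using m by (auto simp: V_def)
  qed
  \<comment> \<open>These products are the terms of Bernstein polynomials in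
    \<open>lap g\<close>.\<close>
  have V_pow: "(\<lambda>\<mu>. \<phi> \<mu> * lap g \<mu> ^ i * (1 - lap g \<mu>) ^ j) \<in> V" if "\<phi> \<in> V" "g \<in> CK_plus" for \<phi> g i j
  proof (induction j)
    case 0
    show ?case
    proof (induction i)
      case (Suc i)
      then show ?case using V_lap[OF Suc that(2)] by (simp add: mult_ac)
    qed (use that in simp)
  next
    case (Suc j)
    then show ?case
      using V_add[OF Suc V_scale[OF V_lap[OF Suc that(2)], of "-1"]] by (simp add: algebra_simps)
  qed
  have V_sum: "(\<lambda>\<mu>. \<Sum>k\<le>n. \<phi> k \<mu>) \<in> V" if "\<And>k. \<phi> k \<in> V" for \<phi> and n :: nat
    by (induction n) (auto intro: that V_add)
  have V_cont: "(\<lambda>\<mu>. \<phi> \<mu> * h (lap g \<mu>)) \<in> V" if \<phi>: "\<phi> \<in> V" and g: "g \<in> CK_plus"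
    and h: "continuous_on {0..1} h" and hb: "\<And>y. \<bar>h y\<bar> \<le> 1" for \<phi> g and h :: "real \<Rightarrow> real"
  proof -
    obtain C where C: "\<And>\<mu>. \<bar>\<phi> \<mu>\<bar> \<le> C" using V_bd[OF \<phi>] by auto
    have "0 \<le> C" using C[of undefined] by linarith
    define p where "p n y = (\<Sum>k\<le>n. h (real k / real n) * Bernstein n k y)" for n y
    have pb: "\<bar>p n y\<bar> \<le> 1" if "0 \<le> y" "y \<le> 1" for n y
    proof -
      have "\<bar>p n y\<bar> \<le> (\<Sum>k\<le>n. \<bar>h (real k / real n) * Bernstein n k y\<bar>)" unfolding p_def by (rule sum_abs)
      also have "\<dots> \<le> (\<Sum>k\<le>n. Bernstein n k y)"
        using hb Bernstein_nonneg[OF that]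
        by (intro sum_mono) (auto simp: abs_mult intro: mult_left_le_one_le)
      finally show ?thesis by simp
    qed
    have plim: "(\<lambda>n. p n y) \<longlonglongrightarrow> h y" if "0 \<le> y" "y \<le> 1" for y
    proof (rule LIMSEQ_I)
      fix e :: real assume "0 < e"
      from Bernstein_Weierstrass[OF h this]
      obtain N where "\<forall>n x. N \<le> n \<and> x \<in> {0..1} \<longrightarrow> \<bar>h x - p n x\<bar> < e" unfolding p_def ..
      then show "\<exists>no. \<forall>n\<ge>no. norm (p n y - h y) < e"
        using \<open>0 \<le> y\<close> \<open>y \<le> 1\<close> by (intro exI[of _ N]) (auto simp: abs_minus_commute)
    qed
    show ?thesis
    proof (rule V_lim[of "\<lambda>n \<mu>. \<phi> \<mu> * p n (lap g \<mu>)" C])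
      fix n
      have "(\<lambda>\<mu>. (h (real k / real n) * real (n choose k)) * (\<phi> \<mu> * lap g \<mu> ^ k * (1 - lap g \<mu>) ^ (n - k))) \<in> V" for k
        by (intro V_scale V_pow \<phi> g)
      from V_sum[where n = n, OF this] show "(\<lambda>\<mu>. \<phi> \<mu> * p n (lap g \<mu>)) \<in> V"
        by (simp add: p_def Bernstein_def sum_distrib_left mult_ac)
      show "\<bar>\<phi> \<mu> * p n (lap g \<mu>)\<bar> \<le> C" for \<mu>
        using mult_mono[OF C[of \<mu>] pb[of "lap g \<mu>" n]] \<open>0 \<le> C\<close> by (simp add: abs_mult)
      show "(\<lambda>n. \<phi> \<mu> * p n (lap g \<mu>)) \<longlonglongrightarrow> \<phi> \<mu> * h (lap g \<mu>)" for \<mu>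
        by (intro tendsto_intros plim) auto
    qed
  qed
  have V_ind: "(\<lambda>\<mu>. \<phi> \<mu> * indicator {a<..} (lap g \<mu>)) \<in> V" if \<phi>: "\<phi> \<in> V" and g: "g \<in> CK_plus" for \<phi> g and a :: real
  proof -
    obtain C where C: "\<And>\<mu>. \<bar>\<phi> \<mu>\<bar> \<le> C" using V_bd[OF \<phi>] by auto
    have "0 \<le> C" using C[of undefined] by linarith
    define h where "h n y = min 1 (real n * max 0 (y - a))" for n y
    have hb: "\<bar>h n y\<bar> \<le> 1" for n y by (auto simp: h_def min_def mult_nonneg_nonneg)
    show ?thesis
    proof (rule V_lim[of "\<lambda>n \<mu>. \<phi> \<mu> * h n (lap g \<mu>)" C])
      show "(\<lambda>\<mu>. \<phi> \<mu> * h n (lap g \<mu>)) \<in> V" for n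
        by (intro V_cont \<phi> g hb) (auto simp: h_def intro!: continuous_intros)
      show "\<bar>\<phi> \<mu> * h n (lap g \<mu>)\<bar> \<le> C" for n \<mu>
        using mult_mono[OF C[of \<mu>] hb[of n "lap g \<mu>"]] \<open>0 \<le> C\<close> by (simp add: abs_mult)
      show "(\<lambda>n. \<phi> \<mu> * h n (lap g \<mu>)) \<longlonglongrightarrow> \<phi> \<mu> * indicator {a<..} (lap g \<mu>)" for \<mu>
        unfolding h_def by (intro tendsto_intros ramp_tendsto_indicator)
    qed
  qed
  \<comment> \<open>With finite sets of pairs as indices, intersections correspond to unions of
    indices, and the empty index gives the whole space.\<close>
  define G where "G J = {\<mu> \<in> Mp. \<forall>(f, a)\<in>J. a < lap f \<mu>}" for J :: "(('a \<Rightarrow> real) \<times> real) set"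
  define GG where "GG = G ` {J. finite J \<and> fst ` J \<subseteq> CK_plus}"
  have ind_V: "(\<lambda>\<mu>. \<Prod>p\<in>J. indicator {snd p<..} (lap (fst p) \<mu>)) \<in> V" if "finite J" "fst ` J \<subseteq> CK_plus" for J
    using that
  proof (induction J)
    case (insert p J)
    then show ?case using V_ind[of "\<lambda>\<mu>. \<Prod>p\<in>J. indicator {snd p<..} (lap (fst p) \<mu>)" "fst p" "snd p"]
      by (simp add: mult.commute)
  qed (use V_one in simp)
  have GG_sets: "G J \<in> sets Mp_borel" if "finite J" "fst ` J \<subseteq> CK_plus" for J
  proof -
    have "{\<mu> \<in> space Mp_borel. \<forall>p\<in>J. snd p < lap (fst p) \<mu>} \<in> sets Mp_borel"
      using that measurable_lap by (intro sets.sets_Collect_finite_All borel_measurable_less) auto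
    then show ?thesis by (simp add: G_def case_prod_beta)
  qed
  show ?thesis
  proof (rule measure_eqI_generator_eq[of GG Mp])
    show "Int_stable GG"
    proof (rule Int_stableI)
      fix a b assume "a \<in> GG" "b \<in> GG"
      then obtain J J' where "a = G J" "b = G J'" "finite J" "finite J'" "fst ` J \<subseteq> CK_plus" "fst ` J' \<subseteq> CK_plus"
        by (auto simp: GG_def)
      then show "a \<inter> b \<in> GG" unfolding GG_def by (intro image_eqI[of _ _ "J \<union> J'"]) (auto simp: G_def)
    qed
    show GP: "GG \<subseteq> Pow Mp" by (auto simp: GG_def G_def)
    show "emeasure M1 X = emeasure M2 X" if "X \<in> GG" for X
    proof -
      obtain J where J: "X = G J" "finite J" "fst ` J \<subseteq> CK_plus" using \<open>X \<in> GG\<close> by (auto simp: GG_def)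
      have ind: "(\<Prod>p\<in>J. indicator {snd p<..} (lap (fst p) \<mu>)) = (indicator X \<mu> :: real)" if "\<mu> \<in> Mp" for \<mu>
        using J(2) that unfolding J(1) G_def by (induction J) (auto simp: indicator_def)
      have "(\<integral>\<mu>. (\<Prod>p\<in>J. indicator {snd p<..} (lap (fst p) \<mu>) :: real) \<partial>M) = measure M X"
        if "sets M = sets Mp_borel" for M
      proof -
        have "space M = Mp" using sets_eq_imp_space_eq[OF that] by simp
        then have "(\<integral>\<mu>. (\<Prod>p\<in>J. indicator {snd p<..} (lap (fst p) \<mu>) :: real) \<partial>M) = (\<integral>\<mu>. indicat_real X \<mu> \<partial>M)"
          using ind by (intro Bochner_Integration.integral_cong) auto
        then show ?thesis using GG_sets[OF J(2,3)] sets.sets_into_space that J(1) \<open>space M = Mp\<close>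
          by (simp add: Int_absorb2 G_def subset_iff)
      qed
      moreover have "(\<integral>\<mu>. (\<Prod>p\<in>J. indicator {snd p<..} (lap (fst p) \<mu>) :: real) \<partial>M1) = (\<integral>\<mu>. (\<Prod>p\<in>J. indicator {snd p<..} (lap (fst p) \<mu>) :: real) \<partial>M2)"
        using ind_V[OF J(2,3)] CK_plus_zero unfolding V_def by fastforce
      ultimately have "measure M1 X = measure M2 X" using sets by simp
      then show ?thesis by (simp add: M1.emeasure_eq_measure M2.emeasure_eq_measure)
    qed
    have "sets Mp_borel \<subseteq> sigma_sets Mp GG"
    proof (rule sets_Mp_borel_subset[OF GP sigma_sets.Basic])
      fix f :: "'a \<Rightarrow> real" and a assume "f \<in> CK_plus"
      then show "{\<mu> \<in> Mp. a < lap f \<mu>} \<in> GG"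
        unfolding GG_def by (intro image_eqI[of _ _ "{(f, a)}"]) (auto simp: G_def)
    qed
    moreover have "sigma_sets Mp GG \<subseteq> sets Mp_borel"
      using GG_sets sets.sigma_sets_subset[of GG Mp_borel] by (auto simp: GG_def)
    ultimately have "sets Mp_borel = sigma_sets Mp GG" by auto
    then show "sets M1 = sigma_sets Mp GG" "sets M2 = sigma_sets Mp GG" using sets by auto
    show "range (\<lambda>_::nat. Mp) \<subseteq> GG"
      unfolding GG_def by (auto intro!: image_eqI[of _ _ "{}"] simp: G_def)
  qed auto
qed

end

section \<open>Relative compactness in the vague topology\<close>

text \<open>Dini's theorem; on E it delivers the Daniell condition, since monotone convergence
  becomes uniform on the compact support of a weight.\<close>

lemma dini_compact:
  fixes \<phi> :: "nat \<Rightarrow> 'x::topological_space \<Rightarrow> real"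
  assumes "compact K" "\<And>j. continuous_on UNIV (\<phi> j)" "\<And>x. decseq (\<lambda>j. \<phi> j x)"
    "\<And>x. (\<lambda>j. \<phi> j x) \<longlonglongrightarrow> 0" "0 < e"
  obtains j0 where "\<And>j x. j \<ge> j0 \<Longrightarrow> x \<in> K \<Longrightarrow> \<phi> j x < e"
proof -
  have "open {x. \<phi> j x < e}" for j using assms(2) by (intro open_Collect_less continuous_on_const)
  moreover have "K \<subseteq> (\<Union>j. {x. \<phi> j x < e})"
  proof
    fix x assume "x \<in> K"
    have "eventually (\<lambda>j. \<phi> j x < e) sequentially" using assms(4,5) by (rule order_tendstoD)
    then show "x \<in> (\<Union>j. {x. \<phi> j x < e})" by (auto simp: eventually_sequentially)
  qed
  ultimately obtain J where J: "finite J" "K \<subseteq> (\<Union>j\<in>J. {x. \<phi> j x < e})"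
    by (rule compactE_image[OF assms(1)])
  show thesis
  proof (rule that[of "Max (insert 0 J)"])
    fix j x assume j: "Max (insert 0 J) \<le> j" and "x \<in> K"
    then obtain i where i: "i \<in> J" "\<phi> i x < e" using J by auto
    then have "i \<le> j" using j J(1) by simp
    then have "\<phi> j x \<le> \<phi> i x" using assms(3)[of x] by (simp add: decseq_def)
    then show "\<phi> j x < e" using i by simp
  qed
qed

lemma Nats_of_approx:
  fixes x :: real
  assumes "\<And>\<delta>. 0 < \<delta> \<Longrightarrow> \<exists>k::nat. \<bar>real k - x\<bar> < \<delta>"
  shows "x \<in> \<nat>"
proof -
  have "x \<in> closure \<nat>"
    unfolding closure_approachable using assms by (force simp: dist_real_def)
  then show ?thesis by simp
qed

context lcsc_space
begin

text \<open>Identifies the \<sigma>-field that the Daniell construction yields for bounded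
  continuous functions with the Borel field: by the countable family of lower bumps, every open set
  is a countable union of positivity sets.\<close>

lemma borel_eq_continuous_positive:
  "sets (borel :: 'a measure) = sigma_sets UNIV {{x \<in> UNIV. 0 < \<phi> x} | \<phi> :: 'a \<Rightarrow> real. \<phi> \<in> {\<phi>. continuous_on UNIV \<phi> \<and> bounded (range \<phi>)}}"
  (is "_ = sigma_sets UNIV ?G")
proof -
  obtain S :: "('a \<Rightarrow> real) set" where S: "countable S" "S \<subseteq> CK_plus" "(\<lambda>_. 0) \<in> S"
    "\<And>f x r. f \<in> CK_plus \<Longrightarrow> r < f x \<Longrightarrow> \<exists>g\<in>S. (\<forall>y. g y \<le> f y) \<and> r < g x"
    using countable_lower_bumps by metis
  have SG: "{x. 0 < g x} \<in> ?G" if "g \<in> S" for g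
  proof -
    have g: "g \<in> CK_plus" using S(2) that by auto
    obtain C where "\<And>x. g x \<le> C" using CK_plus_bounded[OF g] by metis
    then have "bounded (range g)" using CK_plusD(2)[OF g] by (auto simp: bounded_iff intro!: exI[of _ C])
    then show ?thesis using CK_plusD(1)[OF g] by (auto intro!: exI[of _ g])
  qed
  have opn: "U \<in> sigma_sets UNIV ?G" if U: "open U" for U
  proof -
    define T where "T = {g \<in> S. {x. g x \<noteq> 0} \<subseteq> U}"
    have "U = (\<Union>g\<in>T. {x. 0 < g x})"
    proof
      show "(\<Union>g\<in>T. {x. 0 < g x}) \<subseteq> U" by (auto simp: T_def)
      show "U \<subseteq> (\<Union>g\<in>T. {x. 0 < g x})"
      proof
        fix x assume x: "x \<in> U"
        obtain f where f: "f \<in> CK_plus" "f x = 1" "closure {x. f x \<noteq> 0} \<subseteq> U"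
          using U x by (rule_tac bump[of "{x}" U]) auto
        then obtain g where g: "g \<in> S" "\<And>y. g y \<le> f y" "0 < g x" using S(4)[of f 0 x] by auto
        have "{y. g y \<noteq> 0} \<subseteq> {y. f y \<noteq> 0}"
        proof
          fix y assume "y \<in> {y. g y \<noteq> 0}"
          moreover have "0 \<le> g y" using g(1) S(2) by (auto simp: CK_plusD)
          ultimately show "y \<in> {y. f y \<noteq> 0}" using g(2)[of y] by auto
        qed
        then have "g \<in> T" using g f(3) closure_subset[of "{y. f y \<noteq> 0}"] by (auto simp: T_def)
        then show "x \<in> (\<Union>g\<in>T. {x. 0 < g x})" using g by auto
      qed
    qed
    moreover have "(\<Union>g\<in>T. {x. 0 < g x}) \<in> sigma_sets UNIV ?G"
      using S(1) SG by (intro sigma_sets_UNION) (auto simp: T_def)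
    ultimately show ?thesis by simp
  qed
  have sub: "?G \<subseteq> sets borel"
    by (auto intro!: borel_open open_Collect_less continuous_on_const)
  show ?thesis
  proof (rule antisym)
    have "sigma_sets UNIV {U. open U} \<subseteq> sigma_sets UNIV ?G" using opn by (intro sigma_sets_mono) blast
    then show "sets borel \<subseteq> sigma_sets UNIV ?G" by (simp add: borel_def)
    show "sigma_sets UNIV ?G \<subseteq> sets borel" using sets.sigma_sets_subset[OF sub] by simp
  qed
qed

text \<open>A relatively compact open neighbourhood is diminished successively by the closures of
  basis sets whose closure misses \<open>K\<close>. By regularity and second countability these
  countably many sets exhaust the complement of \<open>K\<close>, and continuity from above
  applies.\<close>

lemma compact_outer_regular:
  assumes "sets \<mu> = sets borel" and fin: "\<And>K. compact K \<Longrightarrow> emeasure \<mu> K < \<infinity>"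
    and K: "compact (K :: 'a set)" and "0 < \<delta>"
  obtains V where "open V" "K \<subseteq> V" "compact (closure V)" "measure \<mu> V < measure \<mu> K + \<delta>"
proof -
  obtain W where W: "open W" "K \<subseteq> W" "compact (closure W)"
    by (rule compact_neighbourhood[OF K open_UNIV]) auto
  obtain B :: "'a set set" where B: "countable B" "topological_basis B"
    using ex_countable_basis by auto
  define C where "C = insert {} {U \<in> B. closure U \<inter> K = {}}"
  have "countable C" "C \<noteq> {}" using B by (auto simp: C_def)
  then obtain V :: "nat \<Rightarrow> 'a set" where V: "range V = C" using range_from_nat_into[OF \<open>C \<noteq> {}\<close> \<open>countable C\<close>] by metis
  have VK: "closure (V i) \<inter> K = {}" for i
  proof -
    have "V i \<in> C" using V by auto
    then show ?thesis by (auto simp: C_def)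
  qed
  have cover: "\<exists>i. x \<in> V i" if x: "x \<notin> K" for x
  proof -
    have "open (- K)" using compact_imp_closed[OF K] by auto
    then obtain U where U: "open U" "{x} \<subseteq> U" "closure U \<subseteq> - K"
      using x by (rule_tac compact_neighbourhood[of "{x}" "- K"]) auto
    then obtain A where A: "A \<in> B" "x \<in> A" "A \<subseteq> U" using topological_basisE[OF B(2), of U x] by auto
    then have "A \<in> range V" unfolding V C_def using U closure_mono[OF A(3)] by auto
    then show ?thesis using A by auto
  qed
  define D where "D n = W - (\<Union>i<n. closure (V i))" for n
  have oD: "open (D n)" for n unfolding D_def using W by (intro open_Diff closed_UN) auto
  have KD: "K \<subseteq> D n" for n using VK W by (auto simp: D_def)
  have Dfin: "emeasure \<mu> (D n) \<noteq> \<infinity>" for n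
  proof -
    have "emeasure \<mu> (D n) \<le> emeasure \<mu> (closure W)"
      using closure_subset[of W] assms(1) by (intro emeasure_mono) (auto simp: D_def)
    then show ?thesis using fin[OF W(3)] by auto
  qed
  have "(\<Inter>n. D n) = K"
  proof
    show "(\<Inter>n. D n) \<subseteq> K"
    proof
      fix x assume x: "x \<in> (\<Inter>n. D n)"
      show "x \<in> K"
      proof (rule ccontr)
        assume "x \<notin> K"
        then obtain i where "x \<in> V i" using cover by auto
        moreover have "x \<in> D (Suc i)" using x by auto
        ultimately show False using closure_subset[of "V i"] by (auto simp: D_def)
      qed
    qed
  qed (use KD in auto)
  moreover have "(\<lambda>n. measure \<mu> (D n)) \<longlonglongrightarrow> measure \<mu> (\<Inter>n. D n)"
    using oD assms(1) Dfin by (intro Lim_measure_decseq) (auto simp: decseq_def D_def)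
  ultimately have "(\<lambda>n. measure \<mu> (D n)) \<longlonglongrightarrow> measure \<mu> K" by simp
  then have "eventually (\<lambda>n. measure \<mu> (D n) < measure \<mu> K + \<delta>) sequentially"
    using \<open>0 < \<delta>\<close> by (intro order_tendstoD(2)) auto
  then obtain n where n: "measure \<mu> (D n) < measure \<mu> K + \<delta>" by (auto simp: eventually_sequentially)
  have "closure (D n) = closure W \<inter> closure (D n)" using closure_mono[of "D n" W] by (auto simp: D_def)
  then have "compact (closure (D n))" using compact_Int_closed[OF W(3) closed_closure, of "D n"] by simp
  then show thesis using oD KD n by (intro that[of "D n"])
qed

text \<open>Inside the closure of \<open>B\<close>, closed sets have natural mass. This passes to
  all Borel sets by a Dynkin argument: the naturals are stable under nonnegative differences and
  form a closed set, so countable disjoint unions keep integral mass.\<close>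

lemma Mp_of_compact_Nats:
  assumes sets: "sets \<mu> = sets (borel :: 'a measure)" and fin: "\<And>K. compact K \<Longrightarrow> emeasure \<mu> K < \<infinity>"
    and nat: "\<And>K. compact K \<Longrightarrow> measure \<mu> K \<in> \<nat>"
  shows "\<mu> \<in> Mp"
proof -
  have "\<exists>n::nat. emeasure \<mu> B = of_nat n" if B: "B \<in> bounded_borel" for B
  proof -
    define K where "K = closure B"
    have K: "compact K" "K \<in> sets \<mu>" using B sets by (auto simp: K_def bounded_borel_def)
    have finK: "emeasure \<mu> (A \<inter> K) < \<infinity>" for A
      using le_less_trans[OF emeasure_mono[of "A \<inter> K" K \<mu>] fin[OF K(1)]] K(2) by auto
    have "B \<in> sigma_sets UNIV (Collect closed)"
      using B unfolding bounded_borel_def borel_eq_closed by simp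
    have Int_stable_closed: "Int_stable (Collect closed :: 'a set set)" by (auto simp: Int_stable_def)
    have closed_Pow: "Collect closed \<subseteq> Pow (UNIV :: 'a set)" by auto
    have "measure \<mu> (A \<inter> K) \<in> \<nat>" if "A \<in> sigma_sets UNIV (Collect closed)" for A
      using Int_stable_closed closed_Pow that
    proof (induction rule: sigma_sets_induct_disjoint)
      case (basic A)
      then show ?case using K by (intro nat) (auto simp: Int_commute intro: compact_Int_closed)
    next
      case empty
      show ?case by simp
    next
      case (compl A)
      have A: "A \<in> sets \<mu>" using compl sets by (simp add: borel_eq_closed)
      have "measure \<mu> ((UNIV - A) \<inter> K) = measure \<mu> K - measure \<mu> (A \<inter> K)"
      proof -
        have "(UNIV - A) \<inter> K = K - A \<inter> K" by auto
        then show ?thesis using A K(2) finK[of UNIV] by (simp add: measure_Diff)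
      qed
      moreover have "measure \<mu> (A \<inter> K) \<le> measure \<mu> K"
        using A K(2) finK[of UNIV] by (intro measure_mono_fmeasurable) (auto simp: fmeasurable_def)
      ultimately show ?case using compl(2) nat[OF K(1)] by (auto elim!: Nats_cases simp flip: of_nat_diff)
    next
      case (union A)
      have A: "A i \<in> sets \<mu>" for i
      proof -
        have "A i \<in> sigma_sets UNIV (Collect closed)" using union(2) by blast
        then show ?thesis by (simp add: sets borel_eq_closed)
      qed
      have eq: "(\<Union>i. A i) \<inter> K = (\<Union>i. A i \<inter> K)" by auto
      have "(\<lambda>i. measure \<mu> (A i \<inter> K)) sums measure \<mu> (\<Union>i. A i \<inter> K)"
      proof (rule measure_UNION)
        show "range (\<lambda>i. A i \<inter> K) \<subseteq> sets \<mu>" using A K(2) by blast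
        show "disjoint_family (\<lambda>i. A i \<inter> K)" using union(1) by (auto simp: disjoint_family_on_def)
        show "emeasure \<mu> (\<Union>i. A i \<inter> K) \<noteq> \<infinity>" using finK[of "\<Union>i. A i"] unfolding eq by simp
      qed
      moreover have "(\<Sum>i<n. measure \<mu> (A i \<inter> K)) \<in> \<nat>" for n
        by (induction n) (auto intro: Nats_add union(3))
      ultimately have "measure \<mu> (\<Union>i. A i \<inter> K) \<in> \<nat>"
        unfolding sums_def
        by (intro Lim_in_closed_set[OF closed_Nats _ sequentially_bot, rotated]) auto
      then show ?case unfolding eq .
    qed
    from this[OF \<open>B \<in> sigma_sets UNIV (Collect closed)\<close>] have "measure \<mu> B \<in> \<nat>"
      using closure_subset[of B] by (simp add: K_def Int_absorb2)
    then obtain n where "measure \<mu> B = real n" by (rule Nats_cases)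
    moreover have "emeasure \<mu> B < \<infinity>" using finK[of B] closure_subset[of B] by (simp add: K_def Int_absorb2)
    ultimately show ?thesis
      by (intro exI[of _ n]) (simp add: emeasure_eq_ennreal_measure less_top ennreal_of_nat_eq_real_of_nat)
  qed
  with sets fin show ?thesis unfolding Mp_def radon_measure_def by blast
qed

text \<open>Constants need not be integrable in the limit, so the limit functional is not itself a
  Daniell integral on bounded functions. After multiplication by a fixed test function p it becomes
  one: \<phi> is sent to the limit of the integrals of \<phi> p.\<close>

lemma vague_compactness:
  fixes \<nu> :: "nat \<Rightarrow> 'a measure"
  assumes F: "F \<noteq> bot" and \<nu>: "\<And>n. \<nu> n \<in> Mp"
    and bdd: "\<And>f. f \<in> CK_plus \<Longrightarrow> \<exists>C. eventually (\<lambda>n. (\<integral>x. f x \<partial>\<nu> n) \<le> C) F"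
  obtains \<mu> G where "\<mu> \<in> Mp" "G \<le> F" "G \<noteq> bot"
    "\<And>f. f \<in> CK_plus \<Longrightarrow> ((\<lambda>n. \<integral>x. f x \<partial>\<nu> n) \<longlongrightarrow> (\<integral>x. f x \<partial>\<mu>)) G"
proof -
  define S where "S = {f :: 'a \<Rightarrow> real. continuous_on UNIV f \<and> (\<exists>g\<in>CK_plus. \<forall>x. \<bar>f x\<bar> \<le> g x)}"
  have S_I: "f \<in> S" if "continuous_on UNIV f" "g \<in> CK_plus" "\<And>x. \<bar>f x\<bar> \<le> g x" for f g
    unfolding S_def using that by blast
  have S_cont: "continuous_on UNIV f" if "f \<in> S" for f using that by (simp add: S_def)
  have S_int: "integrable (\<nu> n) f" if f: "f \<in> S" for f n
  proof -
    obtain g where "g \<in> CK_plus" "\<And>x. \<bar>f x\<bar> \<le> g x" using f by (auto simp: S_def)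
    then show ?thesis
      using f \<nu> by (intro integrable_dominated_CK[of _ g] borel_measurable_continuous_onI) (auto simp: S_def)
  qed
  have "\<exists>C. eventually (\<lambda>n. \<bar>\<integral>x. f x \<partial>\<nu> n\<bar> \<le> C) F" if f: "f \<in> S" for f
  proof -
    obtain g where g: "g \<in> CK_plus" "\<And>x. \<bar>f x\<bar> \<le> g x" using f by (auto simp: S_def)
    obtain C where C: "eventually (\<lambda>n. (\<integral>x. g x \<partial>\<nu> n) \<le> C) F" using bdd[OF g(1)] by auto
    have "\<bar>\<integral>x. f x \<partial>\<nu> n\<bar> \<le> (\<integral>x. g x \<partial>\<nu> n)" for n
    proof -
      have "\<bar>\<integral>x. f x \<partial>\<nu> n\<bar> \<le> (\<integral>x. \<bar>f x\<bar> \<partial>\<nu> n)" using integral_norm_bound[of "\<nu> n" f] by simp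
      also have "\<dots> \<le> (\<integral>x. g x \<partial>\<nu> n)"
        using g(2) by (intro integral_mono integrable_abs[OF S_int[OF f]] integrable_CK[OF \<nu> g(1)]) auto
      finally show ?thesis .
    qed
    then have "eventually (\<lambda>n. \<bar>\<integral>x. f x \<partial>\<nu> n\<bar> \<le> C) F"
      using C by (elim eventually_mono) (rule order_trans)
    then show ?thesis by auto
  qed
  then obtain C where "\<And>f. f \<in> S \<Longrightarrow> eventually (\<lambda>n. \<bar>\<integral>x. f x \<partial>\<nu> n\<bar> \<le> C f) F" by metis
  then obtain G where G: "G \<le> F" "G \<noteq> bot" "\<And>f. f \<in> S \<Longrightarrow> \<exists>l. ((\<lambda>n. \<integral>x. f x \<partial>\<nu> n) \<longlongrightarrow> l) G"
    using filter_subnet[OF F, of S "\<lambda>n f. \<integral>x. f x \<partial>\<nu> n" C] by blast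
  define c where "c f = Lim G (\<lambda>n. \<integral>x. f x \<partial>\<nu> n)" for f :: "'a \<Rightarrow> real"
  have c: "((\<lambda>n. \<integral>x. f x \<partial>\<nu> n) \<longlongrightarrow> c f) G" if "f \<in> S" for f
    using G(3)[OF that] tendsto_Lim[OF G(2)] unfolding c_def by metis
  have c_unique: "c f = l" if "((\<lambda>n. \<integral>x. f x \<partial>\<nu> n) \<longlongrightarrow> l) G" for f l
    unfolding c_def using that by (rule tendsto_Lim[OF G(2)])
  have S_CK: "f \<in> S" if "f \<in> CK_plus" for f
    using that by (auto simp: S_def CK_plusD intro!: bexI[of _ f])
  have S_add: "(\<lambda>x. f x + g x) \<in> S" if "f \<in> S" "g \<in> S" for f g
  proof -
    obtain f' g' where fg: "f' \<in> CK_plus" "g' \<in> CK_plus" "\<And>x. \<bar>f x\<bar> \<le> f' x" "\<And>x. \<bar>g x\<bar> \<le> g' x"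
      using \<open>f \<in> S\<close> \<open>g \<in> S\<close> by (auto simp: S_def)
    have "\<bar>f x + g x\<bar> \<le> f' x + g' x" for x using fg(3)[of x] fg(4)[of x] by linarith
    then show ?thesis
      by (rule S_I[OF continuous_on_add[OF S_cont[OF that(1)] S_cont[OF that(2)]] CK_plus_add[OF fg(1,2)]])
  qed
  have S_mult: "(\<lambda>x. \<phi> x * p x) \<in> S" if \<phi>: "continuous_on UNIV \<phi>" "bounded (range \<phi>)" and p: "p \<in> CK_plus" for \<phi> p
  proof -
    obtain C where C: "\<And>x. \<bar>\<phi> x\<bar> \<le> C" using \<phi>(2) by (auto simp: bounded_iff)
    have "0 \<le> C" using C[of undefined] by linarith
    have "\<bar>\<phi> x * p x\<bar> \<le> C * p x" for x
      using C[of x] CK_plusD(2)[OF p, of x] by (simp add: abs_mult mult_right_mono)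
    then show ?thesis
      by (rule S_I[OF continuous_on_mult[OF \<phi>(1) CK_plusD(1)[OF p]] CK_plus_scale[OF \<open>0 \<le> C\<close> p]])
  qed
  have c_add: "c (\<lambda>x. f x + g x) = c f + c g" if "f \<in> S" "g \<in> S" for f g
    using tendsto_add[OF c[OF that(1)] c[OF that(2)]] S_int that by (intro c_unique) simp
  have c_scale: "c (\<lambda>x. a * f x) = a * c f" if "f \<in> S" for f a
    using tendsto_mult_left[OF c[OF that], of a] by (intro c_unique) simp
  have c_mono: "c f \<le> c g" if "f \<in> S" "g \<in> S" "\<And>x. f x \<le> g x" for f g
    by (rule tendsto_le[OF G(2) c[OF that(2)] c[OF that(1)]])
      (intro always_eventually allI integral_mono S_int that)
  have c_zero: "c (\<lambda>_. 0) = 0" by (intro c_unique) simp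
  define Lb where "Lb = {\<phi> :: 'a \<Rightarrow> real. continuous_on UNIV \<phi> \<and> bounded (range \<phi>)}"
  have rep: "\<exists>M. sets M = sets borel \<and> finite_measure M \<and>
    (\<forall>\<phi>\<in>Lb. integrable M \<phi> \<and> (\<integral>x. \<phi> x \<partial>M) = c (\<lambda>x. \<phi> x * p x))" if p: "p \<in> CK_plus" for p
  proof -
    interpret daniell_integral UNIV Lb "\<lambda>\<phi>. c (\<lambda>x. \<phi> x * p x)"
    proof
      show "(\<lambda>_. 1) \<in> Lb" by (auto simp: Lb_def)
      fix \<phi> \<psi> :: "'a \<Rightarrow> real" and a :: real assume \<phi>: "\<phi> \<in> Lb"
      show "(\<lambda>x. a * \<phi> x) \<in> Lb" using \<phi> bounded_scaling[of "range \<phi>" a]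
        by (auto simp: Lb_def image_image intro!: continuous_on_mult_left)
      show "\<exists>C. \<forall>x\<in>UNIV. \<bar>\<phi> x\<bar> \<le> C" using \<phi> by (auto simp: Lb_def bounded_iff)
      show "c (\<lambda>x. a * \<phi> x * p x) = a * c (\<lambda>x. \<phi> x * p x)"
        using c_scale[OF S_mult[OF _ _ p], of \<phi> a] \<phi> by (simp add: Lb_def mult.assoc)
      show "0 \<le> c (\<lambda>x. \<phi> x * p x)" if "\<And>x. x \<in> UNIV \<Longrightarrow> 0 \<le> \<phi> x"
        using c_mono[OF S_CK[OF CK_plus_zero] S_mult[OF _ _ p], of \<phi>] \<phi> that CK_plusD(2)[OF p]
        by (simp add: Lb_def c_zero)
      assume \<psi>: "\<psi> \<in> Lb"
      obtain C D where CD: "\<And>x. \<bar>\<phi> x\<bar> \<le> C" "\<And>x. \<bar>\<psi> x\<bar> \<le> D"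
        using \<phi> \<psi> by (auto simp: Lb_def bounded_iff)
      have "norm y \<le> C + D" if y: "y \<in> range (\<lambda>x. \<phi> x + \<psi> x) \<union> range (\<lambda>x. max (\<phi> x) (\<psi> x))" for y
      proof -
        obtain x where "y = \<phi> x + \<psi> x \<or> y = max (\<phi> x) (\<psi> x)" using y by auto
        then show ?thesis using CD(1)[of x] CD(2)[of x] by (auto simp: max_def abs_le_iff)
      qed
      then have "bounded (range (\<lambda>x. \<phi> x + \<psi> x))" "bounded (range (\<lambda>x. max (\<phi> x) (\<psi> x)))"
        unfolding bounded_iff by blast+
      then show "(\<lambda>x. \<phi> x + \<psi> x) \<in> Lb" "(\<lambda>x. max (\<phi> x) (\<psi> x)) \<in> Lb"
        using \<phi> \<psi> by (auto simp: Lb_def intro!: continuous_on_add continuous_on_max)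
      show "c (\<lambda>x. (\<phi> x + \<psi> x) * p x) = c (\<lambda>x. \<phi> x * p x) + c (\<lambda>x. \<psi> x * p x)"
        using c_add[OF S_mult[OF _ _ p] S_mult[OF _ _ p], of \<phi> \<psi>] \<phi> \<psi> by (simp add: Lb_def distrib_right)
    next
      fix u :: "nat \<Rightarrow> 'a \<Rightarrow> real"
      assume u: "\<And>j. u j \<in> Lb" "\<And>x. x \<in> UNIV \<Longrightarrow> decseq (\<lambda>j. u j x)" "\<And>x. x \<in> UNIV \<Longrightarrow> (\<lambda>j. u j x) \<longlonglongrightarrow> 0"
      have nonneg: "0 \<le> u j x" for j x
        using u(2,3)[of x] decseq_ge by blast
      have uS: "(\<lambda>x. u j x * p x) \<in> S" for j using u(1)[of j] by (intro S_mult p) (auto simp: Lb_def)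
      show "(\<lambda>j. c (\<lambda>x. u j x * p x)) \<longlonglongrightarrow> 0"
      proof (rule LIMSEQ_I)
        fix e :: real assume e: "0 < e"
        have cp: "0 \<le> c p" using c_mono[OF S_CK[OF CK_plus_zero] S_CK[OF p]] CK_plusD(2)[OF p] by (simp add: c_zero)
        \<comment> \<open>Dini's theorem makes \<open>u j\<close> smaller than \<open>e'\<close> on
          the support of \<open>p\<close>, so the functional is at most \<open>e' * c p\<close>. The
          added 1 covers \<open>c p = 0\<close> and makes the final bound strict.\<close>
        define e' where "e' = e / (c p + 1)"
        have e': "0 < e'" using e cp by (simp add: e'_def)
        obtain j0 where j0: "\<And>j x. j \<ge> j0 \<Longrightarrow> x \<in> closure {x. p x \<noteq> 0} \<Longrightarrow> u j x < e'"
          using u CK_plusD(3)[OF p] e' by (rule_tac dini_compact[of "closure {x. p x \<noteq> 0}" u e']) (auto simp: Lb_def)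
        have "norm (c (\<lambda>x. u j x * p x) - 0) < e" if j: "j \<ge> j0" for j
        proof -
          have "u j x * p x \<le> e' * p x" for x
          proof (cases "p x = 0")
            case False
            then have "u j x < e'" using j0[OF j] closure_subset[of "{x. p x \<noteq> 0}"] by auto
            then show ?thesis using CK_plusD(2)[OF p] by (intro mult_right_mono) auto
          qed simp
          then have "c (\<lambda>x. u j x * p x) \<le> e' * c p"
            using c_mono[OF uS S_CK[OF CK_plus_scale[OF _ p]], of e' j] c_scale[OF S_CK[OF p]] e' by simp
          also have "\<dots> < e' * (c p + 1)" using e' by simp
          also have "\<dots> = e" using cp by (simp add: e'_def)
          finally have "c (\<lambda>x. u j x * p x) < e" .
          moreover have "0 \<le> c (\<lambda>x. u j x * p x)"
            using c_mono[OF S_CK[OF CK_plus_zero] uS] nonneg CK_plusD(2)[OF p] by (simp add: c_zero)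
          ultimately show ?thesis by simp
        qed
        then show "\<exists>no. \<forall>n\<ge>no. norm (c (\<lambda>x. u n x * p x) - 0) < e" by blast
      qed
    qed
    show ?thesis
      by (rule daniell_representation) (auto simp: borel_eq_continuous_positive Lb_def)
  qed
  obtain h :: "nat \<Rightarrow> 'a \<Rightarrow> real" where h: "\<And>m. h m \<in> CK_plus" "\<And>m x. h m x \<le> 1"
    "\<And>x. incseq (\<lambda>m. h m x)" "\<And>K. compact K \<Longrightarrow> \<exists>m0. \<forall>m\<ge>m0. \<forall>x\<in>K. h m x = 1"
    using exhaustion by metis
  \<comment> \<open>A partition of unity: the limit functional is represented on each \<open>p m\<close> separately.\<close>
  define p where "p m x = h m x - (if m = 0 then 0 else h (m - 1) x)" for m x
  have p: "p m \<in> CK_plus" for m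
  proof (rule CK_plus_dominated[OF h(1)[of m]])
    show "continuous_on UNIV (p m)" unfolding p_def
      by (cases "m = 0") (auto intro!: continuous_on_diff CK_plusD(1)[OF h(1)])
    have le: "(if m = 0 then 0 else h (m - 1) x) \<le> h m x" for x
      using h(3)[of x] CK_plusD(2)[OF h(1)] by (auto simp: incseq_def)
    then show "0 \<le> p m x" for x by (simp add: p_def)
    show "p m x = 0" if "h m x = 0" for x
      using that le[of x] CK_plusD(2)[OF h(1), of "m - 1" x] by (auto simp: p_def split: if_splits)
  qed
  have psum: "(\<Sum>m<n. p m x) = (if n = 0 then 0 else h (n - 1) x)" for n x
    by (induction n) (auto simp: p_def)
  obtain M where M: "\<And>m. sets (M m) = sets borel" "\<And>m. finite_measure (M m)"
    "\<And>m \<phi>. \<phi> \<in> Lb \<Longrightarrow> integrable (M m) \<phi>" "\<And>m \<phi>. \<phi> \<in> Lb \<Longrightarrow> (\<integral>x. \<phi> x \<partial>M m) = c (\<lambda>x. \<phi> x * p m x)"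
    using rep[OF p] by metis
  obtain \<mu> where \<mu>: "sets \<mu> = sets borel" 
    "\<And>f. f \<in> borel_measurable borel \<Longrightarrow> (\<integral>\<^sup>+x. f x \<partial>\<mu>) = (\<Sum>i. \<integral>\<^sup>+x. f x \<partial>M i)"
    by (rule countable_measure_sum[of M borel]) (use M(1) in auto)
  have \<mu>_mint: "mint \<mu> f = ennreal (c f)" if f: "f \<in> CK_plus" for f
  proof -
    obtain C where C: "\<And>x. f x \<le> C" using CK_plus_bounded[OF f] by metis
    have fLb: "f \<in> Lb" using C CK_plusD[OF f] by (auto simp: Lb_def bounded_iff intro!: exI[of _ C])
    obtain m0 where m0: "\<And>m x. m \<ge> m0 \<Longrightarrow> x \<in> closure {x. f x \<noteq> 0} \<Longrightarrow> h m x = 1"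
      using h(4)[OF CK_plusD(3)[OF f]] by metis
    have m0': "f x * h m x = f x" if "m \<ge> m0" for m x
      using m0[OF that, of x] closure_subset[of "{x. f x \<noteq> 0}"] by (cases "f x = 0") auto
    have fp: "(\<lambda>x. f x * p m x) \<in> S" for m using fLb by (intro S_mult p) (auto simp: Lb_def)
    have cfp: "0 \<le> c (\<lambda>x. f x * p m x)" for m
      using c_mono[OF S_CK[OF CK_plus_zero] fp] CK_plusD(2)[OF f] CK_plusD(2)[OF p] by (simp add: c_zero)
    have "(\<Sum>m<n. c (\<lambda>x. f x * p m x)) = c (\<lambda>x. \<Sum>m<n. f x * p m x) \<and> (\<lambda>x. \<Sum>m<n. f x * p m x) \<in> S" for n
    proof (induction n)
      case (Suc n)
      then show ?case using c_add[OF _ fp, of "\<lambda>x. \<Sum>m<n. f x * p m x" n] S_add[OF _ fp] by simp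
    qed (use c_zero S_CK[OF CK_plus_zero] in simp)
    then have part: "(\<Sum>m<n. c (\<lambda>x. f x * p m x)) = c (\<lambda>x. f x * (\<Sum>m<n. p m x))" for n
      by (simp add: sum_distrib_left)
    \<comment> \<open>Once \<open>h\<close> equals 1 on the support of \<open>f\<close>, the
      partition of unity sums to 1 there, so the partial sums equal \<open>c f\<close>
      exactly.\<close>
    have "(\<lambda>n. \<Sum>m<n. c (\<lambda>x. f x * p m x)) \<longlonglongrightarrow> c f"
    proof (rule tendsto_eventually, rule eventually_sequentiallyI[of "Suc m0"])
      fix n assume "Suc m0 \<le> n"
      then have "(\<lambda>x. f x * (\<Sum>m<n. p m x)) = f"
        using m0'[of "n - 1"] by (intro ext) (simp add: psum)
      then show "(\<Sum>m<n. c (\<lambda>x. f x * p m x)) = c f" unfolding part by (rule arg_cong)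
    qed
    then have sums: "(\<lambda>m. c (\<lambda>x. f x * p m x)) sums c f" by (simp add: sums_def)
    have "mint \<mu> f = (\<Sum>i. \<integral>\<^sup>+x. ennreal (f x) \<partial>M i)"
      unfolding mint_def using CK_plus_measurable[OF f] by (intro \<mu>(2)) measurable
    also have "\<dots> = (\<Sum>i. ennreal (c (\<lambda>x. f x * p i x)))"
      using M(3,4)[OF fLb] CK_plusD(2)[OF f] by (intro suminf_cong) (simp add: nn_integral_eq_integral)
    also have "\<dots> = ennreal (c f)"
      using sums cfp by (simp add: suminf_ennreal2 sums_iff)
    finally show ?thesis .
  qed
  have c_nonneg: "0 \<le> c f" if "f \<in> CK_plus" for f
    using c_mono[OF S_CK[OF CK_plus_zero] S_CK[OF that]] CK_plusD(2)[OF that] by (simp add: c_zero)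
  have m_mono: "emeasure \<mu> K \<le> mint \<mu> f" if "K \<in> sets borel" "\<And>x. x \<in> K \<Longrightarrow> 1 \<le> f x" for K f
  proof -
    have "emeasure \<mu> K = (\<integral>\<^sup>+x. indicator K x \<partial>\<mu>)" using that \<mu>(1) by simp
    also have "\<dots> \<le> mint \<mu> f" unfolding mint_def using that(2)
      by (intro nn_integral_mono) (auto simp: indicator_def)
    finally show ?thesis .
  qed
  have m_mono': "mint \<mu> f \<le> emeasure \<mu> K" if "K \<in> sets borel" "\<And>x. f x \<le> 1" "\<And>x. x \<notin> K \<Longrightarrow> f x = 0" for K f
  proof -
    have "mint \<mu> f \<le> (\<integral>\<^sup>+x. indicator K x \<partial>\<mu>)" unfolding mint_def using that(2,3)
      by (intro nn_integral_mono) (auto simp: indicator_def)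
    then show ?thesis using that \<mu>(1) by simp
  qed
  have fin: "emeasure \<mu> K < \<infinity>" if K: "compact K" for K
  proof -
    obtain f where f: "f \<in> CK_plus" "\<And>x. x \<in> K \<Longrightarrow> f x = 1"
      by (rule bump[OF K open_UNIV]) auto
    then have "emeasure \<mu> K \<le> ennreal (c f)"
      using m_mono[of K f] compact_imp_closed[OF K] \<mu>_mint[OF f(1)] by simp
    then show ?thesis by (rule le_less_trans) simp
  qed
  have "\<mu> \<in> Mp"
  proof (rule Mp_of_compact_Nats[OF \<mu>(1) fin])
    fix K :: "'a set" assume K: "compact K"
    show "measure \<mu> K \<in> \<nat>"
    proof (rule Nats_of_approx)
      fix \<delta> :: real assume \<delta>: "0 < \<delta>"
      obtain V where V: "open V" "K \<subseteq> V" "compact (closure V)" "measure \<mu> V < measure \<mu> K + \<delta> / 2"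
        by (rule compact_outer_regular[OF \<mu>(1) fin K, of "\<delta> / 2"]) (use \<delta> in auto)
      obtain f where f: "f \<in> CK_plus" "\<And>x. f x \<le> 1" "\<And>x. x \<in> K \<Longrightarrow> f x = 1" "closure {x. f x \<noteq> 0} \<subseteq> V"
        by (rule bump[OF K V(1,2)]) auto
      \<comment> \<open>The integer \<open>\<nu> n L\<close> is squeezed between \<open>\<nu> n f\<close> and \<open>\<nu> n g\<close>, both close to \<open>\<mu> K\<close>.\<close>
      define L where "L = closure {x. f x \<noteq> 0}"
      have L: "compact L" using CK_plusD(3)[OF f(1)] by (simp add: L_def)
      obtain g where g: "g \<in> CK_plus" "\<And>x. g x \<le> 1" "\<And>x. x \<in> L \<Longrightarrow> g x = 1" "closure {x. g x \<noteq> 0} \<subseteq> V"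
        by (rule bump[OF L V(1)]) (use f(4) L_def in auto)
      have finV: "emeasure \<mu> V < \<infinity>"
        using le_less_trans[OF emeasure_mono[of V "closure V" \<mu>] fin[OF V(3)]] closure_subset[of V] \<mu>(1) by auto
      have "ennreal (measure \<mu> K) \<le> ennreal (c f)"
        using m_mono[of K f] f(3) compact_imp_closed[OF K] \<mu>_mint[OF f(1)] fin[OF K]
        by (simp add: emeasure_eq_ennreal_measure)
      then have Kf: "measure \<mu> K \<le> c f" using c_nonneg[OF f(1)] by simp
      have "g x = 0" if "x \<notin> V" for x using that g(4) closure_subset[of "{x. g x \<noteq> 0}"] by auto
      then have "ennreal (c g) \<le> ennreal (measure \<mu> V)"
        using m_mono'[of V g] g(2) V(1) \<mu>_mint[OF g(1)] finV by (simp add: emeasure_eq_ennreal_measure)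
      then have gV: "c g \<le> measure \<mu> V" by simp
      \<comment> \<open>From below all of \<delta> is available, because \<open>c f\<close> already
        dominates the mass of \<open>K\<close>; from above half of \<delta> has been spent on the
        neighbourhood \<open>V\<close>.\<close>
      have "eventually (\<lambda>n. c f - \<delta> < (\<integral>x. f x \<partial>\<nu> n)) G" "eventually (\<lambda>n. (\<integral>x. g x \<partial>\<nu> n) < c g + \<delta> / 2) G"
        using c[OF S_CK[OF f(1)]] c[OF S_CK[OF g(1)]] \<delta> by (auto intro: order_tendstoD)
      then have "eventually (\<lambda>n. c f - \<delta> < (\<integral>x. f x \<partial>\<nu> n) \<and> (\<integral>x. g x \<partial>\<nu> n) < c g + \<delta> / 2) G"
        by (rule eventually_conj)
      then obtain n where n: "c f - \<delta> < (\<integral>x. f x \<partial>\<nu> n)" "(\<integral>x. g x \<partial>\<nu> n) < c g + \<delta> / 2"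
        using eventually_happens'[OF G(2)] by blast
      have LB: "L \<in> bounded_borel" by (rule compact_bounded_borel[OF L])
      then obtain k :: nat where k: "emeasure (\<nu> n) L = of_nat k" using \<nu>[of n] by (auto simp: Mp_def)
      have Ls: "L \<in> sets (\<nu> n)" using LB Mp_sets[OF \<nu>] by (simp add: bounded_borel_def)
      have iL: "integrable (\<nu> n) (indicator L :: 'a \<Rightarrow> real)" using Ls k by (intro integrable_real_indicator) (auto simp: of_nat_less_top)
      have mL: "(\<integral>x. indicator L x \<partial>\<nu> n) = real k"
        using Ls k Mp_space[OF \<nu>] by (simp add: measure_def)
      have fL: "f x \<le> indicator L x" for x
        using f(2) closure_subset[of "{x. f x \<noteq> 0}"] by (cases "f x = 0") (auto simp: L_def indicator_def)
      have "(\<integral>x. f x \<partial>\<nu> n) \<le> real k"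
        unfolding mL[symmetric] using fL by (intro integral_mono integrable_CK \<nu> f iL) auto
      moreover have "real k \<le> (\<integral>x. g x \<partial>\<nu> n)"
        unfolding mL[symmetric] using g(3) CK_plusD(2)[OF g(1)]
        by (intro integral_mono integrable_CK \<nu> g iL) (auto simp: indicator_def)
      ultimately have "\<bar>real k - measure \<mu> K\<bar> < \<delta>"
        using n Kf gV V(4) by (simp add: abs_less_iff)
      then show "\<exists>k::nat. \<bar>real k - measure \<mu> K\<bar> < \<delta>" by blast
    qed
  qed
  moreover have "((\<lambda>n. \<integral>x. f x \<partial>\<nu> n) \<longlongrightarrow> (\<integral>x. f x \<partial>\<mu>)) G" if f: "f \<in> CK_plus" for f
  proof -
    have "ennreal (\<integral>x. f x \<partial>\<mu>) = ennreal (c f)" using mint_CK[OF calculation f] \<mu>_mint[OF f] by simp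
    then have "(\<integral>x. f x \<partial>\<mu>) = c f" using c_nonneg[OF f] integral_CK_nonneg[OF f] by simp
    then show ?thesis using c[OF S_CK[OF f]] by simp
  qed
  ultimately show thesis using G(1,2) that by blast
qed

end

section \<open>The continuity theorem for Laplace functionals\<close>

context lcsc_space
begin

lemma lap_zero_fun [simp]: "lap (\<lambda>_. 0) = (\<lambda>_. 1)"
  by (simp add: fun_eq_iff)

text \<open>Boundedness is asked on \<open>Mp\<close> only, since vague continuity does not
  constrain values elsewhere.\<close>

definition Cb :: "('a measure \<Rightarrow> real) set" where
  "Cb = {g. continuous_map vague_topology euclideanreal g \<and> (\<exists>C. \<forall>\<mu>\<in>Mp. \<bar>g \<mu>\<bar> \<le> C)}"

lemma CbD:
  assumes "g \<in> Cb"
  shows "continuous_map vague_topology euclideanreal g" "\<exists>C. \<forall>\<mu>\<in>Mp. \<bar>g \<mu>\<bar> \<le> C" "g \<in> borel_measurable Mp_borel"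
  using assms continuous_map_measurable by (auto simp: Cb_def)

lemma Cb_I: "continuous_map vague_topology euclideanreal g \<Longrightarrow> (\<And>\<mu>. \<mu> \<in> Mp \<Longrightarrow> \<bar>g \<mu>\<bar> \<le> C) \<Longrightarrow> g \<in> Cb"
  unfolding Cb_def by blast

lemma Cb_const: "(\<lambda>_. c) \<in> Cb"
  by (rule Cb_I[of _ "\<bar>c\<bar>"]) auto

lemma Cb_lap: "f \<in> CK_plus \<Longrightarrow> lap f \<in> Cb"
  by (rule Cb_I[of _ 1]) (auto intro: continuous_map_lap)

lemma Cb_add: assumes "g \<in> Cb" "k \<in> Cb" shows "(\<lambda>\<mu>. g \<mu> + k \<mu>) \<in> Cb"
proof -
  obtain C D where "\<forall>\<mu>\<in>Mp. \<bar>g \<mu>\<bar> \<le> C" "\<forall>\<mu>\<in>Mp. \<bar>k \<mu>\<bar> \<le> D" using CbD(2)[OF assms(1)] CbD(2)[OF assms(2)] by auto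
  then show ?thesis using CbD(1)[OF assms(1)] CbD(1)[OF assms(2)]
    by (intro Cb_I[of _ "C + D"] continuous_map_add) (auto intro: order_trans[OF abs_triangle_ineq] add_mono)
qed

lemma Cb_scale: assumes "g \<in> Cb" shows "(\<lambda>\<mu>. c * g \<mu>) \<in> Cb"
proof -
  obtain C where "\<forall>\<mu>\<in>Mp. \<bar>g \<mu>\<bar> \<le> C" using CbD(2)[OF assms(1)] by auto
  then show ?thesis using CbD(1)[OF assms(1)]
    by (intro Cb_I[of _ "\<bar>c\<bar> * C"] continuous_map_real_mult) (auto simp: abs_mult mult_left_mono)
qed

lemma Cb_max: assumes "g \<in> Cb" "k \<in> Cb" shows "(\<lambda>\<mu>. max (g \<mu>) (k \<mu>)) \<in> Cb"
proof -
  obtain C D where *: "\<forall>\<mu>\<in>Mp. \<bar>g \<mu>\<bar> \<le> C" "\<forall>\<mu>\<in>Mp. \<bar>k \<mu>\<bar> \<le> D" using CbD(2)[OF assms(1)] CbD(2)[OF assms(2)] by auto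
  have "\<bar>max (g \<mu>) (k \<mu>)\<bar> \<le> max C D" if "\<mu> \<in> Mp" for \<mu>
    using bspec[OF *(1) that] bspec[OF *(2) that] by (auto simp: max_def abs_le_iff)
  then show ?thesis using CbD(1)[OF assms(1)] CbD(1)[OF assms(2)]
    by (intro Cb_I[of _ "max C D"] continuous_map_real_max)
qed

lemma Cb_sum: "(\<And>m. g m \<in> Cb) \<Longrightarrow> (\<lambda>\<mu>. \<Sum>m<(n::nat). g m \<mu>) \<in> Cb"
  by (induction n) (auto intro: Cb_const Cb_add)

lemma sets_Mp_borel_Cb: "sets Mp_borel = sigma_sets Mp {{\<mu> \<in> Mp. 0 < \<phi> \<mu>} | \<phi>. \<phi> \<in> Cb}" (is "_ = sigma_sets Mp ?G")
proof (rule antisym)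
  show "sets Mp_borel \<subseteq> sigma_sets Mp ?G"
  proof (rule sets_Mp_borel_subset[OF _ sigma_sets.Basic])
    fix f :: "'a \<Rightarrow> real" and a assume f: "f \<in> CK_plus"
    have "{\<mu> \<in> Mp. a < lap f \<mu>} = {\<mu> \<in> Mp. 0 < lap f \<mu> + (- a)}" by auto
    then show "{\<mu> \<in> Mp. a < lap f \<mu>} \<in> ?G"
      by (intro CollectI exI[of _ "\<lambda>\<mu>. lap f \<mu> + (- a)"] conjI Cb_add Cb_lap f Cb_const)
  qed auto
  have "{\<mu> \<in> space Mp_borel. 0 < \<phi> \<mu>} \<in> sets Mp_borel" if "\<phi> \<in> Cb" for \<phi>
    using CbD(3)[OF that] by measurable
  then show "sigma_sets Mp ?G \<subseteq> sets Mp_borel"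
    using sets.sigma_sets_subset[of ?G Mp_borel] by auto
qed

text \<open>A Markov inequality in Laplace form: twice the right-hand side dominates the indicator
  of \<mu>(f) > t. The constant comes from 1/e \<le> 1/2.\<close>

lemma lap_scale_ge:
  assumes "\<mu> \<in> Mp" "f \<in> CK_plus" "0 < t" "t < (\<integral>x. f x \<partial>\<mu>)"
  shows "1 / 2 \<le> 1 - lap (\<lambda>x. f x / t) \<mu>"
proof -
  have f': "(\<lambda>x. f x / t) \<in> CK_plus" using CK_plus_scale[of "1 / t" f] assms by simp
  have "lap (\<lambda>x. f x / t) \<mu> = exp (- ((\<integral>x. f x \<partial>\<mu>) / t))"
    using f' assms by (simp add: lap_def exp_neg_CK)
  also have "\<dots> \<le> exp (- 1)" using assms by (simp add: field_simps)
  also have "\<dots> \<le> 1 / 2" using exp_ge_add_one_self[of "1::real"] by (simp add: exp_minus field_simps)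
  finally show ?thesis by simp
qed

theorem laplace_limit:
  fixes M :: "nat \<Rightarrow> 'a measure measure" and \<Theta> :: "('a \<Rightarrow> real) \<Rightarrow> real"
  assumes F: "F \<noteq> bot" and fin: "\<And>n. finite_measure (M n)" and sets: "\<And>n. sets (M n) = sets Mp_borel"
    and lim: "\<And>f. f \<in> CK_plus \<Longrightarrow> ((\<lambda>n. \<integral>\<mu>. lap f \<mu> \<partial>M n) \<longlongrightarrow> \<Theta> f) F"
    and cont: "\<And>f. f \<in> CK_plus \<Longrightarrow> (\<lambda>j. \<Theta> (\<lambda>x. f x / real (Suc j))) \<longlonglongrightarrow> \<Theta> (\<lambda>_. 0)"
  obtains L G where "finite_measure L" "sets L = sets Mp_borel"
    "\<And>f. f \<in> CK_plus \<Longrightarrow> (\<integral>\<mu>. lap f \<mu> \<partial>L) = \<Theta> f" "G \<le> F" "G \<noteq> bot"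
    "\<And>g. g \<in> Cb \<Longrightarrow> ((\<lambda>n. \<integral>\<mu>. g \<mu> \<partial>M n) \<longlongrightarrow> (\<integral>\<mu>. g \<mu> \<partial>L)) G"
proof -
  have sp: "space (M n) = Mp" for n using sets_eq_imp_space_eq[OF sets[of n]] by simp
  have int: "integrable (M n) g" if g: "g \<in> Cb" for g n
  proof -
    interpret finite_measure "M n" by (rule fin)
    obtain C where C: "\<forall>\<mu>\<in>Mp. \<bar>g \<mu>\<bar> \<le> C" using CbD(2)[OF g] by auto
    have "g \<in> borel_measurable (M n)" using CbD(3)[OF g] sets[of n] by (metis measurable_cong_sets)
    then show ?thesis using C by (intro integrable_const_bound[of _ C] AE_I2) (auto simp: sp)
  qed
  have mass: "((\<lambda>n. measure (M n) Mp) \<longlongrightarrow> \<Theta> (\<lambda>_. 0)) F"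
    using lim[OF CK_plus_zero] by (simp add: sp)
  have \<Theta>0: "0 \<le> \<Theta> (\<lambda>_. 0)" using mass F by (intro tendsto_lowerbound[OF mass]) auto
  have "\<exists>C. eventually (\<lambda>n. \<bar>\<integral>\<mu>. g \<mu> \<partial>M n\<bar> \<le> C) F" if g: "g \<in> Cb" for g
  proof -
    obtain C where C: "\<forall>\<mu>\<in>Mp. \<bar>g \<mu>\<bar> \<le> C" using CbD(2)[OF g] by auto
    have "\<bar>\<integral>\<mu>. g \<mu> \<partial>M n\<bar> \<le> \<bar>C\<bar> * measure (M n) Mp" for n
    proof -
      interpret finite_measure "M n" by (rule fin)
      have "\<bar>\<integral>\<mu>. g \<mu> \<partial>M n\<bar> \<le> (\<integral>\<mu>. \<bar>g \<mu>\<bar> \<partial>M n)" using integral_norm_bound[of "M n" g] by simp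
      also have "\<dots> \<le> (\<integral>\<mu>. \<bar>C\<bar> \<partial>M n)"
        using C by (intro integral_mono integrable_abs[OF int[OF g]]) (auto simp: sp)
      finally show ?thesis by (simp add: sp mult.commute)
    qed
    moreover have "eventually (\<lambda>n. measure (M n) Mp < \<Theta> (\<lambda>_. 0) + 1) F"
      using mass by (rule order_tendstoD(2)) simp
    then have "eventually (\<lambda>n. \<bar>C\<bar> * measure (M n) Mp \<le> \<bar>C\<bar> * (\<Theta> (\<lambda>_. 0) + 1)) F"
      by eventually_elim (simp add: mult_left_mono)
    ultimately have "eventually (\<lambda>n. \<bar>\<integral>\<mu>. g \<mu> \<partial>M n\<bar> \<le> \<bar>C\<bar> * (\<Theta> (\<lambda>_. 0) + 1)) F"
      by (elim eventually_mono) (blast intro: order_trans)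
    then show ?thesis by blast
  qed
  then obtain C where "\<And>g. g \<in> Cb \<Longrightarrow> eventually (\<lambda>n. \<bar>\<integral>\<mu>. g \<mu> \<partial>M n\<bar> \<le> C g) F" by metis
  then obtain G where G: "G \<le> F" "G \<noteq> bot" "\<And>g. g \<in> Cb \<Longrightarrow> \<exists>l. ((\<lambda>n. \<integral>\<mu>. g \<mu> \<partial>M n) \<longlongrightarrow> l) G"
    using filter_subnet[OF F, of Cb "\<lambda>n g. \<integral>\<mu>. g \<mu> \<partial>M n" C] by blast
  define I where "I g = Lim G (\<lambda>n. \<integral>\<mu>. g \<mu> \<partial>M n)" for g :: "'a measure \<Rightarrow> real"
  have I: "((\<lambda>n. \<integral>\<mu>. g \<mu> \<partial>M n) \<longlongrightarrow> I g) G" if "g \<in> Cb" for g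
    using G(3)[OF that] tendsto_Lim[OF G(2)] unfolding I_def by metis
  have I_unique: "I g = l" if "((\<lambda>n. \<integral>\<mu>. g \<mu> \<partial>M n) \<longlongrightarrow> l) G" for g l
    unfolding I_def using that by (rule tendsto_Lim[OF G(2)])
  have I_lap: "I (lap f) = \<Theta> f" if "f \<in> CK_plus" for f
    by (rule I_unique[OF tendsto_mono[OF G(1) lim[OF that]]])
  have I_one: "I (\<lambda>_. 1) = \<Theta> (\<lambda>_. 0)" using I_lap[OF CK_plus_zero] by simp
  have I_add: "I (\<lambda>\<mu>. g \<mu> + k \<mu>) = I g + I k" if "g \<in> Cb" "k \<in> Cb" for g k
    using tendsto_add[OF I[OF that(1)] I[OF that(2)]] int that by (intro I_unique) simp
  have I_scale: "I (\<lambda>\<mu>. a * g \<mu>) = a * I g" if "g \<in> Cb" for g a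
    using tendsto_mult_left[OF I[OF that], of a] by (intro I_unique) simp
  have I_mono: "I g \<le> I k" if "g \<in> Cb" "k \<in> Cb" "\<And>\<mu>. \<mu> \<in> Mp \<Longrightarrow> g \<mu> \<le> k \<mu>" for g k
    by (rule tendsto_le[OF G(2) I[OF that(2)] I[OF that(1)]])
      (intro always_eventually allI integral_mono int that, simp add: sp)
  have I_const: "I (\<lambda>_. a) = a * \<Theta> (\<lambda>_. 0)" for a using I_scale[OF Cb_const[of 1], of a] I_one by simp
  have I_sum: "I (\<lambda>\<mu>. \<Sum>m<n. g m \<mu>) = (\<Sum>m<n. I (g m))" if "\<And>m. g m \<in> Cb" for g and n :: nat
    by (induction n) (auto simp: I_const I_add that Cb_sum)
  interpret daniell_integral Mp Cb I
  proof
    fix u :: "nat \<Rightarrow> 'a measure \<Rightarrow> real"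
    assume u: "\<And>j. u j \<in> Cb" "\<And>\<mu>. \<mu> \<in> Mp \<Longrightarrow> decseq (\<lambda>j. u j \<mu>)" "\<And>\<mu>. \<mu> \<in> Mp \<Longrightarrow> (\<lambda>j. u j \<mu>) \<longlonglongrightarrow> 0"
    have nonneg: "0 \<le> u j \<mu>" if "\<mu> \<in> Mp" for j \<mu>
      using u(2,3)[OF that] decseq_ge by blast
    have Inn: "0 \<le> I (u j)" for j using I_mono[OF Cb_const[of 0] u(1)] nonneg by (simp add: I_const)
    have Idec: "I (u j) \<le> I (u i)" if "i \<le> j" for i j
      using u(2) that by (intro I_mono u) (auto simp: decseq_def)
    obtain h :: "nat \<Rightarrow> 'a \<Rightarrow> real" where h: "\<And>m. h m \<in> CK_plus"
      "\<And>K. compact K \<Longrightarrow> \<exists>m0. \<forall>m\<ge>m0. \<forall>x\<in>K. h m x = 1"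
      using exhaustion by metis
    obtain C0 where C0: "\<forall>\<mu>\<in>Mp. \<bar>u 0 \<mu>\<bar> \<le> C0" using CbD(2)[OF u(1)] by auto
    define C where "C = \<bar>C0\<bar> + 1"
    have C: "0 < C" "u j \<mu> \<le> C" if "\<mu> \<in> Mp" for j \<mu>
    proof -
      have "u j \<mu> \<le> u 0 \<mu>" using u(2)[OF that] by (simp add: decseq_def)
      then show "u j \<mu> \<le> C" using bspec[OF C0 that] by (simp add: C_def)
    qed (simp add: C_def)
    have C_pos: "0 < C" by (simp add: C_def)
    show "(\<lambda>j. I (u j)) \<longlonglongrightarrow> 0"
    proof (rule ccontr)
      assume "\<not> (\<lambda>j. I (u j)) \<longlonglongrightarrow> 0"
      then obtain e where e: "0 < e" "\<And>j. e \<le> I (u j)"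
        using Inn Idec unfolding LIMSEQ_def by (simp add: dist_real_def) (metis le_less_trans linorder_not_less)
      define T where "T = \<Theta> (\<lambda>_. 0) + 1"
      have T: "0 < T" "\<Theta> (\<lambda>_. 0) \<le> T" using \<Theta>0 by (auto simp: T_def)
      \<comment> \<open>With \<open>d * T = e / 4\<close> and
        \<open>2 * C * \<kappa> = e / 4\<close> the bound reached below is e/2, which contradicts
        \<open>e \<le> I (u i)\<close>.\<close>
      define d where "d = e / (4 * T)"
      have d: "0 < d" using e T by (simp add: d_def)
      define \<kappa> where "\<kappa> = e / (8 * C)"
      have \<kappa>: "0 < \<kappa>" using e C_pos by (simp add: \<kappa>_def)
      \<comment> \<open>The geometric factors make the errors from all the \<open>h m\<close>
        together at most \<kappa>.\<close>
      have "\<exists>J. \<Theta> (\<lambda>_. 0) - \<Theta> (\<lambda>x. h m x / real (Suc J)) < \<kappa> * (1/2) ^ Suc m" for m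
      proof -
        have "eventually (\<lambda>j. \<Theta> (\<lambda>_. 0) - \<kappa> * (1/2) ^ Suc m < \<Theta> (\<lambda>x. h m x / real (Suc j))) sequentially"
          using cont[OF h(1)] by (rule order_tendstoD(1)) (use \<kappa> in simp)
        then obtain J where "\<Theta> (\<lambda>_. 0) - \<kappa> * (1/2) ^ Suc m < \<Theta> (\<lambda>x. h m x / real (Suc J))"
          by (auto simp: eventually_sequentially simp del: of_nat_Suc)
        then show ?thesis by (intro exI[of _ J]) simp
      qed
      then obtain J where J: "\<And>m. \<Theta> (\<lambda>_. 0) - \<Theta> (\<lambda>x. h m x / real (Suc (J m))) < \<kappa> * (1/2) ^ Suc m" by metis
      define q where "q m \<mu> = 1 + (-1) * lap (\<lambda>x. h m x / real (Suc (J m))) \<mu>" for m \<mu>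
      have hq: "(\<lambda>x. h m x / real (Suc (J m))) \<in> CK_plus" for m by (rule CK_plus_divide[OF h(1)])
      have q: "q m \<in> Cb" for m unfolding q_def by (intro Cb_add Cb_const Cb_scale Cb_lap hq)
      have qn: "0 \<le> q m \<mu>" for m \<mu> by (simp add: q_def)
      have Iq: "I (q m) < \<kappa> * (1/2) ^ Suc m" for m
      proof -
        have "I (q m) = \<Theta> (\<lambda>_. 0) + (-1) * \<Theta> (\<lambda>x. h m x / real (Suc (J m)))"
          unfolding q_def by (simp only: I_add[OF Cb_const Cb_scale[OF Cb_lap[OF hq]]] I_scale[OF Cb_lap[OF hq]] I_lap[OF hq] I_one)
        then show ?thesis using J[of m] by simp
      qed
      \<comment> \<open>A vague cluster point of these witnesses contradicts the convergence of \<open>u i\<close> to \<open>0\<close>.\<close>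
      have "\<exists>\<mu>\<in>Mp. (\<forall>m<i. (\<integral>x. h m x \<partial>\<mu>) \<le> real (Suc (J m))) \<and> d \<le> u i \<mu>" for i
      proof (rule ccontr)
        assume neg: "\<not> ?thesis"
        \<comment> \<open>Outside the confining set some \<open>q m\<close> is at least 1/2, so the
          last term alone reaches the bound \<open>C\<close> of \<open>u i\<close>; inside it, the
          negated claim gives \<open>u i \<mu> < d\<close>.\<close>
        have le: "u i \<mu> \<le> d + 2 * C * (\<Sum>m<i. q m \<mu>)" if \<mu>: "\<mu> \<in> Mp" for \<mu>
        proof (cases "\<forall>m<i. (\<integral>x. h m x \<partial>\<mu>) \<le> real (Suc (J m))")
          case True
          then have "u i \<mu> < d" using neg \<mu> by force
          moreover have "0 \<le> 2 * C * (\<Sum>m<i. q m \<mu>)" using C_pos qn by (simp add: sum_nonneg)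
          ultimately show ?thesis by linarith
        next
          case False
          then obtain m where m: "m < i" "real (Suc (J m)) < (\<integral>x. h m x \<partial>\<mu>)" by force
          have "1 / 2 \<le> q m \<mu>" using lap_scale_ge[OF \<mu> h(1) _ m(2)] by (simp add: q_def)
          also have "\<dots> \<le> (\<Sum>m<i. q m \<mu>)" using m(1) qn by (intro member_le_sum) auto
          finally have "2 * C * (1 / 2) \<le> 2 * C * (\<Sum>m<i. q m \<mu>)" using C_pos by (intro mult_left_mono) auto
          then show ?thesis using C(2)[OF \<mu>, of i] d by linarith
        qed
        have "I (u i) \<le> I (\<lambda>\<mu>. d + 2 * C * (\<Sum>m<i. q m \<mu>))"
          using le by (intro I_mono u Cb_add Cb_const Cb_scale Cb_sum q)
        also have "\<dots> = d * \<Theta> (\<lambda>_. 0) + 2 * C * (\<Sum>m<i. I (q m))"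
          by (simp only: I_add[OF Cb_const Cb_scale[OF Cb_sum[OF q]]] I_scale[OF Cb_sum[OF q]] I_sum[OF q] I_const)
        also have "\<dots> \<le> d * T + 2 * C * \<kappa>"
        proof (intro add_mono mult_left_mono)
          have "(\<Sum>m<i. I (q m)) \<le> (\<Sum>m<i. \<kappa> * (1/2) ^ Suc m)" using Iq by (intro sum_mono less_imp_le)
          also have "\<dots> = \<kappa> * (\<Sum>m<i. (1/2) ^ Suc m)" by (rule sum_distrib_left[symmetric])
          also have "(\<Sum>m<i. (1/2 :: real) ^ Suc m) \<le> 1" 
          proof -
            have "(\<Sum>m<i. (1/2 :: real) ^ Suc m) = 1 - (1/2) ^ i" by (induction i) auto
            then show ?thesis by simp
          qed
          finally show "(\<Sum>m<i. I (q m)) \<le> \<kappa>" using \<kappa> by simp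
        qed (use T d C_pos in auto)
        also have "d * T = e / 4" using T by (simp add: d_def)
        also have "2 * C * \<kappa> = e / 4" using C_pos by (simp add: \<kappa>_def)
        finally show False using e(1) e(2)[of i] by linarith
      qed
      then obtain \<nu> where \<nu>: "\<And>i. \<nu> i \<in> Mp" "\<And>i m. m < i \<Longrightarrow> (\<integral>x. h m x \<partial>\<nu> i) \<le> real (Suc (J m))" "\<And>i. d \<le> u i (\<nu> i)"
        by metis
      have bdd: "\<exists>B. eventually (\<lambda>i. (\<integral>x. f x \<partial>\<nu> i) \<le> B) sequentially" if f: "f \<in> CK_plus" for f
      proof -
        obtain B where B: "0 < B" "\<And>x. f x \<le> B" using CK_plus_bounded[OF f] by metis
        obtain m where m: "\<forall>x\<in>closure {x. f x \<noteq> 0}. h m x = 1" using h(2)[OF CK_plusD(3)[OF f]] by auto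
        have le: "f x \<le> B * h m x" for x
          using m B closure_subset[of "{x. f x \<noteq> 0}"] CK_plusD(2)[OF h(1), of m x] by (cases "f x = 0") auto
        have "(\<integral>x. f x \<partial>\<nu> i) \<le> B * real (Suc (J m))" if "m < i" for i
        proof -
          have "(\<integral>x. f x \<partial>\<nu> i) \<le> (\<integral>x. B * h m x \<partial>\<nu> i)"
            using le by (intro integral_mono integrable_CK \<nu> f integrable_mult_right h)
          also have "\<dots> \<le> B * real (Suc (J m))" using \<nu>(2)[OF that] B by (simp add: mult_left_mono)
          finally show ?thesis .
        qed
        then show ?thesis by (intro exI[of _ "B * real (Suc (J m))"] eventually_sequentiallyI[of "Suc m"]) auto
      qed
      obtain \<mu> G' where \<mu>: "\<mu> \<in> Mp" "G' \<le> sequentially" "G' \<noteq> bot"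
        "\<And>f. f \<in> CK_plus \<Longrightarrow> ((\<lambda>n. \<integral>x. f x \<partial>\<nu> n) \<longlongrightarrow> (\<integral>x. f x \<partial>\<mu>)) G'"
        using vague_compactness[OF sequentially_bot \<nu>(1) bdd] by blast
      \<comment> \<open>Monotonicity gives \<open>u l (\<nu> i) \<ge> u i (\<nu> i) \<ge> d\<close>
        for i \<ge> l. With \<open>l\<close> fixed, continuity of \<open>u l\<close> carries this to
        the cluster point.\<close>
      have "d \<le> u l \<mu>" for l
      proof (rule tendsto_lowerbound[OF tendsto_continuous_map[OF CbD(1)[OF u(1)] \<mu>(1) \<nu>(1) \<mu>(4)] _ \<mu>(3)])
        have "d \<le> u l (\<nu> i)" if "l \<le> i" for i
          using \<nu>(3)[of i] u(2)[OF \<nu>(1), of i] that by (auto simp: decseq_def intro: order_trans)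
        then have "eventually (\<lambda>i. d \<le> u l (\<nu> i)) sequentially" by (rule eventually_sequentiallyI)
        then show "eventually (\<lambda>i. d \<le> u l (\<nu> i)) G'" by (rule filter_leD[OF \<mu>(2)])
      qed
      then have "d \<le> 0" using u(3)[OF \<mu>(1)] by (intro LIMSEQ_le_const) auto
      with d show False by simp
    qed
  qed (auto intro: Cb_const Cb_add Cb_scale Cb_max CbD(2) I_add I_scale I_mono[OF Cb_const[of 0], unfolded I_const, simplified])
  obtain L where L: "space L = Mp" "sets L = sets Mp_borel" "finite_measure L" "\<And>\<phi>. \<phi> \<in> Cb \<Longrightarrow> (\<integral>x. \<phi> x \<partial>L) = I \<phi>"
    by (rule daniell_representation) (auto simp: sets_Mp_borel_Cb)
  show thesis
  proof (rule that[OF L(3,2) _ G(1,2)])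
    show "(\<integral>\<mu>. lap f \<mu> \<partial>L) = \<Theta> f" if "f \<in> CK_plus" for f
      using L(4)[OF Cb_lap[OF that]] I_lap[OF that] by simp
    show "((\<lambda>n. \<integral>\<mu>. g \<mu> \<partial>M n) \<longlongrightarrow> (\<integral>\<mu>. g \<mu> \<partial>L)) G" if "g \<in> Cb" for g
      using I[OF that] L(4)[OF that] by simp
  qed
qed

text \<open>The fixed summand \<open>h\<close> serves the functionals built from the weights, in
  which only \<open>f\<close> shrinks; \<open>h = 0\<close> is continuity at zero.\<close>

lemma lap_scale_tendsto:
  assumes "\<mu> \<in> Mp" "f \<in> CK_plus" "h \<in> CK_plus"
  shows "(\<lambda>j. lap (\<lambda>x. f x / real (Suc j) + h x) \<mu>) \<longlonglongrightarrow> lap h \<mu>"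
proof -
  note f' = CK_plus_divide[OF assms(2)]
  have "lap (\<lambda>x. f x / real (Suc j)) \<mu> = exp (- ((\<integral>x. f x \<partial>\<mu>) / real (Suc j)))" for j
    using f'[of "Suc j"] assms by (simp add: lap_def exp_neg_CK)
  moreover have "(\<lambda>j. exp (- ((\<integral>x. f x \<partial>\<mu>) / real (Suc j)))) \<longlonglongrightarrow> exp (- 0)"
    by (intro tendsto_exp tendsto_minus LIMSEQ_Suc lim_const_over_n)
  ultimately have "(\<lambda>j. lap (\<lambda>x. f x / real (Suc j)) \<mu> * lap h \<mu>) \<longlonglongrightarrow> 1 * lap h \<mu>"
    by (intro tendsto_mult) auto
  then show ?thesis using assms f' by (simp add: lap_add del: of_nat_Suc)
qed

lemma laplace_scale_tendsto:
  assumes "finite_measure M" "sets M = sets Mp_borel" "f \<in> CK_plus" "h \<in> CK_plus"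
  shows "(\<lambda>j. \<integral>\<mu>. lap (\<lambda>x. f x / real (Suc j) + h x) \<mu> \<partial>M) \<longlonglongrightarrow> (\<integral>\<mu>. lap h \<mu> \<partial>M)"
proof (rule integral_dominated_convergence)
  interpret finite_measure M by fact
  have f': "(\<lambda>x. f x / real (Suc j) + h x) \<in> CK_plus" for j
    by (rule CK_plus_add[OF CK_plus_divide[OF assms(3)] assms(4)])
  have sp: "space M = Mp" using sets_eq_imp_space_eq[OF assms(2)] by simp
  show "lap h \<in> borel_measurable M" "lap (\<lambda>x. f x / real (Suc j) + h x) \<in> borel_measurable M" for j
    using measurable_lap[OF assms(4)] measurable_lap[OF f'] assms(2) by (metis measurable_cong_sets)+
  show "integrable M (\<lambda>_. 1)" by simp
  show "AE \<mu> in M. (\<lambda>j. lap (\<lambda>x. f x / real (Suc j) + h x) \<mu>) \<longlonglongrightarrow> lap h \<mu>"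
    using assms sp by (intro AE_I2 lap_scale_tendsto) auto
qed auto

text \<open>If the integrals of \<open>g\<close> failed to converge, \<open>laplace_limit\<close>
  would still give a limit measure along a filter that stays on the failing indices. Its transform
  is that of \<open>L\<close>, so uniqueness identifies the two, a contradiction.\<close>

theorem laplace_imp_weak_conv:
  fixes M :: "nat \<Rightarrow> 'a measure measure"
  assumes fin: "\<And>n. finite_measure (M n)" "finite_measure L"
    and sets: "\<And>n. sets (M n) = sets Mp_borel" "sets L = sets Mp_borel"
    and lim: "\<And>f. f \<in> CK_plus \<Longrightarrow> (\<lambda>n. \<integral>\<mu>. lap f \<mu> \<partial>M n) \<longlonglongrightarrow> (\<integral>\<mu>. lap f \<mu> \<partial>L)"
    and g: "g \<in> Cb"
  shows "(\<lambda>n. \<integral>\<mu>. g \<mu> \<partial>M n) \<longlonglongrightarrow> (\<integral>\<mu>. g \<mu> \<partial>L)"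
proof (rule ccontr)
  assume "\<not> ?thesis"
  then obtain e where e: "0 < e" "\<not> eventually (\<lambda>n. dist (\<integral>\<mu>. g \<mu> \<partial>M n) (\<integral>\<mu>. g \<mu> \<partial>L) < e) sequentially"
    unfolding tendsto_iff by blast
  define B where "B = {n. \<not> dist (\<integral>\<mu>. g \<mu> \<partial>M n) (\<integral>\<mu>. g \<mu> \<partial>L) < e}"
  \<comment> \<open>Along \<open>F\<close> the integrals of \<open>g\<close> stay away from the supposed limit.\<close>
  define F where "F = inf sequentially (principal B)"
  have F: "F \<noteq> bot"
  proof
    assume "F = bot"
    then have "eventually (\<lambda>n. False) F" by simp
    then have "eventually (\<lambda>n. n \<in> B \<longrightarrow> False) sequentially" unfolding F_def eventually_inf_principal .
    then show False using e(2) by (simp add: B_def)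
  qed
  have Fs: "F \<le> sequentially" by (simp add: F_def)
  obtain L' G where L': "finite_measure L'" "sets L' = sets Mp_borel"
    "\<And>f. f \<in> CK_plus \<Longrightarrow> (\<integral>\<mu>. lap f \<mu> \<partial>L') = (\<integral>\<mu>. lap f \<mu> \<partial>L)" "G \<le> F" "G \<noteq> bot"
    "\<And>g. g \<in> Cb \<Longrightarrow> ((\<lambda>n. \<integral>\<mu>. g \<mu> \<partial>M n) \<longlongrightarrow> (\<integral>\<mu>. g \<mu> \<partial>L')) G"
  proof (rule laplace_limit[OF F fin(1) sets(1), where \<Theta> = "\<lambda>f. \<integral>\<mu>. lap f \<mu> \<partial>L"])
    show "((\<lambda>n. \<integral>\<mu>. lap f \<mu> \<partial>M n) \<longlongrightarrow> (\<integral>\<mu>. lap f \<mu> \<partial>L)) F" if "f \<in> CK_plus" for f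
      by (rule tendsto_mono[OF Fs lim[OF that]])
    show "(\<lambda>j. \<integral>\<mu>. lap (\<lambda>x. f x / real (Suc j)) \<mu> \<partial>L) \<longlonglongrightarrow> (\<integral>\<mu>. lap (\<lambda>_. 0) \<mu> \<partial>L)" if "f \<in> CK_plus" for f
      using laplace_scale_tendsto[OF fin(2) sets(2) that CK_plus_zero] by simp
  qed (rule that)
  have "L' = L" by (rule laplace_unique[OF L'(1) fin(2) L'(2) sets(2) L'(3)])
  then have "((\<lambda>n. \<integral>\<mu>. g \<mu> \<partial>M n) \<longlongrightarrow> (\<integral>\<mu>. g \<mu> \<partial>L)) G" using L'(6)[OF g] by simp
  then have "eventually (\<lambda>n. dist (\<integral>\<mu>. g \<mu> \<partial>M n) (\<integral>\<mu>. g \<mu> \<partial>L) < e) G" using e(1) by (rule tendstoD)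
  moreover have "eventually (\<lambda>n. n \<in> B) G"
    by (rule filter_leD[OF L'(4)]) (simp add: F_def eventually_inf_principal)
  ultimately have "eventually (\<lambda>n. False) G" by eventually_elim (simp add: B_def)
  then show False using L'(5) by simp
qed

end

section \<open>Independent sums\<close>

text \<open>Products of factors in the unit interval differ by at most the sum of the differences of
  their factors, and |1 - x - exp(-x)| \<le> x^2 there; one of the two factors x is then bounded by
  \<epsilon>.\<close>

lemma prod_one_minus_exp_bound:
  fixes a :: "'i \<Rightarrow> real"
  assumes "finite J" "\<And>i. i \<in> J \<Longrightarrow> 0 \<le> a i" "\<And>i. i \<in> J \<Longrightarrow> a i \<le> 1" "\<And>i. i \<in> J \<Longrightarrow> a i \<le> \<epsilon>"
  shows "\<bar>(\<Prod>i\<in>J. 1 - a i) - exp (- (\<Sum>i\<in>J. a i))\<bar> \<le> \<epsilon> * (\<Sum>i\<in>J. a i)"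
proof -
  have pt: "\<bar>(1 - x) - exp (- x)\<bar> \<le> x * x" if "0 \<le> x" "x \<le> 1" for x :: real
  proof -
    have "1 - x \<le> exp (- x)" using exp_ge_add_one_self[of "- x"] by simp
    moreover have "exp (- x) \<le> 1 - x + x * x"
    proof -
      have "(1 - x + x * x) * (1 + x) = 1 + x * x * x" by (simp add: algebra_simps)
      moreover have "0 \<le> x * x * x" using that by simp
      ultimately have "1 \<le> (1 - x + x * x) * (1 + x)" by linarith
      also have "\<dots> \<le> (1 - x + x * x) * exp x"
        using that by (intro mult_left_mono) auto
      finally show ?thesis by (simp add: exp_minus field_simps)
    qed
    ultimately show ?thesis by (simp add: abs_le_iff)
  qed
  have "\<bar>(\<Prod>i\<in>J. 1 - a i) - exp (- (\<Sum>i\<in>J. a i))\<bar> = norm ((\<Prod>i\<in>J. 1 - a i) - (\<Prod>i\<in>J. exp (- a i)))"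
    using assms(1) by (simp add: exp_sum sum_negf[symmetric])
  also have "\<dots> \<le> (\<Sum>i\<in>J. norm ((1 - a i) - exp (- a i)))"
    using assms by (intro norm_prod_diff) (auto simp: abs_le_iff)
  also have "\<dots> \<le> (\<Sum>i\<in>J. \<epsilon> * a i)"
  proof (rule sum_mono)
    fix i assume i: "i \<in> J"
    have "norm ((1 - a i) - exp (- a i)) \<le> a i * a i" using pt assms i by simp
    also have "\<dots> \<le> \<epsilon> * a i" using assms i by (intro mult_right_mono) auto
    finally show "norm ((1 - a i) - exp (- a i)) \<le> \<epsilon> * a i" .
  qed
  finally show ?thesis by (simp add: sum_distrib_left)
qed

context lcsc_space
begin

text \<open>Integrality of point measures bounds the exponents through this dichotomy.\<close>

lemma mint_zero_or_charges:
  assumes \<mu>: "\<mu> \<in> Mp" and f: "f \<in> CK_plus"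
  shows "mint \<mu> f = 0 \<or> 1 \<le> emeasure \<mu> {x. f x \<noteq> (0::real)}"
proof -
  obtain n :: nat where n: "emeasure \<mu> {x. f x \<noteq> 0} = of_nat n"
    using \<mu> CK_plus_support_bounded[OF f] by (auto simp: Mp_def)
  show ?thesis
  proof (cases "n = 0")
    case True
    then have "mint \<mu> f = 0" using n mint_CK_eq_0_iff[OF \<mu> f] by simp
    then show ?thesis ..
  next
    case False
    then have "(1::nat) \<le> n" by simp
    then have "of_nat 1 \<le> (of_nat n :: ennreal)" by (rule of_nat_mono)
    then show ?thesis by (simp add: n)
  qed
qed

text \<open>A configuration seen by \<open>f\<close> has mass at least 1 on the set where
  \<open>f\<close> is nonzero, and on that set \<open>H\<close> is at least
  \<open>c\<close>.\<close>

lemma mint_ge_on_support: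
  assumes \<mu>: "\<mu> \<in> Mp" and f: "f \<in> CK_plus" and H: "\<And>x. f x \<noteq> 0 \<Longrightarrow> c \<le> H x"
  shows "mint \<mu> f = 0 \<or> ennreal c \<le> mint \<mu> H"
proof (cases "mint \<mu> f = 0")
  case False
  let ?B = "{x. f x \<noteq> 0}"
  have B: "?B \<in> sets \<mu>" using CK_plus_support_bounded[OF f] Mp_sets[OF \<mu>] by (simp add: bounded_borel_def)
  have "ennreal c * 1 \<le> ennreal c * emeasure \<mu> ?B"
    using mint_zero_or_charges[OF \<mu> f] False by (intro mult_left_mono) auto
  also have "\<dots> = (\<integral>\<^sup>+x. ennreal c * indicator ?B x \<partial>\<mu>)" using B by (simp add: nn_integral_cmult)
  also have "\<dots> \<le> mint \<mu> H"
    unfolding mint_def using H by (intro nn_integral_mono) (auto simp: indicator_def ennreal_leI)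
  finally show ?thesis by simp
qed simp

text \<open>If \<mu>(f) = 0 the left side vanishes. Otherwise \<mu>(h) \<ge> 1 and \<mu>(H) \<ge> c;
  the constant 2 compensates for 1 - 1/e \<ge> 1/2.\<close>

lemma lap_bound_on_support:
  assumes \<mu>: "\<mu> \<in> Mp" and f: "f \<in> CK_plus" 
    and h: "\<And>x. f x \<noteq> 0 \<Longrightarrow> 1 \<le> h x" and H: "\<And>x. f x \<noteq> 0 \<Longrightarrow> c \<le> H x" and "0 \<le> c"
  shows "lap H \<mu> * (1 - lap f \<mu>) \<le> 2 * exp (- c) * (1 - lap h \<mu>)"
proof (cases "mint \<mu> f = 0")
  case True
  then show ?thesis by (simp add: lap_def)
next
  case False
  have "lap h \<mu> \<le> exp_neg (ennreal 1)"
    unfolding lap_def using mint_ge_on_support[OF \<mu> f h] False by (intro exp_neg_antimono) auto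
  also have "\<dots> = exp (- 1)" by (subst exp_neg_ennreal) auto
  also have "\<dots> \<le> 1 / 2" using exp_ge_add_one_self[of "1::real"] by (simp add: exp_minus field_simps)
  finally have 1: "1 \<le> 2 * (1 - lap h \<mu>)" by simp
  have "lap H \<mu> \<le> exp_neg (ennreal c)"
    unfolding lap_def using mint_ge_on_support[OF \<mu> f H] False by (intro exp_neg_antimono) auto
  then have 2: "lap H \<mu> \<le> exp (- c)" using \<open>0 \<le> c\<close> by simp
  have "lap H \<mu> * (1 - lap f \<mu>) \<le> exp (- c) * 1" using 2 by (intro mult_mono) auto
  also have "\<dots> \<le> exp (- c) * (2 * (1 - lap h \<mu>))" using 1 by (intro mult_left_mono) auto
  finally show ?thesis by (simp add: algebra_simps)
qed

lemma one_minus_lap_bound: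
  assumes "\<mu> \<in> Mp" "f \<in> CK_plus" "\<And>x. f x \<noteq> 0 \<Longrightarrow> 1 \<le> h x"
  shows "1 - lap f \<mu> \<le> 2 * (1 - lap h \<mu>)"
  using lap_bound_on_support[OF assms, where c = 0 and H = "\<lambda>_. 0"] by simp

lemma null_measure_Mp [simp]: "null_measure borel \<in> Mp"
  by (auto simp: Mp_def radon_measure_def intro!: exI[of _ 0])

lemma sum_measure_Mp:
  assumes "finite J" "\<And>i. i \<in> J \<Longrightarrow> \<omega> i \<in> (Mp :: 'a measure set)"
  shows "sum_measure borel \<omega> J \<in> Mp"
proof -
  have em: "emeasure (sum_measure borel \<omega> J) A = (\<Sum>i\<in>J. emeasure (\<omega> i) A)" if "A \<in> sets borel" for A
    using that assms Mp_sets by (intro emeasure_sum_measure) auto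
  have "emeasure (sum_measure borel \<omega> J) K < \<infinity>" if K: "compact K" for K
    using em[of K] Mp_finite[OF assms(2) compact_bounded_borel[OF K]] compact_imp_closed[OF K] assms(1)
    by (simp add: less_top[symmetric])
  moreover have "\<exists>n::nat. emeasure (sum_measure borel \<omega> J) B = of_nat n" if B: "B \<in> bounded_borel" for B
  proof -
    have "\<forall>i\<in>J. \<exists>n::nat. emeasure (\<omega> i) B = of_nat n" using assms(2) B by (auto simp: Mp_def)
    from bchoice[OF this] obtain n :: "_ \<Rightarrow> nat" where "\<forall>i\<in>J. emeasure (\<omega> i) B = of_nat (n i)" ..
    then have "emeasure (sum_measure borel \<omega> J) B = of_nat (\<Sum>i\<in>J. n i)"
      using em[of B] B by (simp add: bounded_borel_def)
    then show ?thesis ..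
  qed
  ultimately show ?thesis by (simp add: Mp_def radon_measure_def)
qed

lemma mint_sum_measure:
  assumes "finite J" "\<And>i. i \<in> J \<Longrightarrow> \<omega> i \<in> (Mp :: 'a measure set)" "f \<in> borel_measurable borel"
  shows "mint (sum_measure borel \<omega> J) f = (\<Sum>i\<in>J. mint (\<omega> i) f)"
  unfolding mint_def using assms Mp_sets
  by (intro nn_integral_sum_measure) auto

lemma lap_sum_measure:
  assumes "finite J" "\<And>i. i \<in> J \<Longrightarrow> \<omega> i \<in> (Mp :: 'a measure set)" "f \<in> CK_plus"
  shows "lap f (sum_measure borel \<omega> J) = (\<Prod>i\<in>J. lap f (\<omega> i))"
  using mint_sum_measure[OF assms(1,2) CK_plus_measurable[OF assms(3)]] by (simp add: lap_def exp_neg_sum)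

lemma space_law: "sets M = sets Mp_borel \<Longrightarrow> space M = Mp"
  using sets_eq_imp_space_eq[of M Mp_borel] by simp

lemma measurable_lap_law: "sets M = sets Mp_borel \<Longrightarrow> f \<in> CK_plus \<Longrightarrow> lap f \<in> borel_measurable M"
  using measurable_lap by (metis measurable_cong_sets)

lemma integrable_lap:
  assumes "finite_measure M" "sets M = sets Mp_borel" "f \<in> CK_plus"
  shows "integrable M (lap f)"
  using finite_measure.integrable_const_bound[OF assms(1), of "lap f" 1] measurable_lap_law[OF assms(2,3)] by simp

lemma
  fixes M :: "'i \<Rightarrow> 'a measure measure"
  assumes J: "finite J" and M: "\<And>i. prob_space (M i)" "\<And>i. sets (M i) = sets Mp_borel"
  shows measurable_independent_sum: "(\<lambda>\<omega>. sum_measure borel \<omega> J) \<in> measurable (PiM J M) Mp_borel"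
    and laplace_independent_sum: "f \<in> CK_plus \<Longrightarrow>
      (\<integral>\<omega>. lap f (sum_measure borel \<omega> J) \<partial>PiM J M) = (\<Prod>i\<in>J. \<integral>\<mu>. lap f \<mu> \<partial>M i)"
proof -
  interpret product_prob_space M J
    by (intro product_prob_spaceI M)
  have sp: "\<omega> i \<in> Mp" if "\<omega> \<in> space (PiM J M)" "i \<in> J" for \<omega> i
    using that space_law[OF M(2)] by (auto simp: space_PiM)
  show "(\<lambda>\<omega>. sum_measure borel \<omega> J) \<in> measurable (PiM J M) Mp_borel"
  proof (rule measurable_Mp_borelI)
    show "sum_measure borel \<omega> J \<in> Mp" if "\<omega> \<in> space (PiM J M)" for \<omega>
      using sp[OF that] J by (intro sum_measure_Mp)
    fix f :: "'a \<Rightarrow> real" assume f: "f \<in> CK_plus"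
    have "(\<lambda>\<omega>. mint (\<omega> i) f) \<in> borel_measurable (PiM J M)" if "i \<in> J" for i
    proof (rule measurable_compose[OF measurable_component_singleton[OF that]])
      show "(\<lambda>\<mu>. mint \<mu> f) \<in> borel_measurable (M i)"
        using measurable_mint_CK[OF f] M(2) by (metis measurable_cong_sets)
    qed
    then have "(\<lambda>\<omega>. \<Sum>i\<in>J. mint (\<omega> i) f) \<in> borel_measurable (PiM J M)" by (rule borel_measurable_sum)
    then show "(\<lambda>\<omega>. mint (sum_measure borel \<omega> J) f) \<in> borel_measurable (PiM J M)"
      by (rule measurable_cong[THEN iffD1, rotated])
        (use sp J CK_plus_measurable[OF f] in \<open>simp add: mint_sum_measure\<close>)
  qed
  assume f: "f \<in> CK_plus"
  have "(\<integral>\<omega>. lap f (sum_measure borel \<omega> J) \<partial>PiM J M) = (\<integral>\<omega>. (\<Prod>i\<in>J. lap f (\<omega> i)) \<partial>PiM J M)"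
    using sp J f by (intro Bochner_Integration.integral_cong) (simp_all add: lap_sum_measure)
  also have "\<dots> = (\<Prod>i\<in>J. \<integral>\<mu>. lap f \<mu> \<partial>M i)"
    using integrable_lap[OF prob_space.finite_measure[OF M(1)] M(2) f] J by (intro product_integral_prod) auto
  finally show "(\<integral>\<omega>. lap f (sum_measure borel \<omega> J) \<partial>PiM J M) = (\<Prod>i\<in>J. \<integral>\<mu>. lap f \<mu> \<partial>M i)" .
qed

lemma independent_sum_law:
  fixes M :: "'i \<Rightarrow> 'a measure measure"
  assumes J: "finite J" and M: "\<And>i. prob_space (M i)" "\<And>i. sets (M i) = sets Mp_borel"
  obtains L where "prob_space L" "sets L = sets Mp_borel"
    "\<And>f. f \<in> CK_plus \<Longrightarrow> (\<integral>\<mu>. lap f \<mu> \<partial>L) = (\<Prod>i\<in>J. \<integral>\<mu>. lap f \<mu> \<partial>M i)"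
proof -
  interpret product_prob_space M J by (intro product_prob_spaceI M)
  have P: "prob_space (PiM J M)" by (intro prob_space_PiM M)
  note m = measurable_independent_sum[of J M, OF assms]
  let ?L = "distr (PiM J M) Mp_borel (\<lambda>\<omega>. sum_measure borel \<omega> J)"
  show thesis
  proof (rule that[of ?L])
    show "prob_space ?L" by (rule prob_space.prob_space_distr[OF P m])
    show "(\<integral>\<mu>. lap f \<mu> \<partial>?L) = (\<Prod>i\<in>J. \<integral>\<mu>. lap f \<mu> \<partial>M i)" if "f \<in> CK_plus" for f
      using integral_distr[OF m measurable_lap[OF that]] laplace_independent_sum[OF assms that] by simp
  qed simp
qed

text \<open>The thinning is all or nothing: the whole configuration is kept with probability
  \<open>p\<close> and replaced by o otherwise, and o has transform 1.\<close>

lemma thinned_law: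
  fixes M :: "'a measure measure"
  assumes M: "prob_space M" "sets M = sets Mp_borel" and p: "0 \<le> p" "p \<le> 1"
  obtains L where "prob_space L" "sets L = sets Mp_borel"
    "\<And>f. f \<in> CK_plus \<Longrightarrow> (\<integral>\<mu>. lap f \<mu> \<partial>L) = 1 - p * (1 - (\<integral>\<mu>. lap f \<mu> \<partial>M))"
proof -
  let ?D = "return Mp_borel (null_measure borel) :: 'a measure measure"
  define m where "m b = (if b then scale_measure (ennreal p) M else scale_measure (ennreal (1 - p)) ?D)" for b :: bool
  define L where "L = sum_measure Mp_borel m UNIV"
  have sm: "sets (m b) = sets Mp_borel" for b using M by (simp add: m_def)
  have nn: "(\<integral>\<^sup>+\<mu>. f \<mu> \<partial>L) = ennreal p * (\<integral>\<^sup>+\<mu>. f \<mu> \<partial>M) + ennreal (1 - p) * f (null_measure borel)"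
    if f: "f \<in> borel_measurable Mp_borel" for f :: "'a measure \<Rightarrow> ennreal"
  proof -
    have fM: "f \<in> borel_measurable M" using f M(2) by (metis measurable_cong_sets)
    have "(\<integral>\<^sup>+\<mu>. f \<mu> \<partial>L) = (\<Sum>b\<in>UNIV. \<integral>\<^sup>+\<mu>. f \<mu> \<partial>m b)"
      unfolding L_def by (rule nn_integral_sum_measure) (use sm f in auto)
    then show ?thesis using f fM
      by (simp add: UNIV_bool m_def nn_integral_scale_measure nn_integral_return add.commute)
  qed
  have sL: "sets L = sets Mp_borel" by (simp add: L_def)
  have "emeasure L (space L) = (\<integral>\<^sup>+\<mu>. 1 \<partial>L)" by simp
  also have "\<dots> = ennreal p + ennreal (1 - p)"
    using nn[of "\<lambda>_. 1"] prob_space.emeasure_space_1[OF M(1)] by simp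
  also have "\<dots> = 1" using p by (simp flip: ennreal_plus)
  finally have L: "prob_space L" by (rule prob_spaceI)
  show thesis
  proof (rule that[OF L sL])
    fix f :: "'a \<Rightarrow> real" assume f: "f \<in> CK_plus"
    have "ennreal (\<integral>\<mu>. lap f \<mu> \<partial>L) = (\<integral>\<^sup>+\<mu>. ennreal (lap f \<mu>) \<partial>L)"
      using integrable_lap[OF prob_space.finite_measure[OF L] sL f] by (simp add: nn_integral_eq_integral)
    also have "\<dots> = ennreal p * ennreal (\<integral>\<mu>. lap f \<mu> \<partial>M) + ennreal (1 - p) * ennreal (lap f (null_measure borel))"
    proof -
      have "(\<lambda>\<mu>. ennreal (lap f \<mu>)) \<in> borel_measurable Mp_borel" using measurable_lap[OF f] by measurable
      then show ?thesis
        using nn integrable_lap[OF prob_space.finite_measure[OF M(1)] M(2) f] by (simp add: nn_integral_eq_integral)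
    qed
    also have "lap f (null_measure borel) = 1" by (simp add: lap_def mint_def)
    finally have "ennreal (\<integral>\<mu>. lap f \<mu> \<partial>L) = ennreal (p * (\<integral>\<mu>. lap f \<mu> \<partial>M) + (1 - p))"
      using p by (simp add: ennreal_mult' integral_nonneg_AE)
    moreover have "0 \<le> p * (\<integral>\<mu>. lap f \<mu> \<partial>M) + (1 - p)" "0 \<le> (\<integral>\<mu>. lap f \<mu> \<partial>L)"
      using p by (auto intro!: add_nonneg_nonneg simp: integral_nonneg_AE)
    ultimately have "(\<integral>\<mu>. lap f \<mu> \<partial>L) = p * (\<integral>\<mu>. lap f \<mu> \<partial>M) + (1 - p)"
      using ennreal_inj by blast
    then show "(\<integral>\<mu>. lap f \<mu> \<partial>L) = 1 - p * (1 - (\<integral>\<mu>. lap f \<mu> \<partial>M))"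
      by (simp add: algebra_simps)
  qed
qed

end

section \<open>Scalar null arrays: products against exponentials\<close>

lemma array_diff_tendsto_0:
  fixes a :: "nat \<Rightarrow> 'i \<Rightarrow> real"
  assumes fin: "\<And>n. finite (J n)" and a: "\<And>n i. i \<in> J n \<Longrightarrow> 0 \<le> a n i" "\<And>n i. i \<in> J n \<Longrightarrow> a n i \<le> 1"
    and negl: "\<And>\<epsilon>. 0 < \<epsilon> \<Longrightarrow> eventually (\<lambda>n. \<forall>i\<in>J n. a n i \<le> \<epsilon>) sequentially"
    and bdd: "eventually (\<lambda>n. (\<Sum>i\<in>J n. a n i) \<le> C) sequentially"
  shows "(\<lambda>n. (\<Prod>i\<in>J n. 1 - a n i) - exp (- (\<Sum>i\<in>J n. a n i))) \<longlonglongrightarrow> 0"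
  unfolding tendsto_iff
proof (intro allI impI)
  fix e :: real assume e: "0 < e"
  define \<epsilon> where "\<epsilon> = e / (\<bar>C\<bar> + 1)"
  have \<epsilon>: "0 < \<epsilon>" using e by (simp add: \<epsilon>_def)
  show "eventually (\<lambda>n. dist ((\<Prod>i\<in>J n. 1 - a n i) - exp (- (\<Sum>i\<in>J n. a n i))) 0 < e) sequentially"
    using negl[OF \<epsilon>] bdd
  proof eventually_elim
    case (elim n)
    have "\<bar>(\<Prod>i\<in>J n. 1 - a n i) - exp (- (\<Sum>i\<in>J n. a n i))\<bar> \<le> \<epsilon> * (\<Sum>i\<in>J n. a n i)"
      using elim by (intro prod_one_minus_exp_bound fin a) auto
    also have "\<dots> \<le> \<epsilon> * \<bar>C\<bar>" using elim \<epsilon> by (intro mult_left_mono) auto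
    also have "\<dots> < \<epsilon> * (\<bar>C\<bar> + 1)" using \<epsilon> by simp
    also have "\<dots> = e" by (simp add: \<epsilon>_def)
    finally show ?case by simp
  qed
qed

lemma array_prod_tendsto_exp:
  fixes a :: "nat \<Rightarrow> 'i \<Rightarrow> real"
  assumes "\<And>n. finite (J n)" "\<And>n i. i \<in> J n \<Longrightarrow> 0 \<le> a n i" "\<And>n i. i \<in> J n \<Longrightarrow> a n i \<le> 1"
    and "\<And>\<epsilon>. 0 < \<epsilon> \<Longrightarrow> eventually (\<lambda>n. \<forall>i\<in>J n. a n i \<le> \<epsilon>) sequentially"
    and lim: "(\<lambda>n. \<Sum>i\<in>J n. a n i) \<longlonglongrightarrow> s"
  shows "(\<lambda>n. \<Prod>i\<in>J n. 1 - a n i) \<longlonglongrightarrow> exp (- s)"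
proof -
  have "eventually (\<lambda>n. (\<Sum>i\<in>J n. a n i) < s + 1) sequentially"
    using lim by (rule order_tendstoD) simp
  then have "eventually (\<lambda>n. (\<Sum>i\<in>J n. a n i) \<le> s + 1) sequentially"
    by eventually_elim simp
  from tendsto_add[OF array_diff_tendsto_0[OF assms(1-4) this] tendsto_exp[OF tendsto_minus[OF lim]]]
  show ?thesis by simp
qed

text \<open>The bound on the sums that the comparison needs is extracted from 1 - x \<le> exp(-x): a
  product that stays away from 0 keeps its sum bounded.\<close>

lemma array_sum_tendsto_ln:
  fixes a :: "nat \<Rightarrow> 'i \<Rightarrow> real"
  assumes "\<And>n. finite (J n)" "\<And>n i. i \<in> J n \<Longrightarrow> 0 \<le> a n i" "\<And>n i. i \<in> J n \<Longrightarrow> a n i \<le> 1"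
    and "\<And>\<epsilon>. 0 < \<epsilon> \<Longrightarrow> eventually (\<lambda>n. \<forall>i\<in>J n. a n i \<le> \<epsilon>) sequentially"
    and lim: "(\<lambda>n. \<Prod>i\<in>J n. 1 - a n i) \<longlonglongrightarrow> l" and l: "0 < l"
  shows "(\<lambda>n. \<Sum>i\<in>J n. a n i) \<longlonglongrightarrow> - ln l"
proof -
  have "eventually (\<lambda>n. l / 2 < (\<Prod>i\<in>J n. 1 - a n i)) sequentially"
    using lim by (rule order_tendstoD) (use l in simp)
  then have "eventually (\<lambda>n. (\<Sum>i\<in>J n. a n i) \<le> - ln (l / 2)) sequentially"
  proof eventually_elim
    case (elim n)
    have "(\<Prod>i\<in>J n. 1 - a n i) \<le> (\<Prod>i\<in>J n. exp (- a n i))"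
    proof (rule prod_mono)
      fix i assume "i \<in> J n"
      then show "0 \<le> 1 - a n i \<and> 1 - a n i \<le> exp (- a n i)"
        using assms(3) exp_ge_add_one_self[of "- a n i"] by auto
    qed
    also have "\<dots> = exp (- (\<Sum>i\<in>J n. a n i))" using assms(1) by (simp add: exp_sum sum_negf[symmetric])
    finally have "l / 2 < exp (- (\<Sum>i\<in>J n. a n i))" using elim by simp
    then have "ln (l / 2) < ln (exp (- (\<Sum>i\<in>J n. a n i)))" using l by (subst ln_less_cancel_iff) auto
    then show ?case by simp
  qed
  from tendsto_diff[OF lim array_diff_tendsto_0[OF assms(1-4) this]]
  have "(\<lambda>n. exp (- (\<Sum>i\<in>J n. a n i))) \<longlonglongrightarrow> l" by simp
  from tendsto_ln[OF this] l have "(\<lambda>n. - (\<Sum>i\<in>J n. a n i)) \<longlonglongrightarrow> ln l" by simp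
  from tendsto_minus[OF this] show ?thesis by simp
qed

context lcsc_space
begin

section \<open>Laplace exponents of admissible measures\<close>

lemma laplace_exponent_lap: "laplace_exponent \<nu> f = (\<integral>\<^sup>+\<mu>. ennreal (1 - lap f \<mu>) \<partial>\<nu>)"
  by (simp add: laplace_exponent_def lap_def)

lemma lap_mono: "(\<And>x. f x \<le> g x) \<Longrightarrow> lap g \<mu> \<le> lap f \<mu>"
  unfolding lap_def by (intro exp_neg_antimono mint_mono)

lemma bump_on_support:
  assumes "f \<in> CK_plus"
  obtains b :: "'a \<Rightarrow> real" where "b \<in> CK_plus" "\<And>x. b x \<le> 1" "\<And>x. f x \<noteq> (0::real) \<Longrightarrow> 1 \<le> b x"
proof -
  obtain b where b: "b \<in> CK_plus" "\<And>x. b x \<le> 1" "\<And>x. x \<in> closure {x. f x \<noteq> 0} \<Longrightarrow> b x = (1::real)"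
    by (rule bump[OF CK_plusD(3)[OF assms] open_UNIV]) auto
  show thesis using b closure_subset[of "{x. f x \<noteq> 0}"] by (intro that[of b]) force+
qed

text \<open>Admissibility speaks of sets, hence controls functions below an indicator, such as the
  bump \<open>b\<close>. The exponent of \<open>f\<close> is compared with that of \<open>b\<close>
  by integrality, through the support of \<open>f\<close> alone.\<close>

lemma laplace_exponent_finite:
  assumes \<nu>: "admissible_measure \<nu>" and f: "f \<in> CK_plus"
  shows "laplace_exponent \<nu> (f :: 'a \<Rightarrow> real) < \<infinity>"
proof -
  have s\<nu>: "sets \<nu> = sets Mp_borel" using \<nu> by (simp add: admissible_measure_def)
  obtain b where b: "b \<in> CK_plus" "\<And>x. b x \<le> 1" "\<And>x. f x \<noteq> 0 \<Longrightarrow> 1 \<le> b x"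
    using bump_on_support[OF f] by metis
  let ?B = "{x. b x \<noteq> 0}"
  have B: "?B \<in> bounded_borel" by (rule CK_plus_support_bounded[OF b(1)])
  have "laplace_exponent \<nu> b \<le> (\<integral>\<^sup>+\<mu>. ennreal (1 - exp_neg (emeasure \<mu> ?B)) \<partial>\<nu>)"
    unfolding laplace_exponent_def
  proof (intro nn_integral_mono ennreal_leI diff_left_mono exp_neg_antimono)
    fix \<mu> assume "\<mu> \<in> space \<nu>"
    then have \<mu>: "\<mu> \<in> Mp" using space_law[OF s\<nu>] by simp
    have "mint \<mu> b \<le> (\<integral>\<^sup>+x. indicator ?B x \<partial>\<mu>)"
      unfolding mint_def using b(2) by (intro nn_integral_mono) (auto simp: indicator_def)
    also have "\<dots> = emeasure \<mu> ?B" using B Mp_sets[OF \<mu>] by (simp add: bounded_borel_def)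
    finally show "mint \<mu> b \<le> emeasure \<mu> ?B" .
  qed
  also have "\<dots> < \<infinity>" using \<nu> B by (simp add: admissible_measure_def)
  finally have bf: "laplace_exponent \<nu> b < \<infinity>" .
  have "laplace_exponent \<nu> f \<le> (\<integral>\<^sup>+\<mu>. 2 * ennreal (1 - lap b \<mu>) \<partial>\<nu>)"
    unfolding laplace_exponent_lap
  proof (intro nn_integral_mono)
    fix \<mu> assume "\<mu> \<in> space \<nu>"
    then have \<mu>: "\<mu> \<in> Mp" using space_law[OF s\<nu>] by simp
    have "ennreal (1 - lap f \<mu>) \<le> ennreal (2 * (1 - lap b \<mu>))"
      by (intro ennreal_leI one_minus_lap_bound \<mu> f b)
    also have "\<dots> = 2 * ennreal (1 - lap b \<mu>)" by (subst ennreal_mult') auto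
    finally show "ennreal (1 - lap f \<mu>) \<le> 2 * ennreal (1 - lap b \<mu>)" .
  qed
  also have "\<dots> = 2 * laplace_exponent \<nu> b"
    unfolding laplace_exponent_lap using measurable_lap_law[OF s\<nu> b(1)] by (intro nn_integral_cmult) measurable
  also have "\<dots> < \<infinity>" using bf by (simp add: ennreal_mult_less_top)
  finally show ?thesis .
qed

text \<open>Dominated convergence with the exponent of \<open>f\<close> as majorant. This is the
  continuity at zero that keeps mass from escaping when a limit law is built from a given
  measure.\<close>

lemma laplace_exponent_scale_tendsto:
  assumes \<nu>: "admissible_measure \<nu>" and f: "f \<in> CK_plus"
  shows "(\<lambda>j. laplace_exponent \<nu> (\<lambda>x::'a. f x / real (Suc j))) \<longlonglongrightarrow> 0"
proof -
  have s\<nu>: "sets \<nu> = sets Mp_borel" using \<nu> by (simp add: admissible_measure_def)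
  note f' = CK_plus_divide[OF f]
  have "(\<lambda>j. \<integral>\<^sup>+\<mu>. ennreal (1 - lap (\<lambda>x. f x / real (Suc j)) \<mu>) \<partial>\<nu>) \<longlonglongrightarrow> (\<integral>\<^sup>+\<mu>. 0 \<partial>\<nu>)"
  proof (rule nn_integral_dominated_convergence)
    show "(\<lambda>\<mu>. ennreal (1 - lap (\<lambda>x. f x / real (Suc j)) \<mu>)) \<in> borel_measurable \<nu>" for j
      using measurable_lap_law[OF s\<nu> f'] by measurable
    show "(\<lambda>\<mu>. ennreal (1 - lap f \<mu>)) \<in> borel_measurable \<nu>"
      using measurable_lap_law[OF s\<nu> f] by measurable
    show "(\<integral>\<^sup>+\<mu>. ennreal (1 - lap f \<mu>) \<partial>\<nu>) < \<infinity>"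
      using laplace_exponent_finite[OF \<nu> f] by (simp add: laplace_exponent_lap)
    have "f x / real (Suc j) \<le> f x" for j x
      using CK_plusD(2)[OF f, of x] by (simp add: field_simps mult_left_mono)
    then show "AE \<mu> in \<nu>. ennreal (1 - lap (\<lambda>x. f x / real (Suc j)) \<mu>) \<le> ennreal (1 - lap f \<mu>)" for j
      by (intro AE_I2 ennreal_leI diff_left_mono lap_mono)
    show "AE \<mu> in \<nu>. (\<lambda>j. ennreal (1 - lap (\<lambda>x. f x / real (Suc j)) \<mu>)) \<longlonglongrightarrow> 0"
    proof (rule AE_I2)
      fix \<mu> assume "\<mu> \<in> space \<nu>"
      then have "(\<lambda>j. lap (\<lambda>x. f x / real (Suc j) + 0) \<mu>) \<longlonglongrightarrow> 1"
        using lap_scale_tendsto[OF _ f CK_plus_zero] space_law[OF s\<nu>] by simp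
      then have "(\<lambda>j. 1 - lap (\<lambda>x. f x / real (Suc j)) \<mu>) \<longlonglongrightarrow> 1 - 1" by (intro tendsto_intros) simp
      from tendsto_ennrealI[OF this] show "(\<lambda>j. ennreal (1 - lap (\<lambda>x. f x / real (Suc j)) \<mu>)) \<longlonglongrightarrow> 0" by simp
    qed
  qed simp
  then show ?thesis by (simp add: laplace_exponent_lap)
qed

text \<open>Test functions have finite integrals, so \<open>lap f\<close> is strictly positive on
  \<open>Mp\<close>; this makes logarithms of transforms available.\<close>

lemma laplace_pos:
  assumes "prob_space Q" "sets Q = sets Mp_borel" "f \<in> CK_plus"
  shows "0 < (\<integral>\<mu>. lap f \<mu> \<partial>Q)"
proof (rule ccontr)
  interpret prob_space Q by fact
  have int: "integrable Q (lap f)" using integrable_lap[OF finite_measure_axioms assms(2,3)] .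
  assume "\<not> 0 < (\<integral>\<mu>. lap f \<mu> \<partial>Q)"
  then have "(\<integral>\<mu>. lap f \<mu> \<partial>Q) = 0"
    using integral_nonneg_AE[of "lap f" Q] by (simp add: order_antisym)
  then have "AE \<mu> in Q. lap f \<mu> = 0"
    using int by (subst (asm) integral_nonneg_eq_0_iff_AE) auto
  moreover have "AE \<mu> in Q. lap f \<mu> \<noteq> 0"
    using assms space_law[OF assms(2)] by (intro AE_I2) (simp add: lap_def exp_neg_CK)
  ultimately have "AE \<mu> in Q. False" by eventually_elim simp
  then show False by simp
qed

lemma prob_spaceI_laplace:
  assumes "finite_measure L" "(\<integral>\<mu>. lap (\<lambda>_. 0) \<mu> \<partial>L) = 1"
  shows "prob_space L"
proof -
  interpret finite_measure L by fact
  show ?thesis using assms(2) by (intro prob_spaceI) (simp add: emeasure_eq_measure)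
qed

text \<open>The exhausting functions separate o from all other configurations by countably many
  measurable conditions.\<close>

lemma null_singleton_sets: "{null_measure borel :: 'a measure} \<in> sets Mp_borel"
proof -
  obtain h :: "nat \<Rightarrow> 'a \<Rightarrow> real" where h: "\<And>m. h m \<in> CK_plus"
    "\<And>K. compact K \<Longrightarrow> \<exists>m0. \<forall>m\<ge>m0. \<forall>x\<in>K. h m x = 1"
    using exhaustion by metis
  have "\<mu> = null_measure borel" if \<mu>: "\<mu> \<in> Mp" and z: "\<And>m. mint \<mu> (h m) = 0" for \<mu> :: "'a measure"
  proof -
    have "emeasure \<mu> {x. h m x \<noteq> 0} = 0" for m
      using z mint_CK_eq_0_iff[OF \<mu> h(1)] by simp
    moreover have "{x. h m x \<noteq> 0} \<in> sets \<mu>" for m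
      using CK_plus_open_support[OF h(1)] Mp_sets[OF \<mu>] by simp
    ultimately have "emeasure \<mu> (\<Union>m. {x. h m x \<noteq> 0}) = 0" by (intro emeasure_UN_eq_0) auto
    moreover have "(\<Union>m. {x. h m x \<noteq> 0}) = UNIV"
    proof -
      have "\<exists>m. h m x = 1" for x using h(2)[of "{x}"] by auto
      then show ?thesis by (metis (mono_tags, lifting) UNIV_eq_I UN_I iso_tuple_UNIV_I mem_Collect_eq zero_neq_one)
    qed
    ultimately have "emeasure \<mu> UNIV = 0" by simp
    then have "emeasure \<mu> A = 0" if "A \<in> sets \<mu>" for A
      using emeasure_mono[of A UNIV \<mu>] Mp_sets[OF \<mu>] by auto
    then show ?thesis using Mp_sets[OF \<mu>] by (intro measure_eqI) auto
  qed
  then have "{null_measure borel :: 'a measure} = {\<mu> \<in> space Mp_borel. \<forall>m. mint \<mu> (h m) = 0}"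
    by (auto simp: mint_def)
  also have "\<dots> \<in> sets Mp_borel"
  proof (rule sets.sets_Collect_countable_All)
    show "{\<mu> \<in> space Mp_borel. mint \<mu> (h m) = 0} \<in> sets Mp_borel" for m
      using measurable_mint_CK[OF h(1), of m] by measurable
  qed
  finally show ?thesis .
qed

end

section \<open>Null arrays\<close>

text \<open>Only laws enter, and smallness of the entries is stated through transforms instead of
  charging probabilities. In this form it is inherited at once by an array whose entries are
  replaced by o with a fixed probability, as roots require.\<close>

locale null_array = lcsc_space E_type for E_type :: "'a::{t2_space, second_countable_topology} itself" +
  fixes PN :: "nat \<Rightarrow> 'a measure measure" and RR :: "nat \<Rightarrow> nat \<Rightarrow> 'a measure measure" and k :: "nat \<Rightarrow> nat"
  assumes PN: "\<And>n. prob_space (PN n)" "\<And>n. sets (PN n) = sets Mp_borel"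
    and RR: "\<And>i n. prob_space (RR i n)" "\<And>i n. sets (RR i n) = sets Mp_borel"
    and negligible: "\<And>f \<epsilon>. f \<in> CK_plus \<Longrightarrow> 0 < \<epsilon> \<Longrightarrow>
      eventually (\<lambda>n. \<forall>i\<in>{1..k n}. 1 - (\<integral>\<mu>. lap f \<mu> \<partial>RR i n) \<le> \<epsilon>) sequentially"
    and approx: "\<And>f. f \<in> CK_plus \<Longrightarrow>
      (\<lambda>n. (\<integral>\<mu>. lap f \<mu> \<partial>PN n) - (\<Prod>i=1..k n. \<integral>\<mu>. lap f \<mu> \<partial>RR i n)) \<longlonglongrightarrow> 0"
begin

text \<open>The exponent of lambda_n as a real number; \<open>laplace_exponent_intensity\<close>
  makes the identification.\<close>

definition \<Psi> :: "nat \<Rightarrow> ('a \<Rightarrow> real) \<Rightarrow> real" where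
  "\<Psi> n f = (\<Sum>i=1..k n. 1 - (\<integral>\<mu>. lap f \<mu> \<partial>RR i n))"

lemma RR_finite: "finite_measure (RR i n)"
  using RR(1) by (rule prob_space.finite_measure)

lemma PN_finite: "finite_measure (PN n)"
  using PN(1) by (rule prob_space.finite_measure)

lemma lap_RR_bounds: "f \<in> CK_plus \<Longrightarrow> 0 \<le> (\<integral>\<mu>. lap f \<mu> \<partial>RR i n)" "f \<in> CK_plus \<Longrightarrow> (\<integral>\<mu>. lap f \<mu> \<partial>RR i n) \<le> 1"
proof -
  interpret prob_space "RR i n" by (rule RR)
  show "0 \<le> (\<integral>\<mu>. lap f \<mu> \<partial>RR i n)" by (intro integral_nonneg_AE) auto
  show "f \<in> CK_plus \<Longrightarrow> (\<integral>\<mu>. lap f \<mu> \<partial>RR i n) \<le> 1"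
    by (intro integral_le_const integrable_lap RR_finite RR AE_I2) auto
qed

lemma \<Psi>_nonneg: "f \<in> CK_plus \<Longrightarrow> 0 \<le> \<Psi> n f"
  unfolding \<Psi>_def using lap_RR_bounds by (intro sum_nonneg) auto

lemma \<Psi>_zero: "\<Psi> n (\<lambda>_. 0) = 0"
  unfolding \<Psi>_def using prob_space.prob_space[OF RR(1)] by simp

lemma laplace_tendsto_exp:
  assumes f: "f \<in> CK_plus" and lim: "(\<lambda>n. \<Psi> n f) \<longlonglongrightarrow> s"
  shows "(\<lambda>n. \<integral>\<mu>. lap f \<mu> \<partial>PN n) \<longlonglongrightarrow> exp (- s)"
proof -
  have "(\<lambda>n. \<Prod>i=1..k n. 1 - (1 - (\<integral>\<mu>. lap f \<mu> \<partial>RR i n))) \<longlonglongrightarrow> exp (- s)"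
    using lim lap_RR_bounds[OF f] negligible[OF f]
    by (intro array_prod_tendsto_exp) (auto simp: \<Psi>_def)
  from tendsto_add[OF approx[OF f] this] show ?thesis by simp
qed

lemma \<Psi>_tendsto_ln:
  assumes f: "f \<in> CK_plus" and lim: "(\<lambda>n. \<integral>\<mu>. lap f \<mu> \<partial>PN n) \<longlonglongrightarrow> l" and "0 < l"
  shows "(\<lambda>n. \<Psi> n f) \<longlonglongrightarrow> - ln l"
proof -
  from tendsto_diff[OF lim approx[OF f]]
  have "(\<lambda>n. \<Prod>i=1..k n. 1 - (1 - (\<integral>\<mu>. lap f \<mu> \<partial>RR i n))) \<longlonglongrightarrow> l" by simp
  then show ?thesis unfolding \<Psi>_def
    using lap_RR_bounds[OF f] negligible[OF f] \<open>0 < l\<close>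
    by (intro array_sum_tendsto_ln) auto
qed

lemma limit_law:
  assumes lim: "\<And>f. f \<in> CK_plus \<Longrightarrow> (\<lambda>n. \<Psi> n f) \<longlonglongrightarrow> \<psi> f"
    and cont: "\<And>f. f \<in> CK_plus \<Longrightarrow> (\<lambda>j. \<psi> (\<lambda>x. f x / real (Suc j))) \<longlonglongrightarrow> 0"
  obtains L where "prob_space L" "sets L = sets Mp_borel"
    "\<And>f. f \<in> CK_plus \<Longrightarrow> (\<integral>\<mu>. lap f \<mu> \<partial>L) = exp (- \<psi> f)"
proof -
  have \<psi>0: "\<psi> (\<lambda>_. 0) = 0" using lim[OF CK_plus_zero] by (simp add: \<Psi>_zero LIMSEQ_const_iff)
  obtain L where L: "finite_measure L" "sets L = sets Mp_borel"
    "\<And>f. f \<in> CK_plus \<Longrightarrow> (\<integral>\<mu>. lap f \<mu> \<partial>L) = exp (- \<psi> f)"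
  proof (rule laplace_limit[OF sequentially_bot PN_finite PN(2), where \<Theta> = "\<lambda>f. exp (- \<psi> f)"])
    show "(\<lambda>n. \<integral>\<mu>. lap f \<mu> \<partial>PN n) \<longlonglongrightarrow> exp (- \<psi> f)" if "f \<in> CK_plus" for f
      using that lim[OF that] by (rule laplace_tendsto_exp)
    show "(\<lambda>j. exp (- \<psi> (\<lambda>x. f x / real (Suc j)))) \<longlonglongrightarrow> exp (- \<psi> (\<lambda>_. 0))" if "f \<in> CK_plus" for f
      unfolding \<psi>0 by (intro tendsto_exp tendsto_minus cont that)
  qed (rule that)
  moreover have "prob_space L" using L(3)[OF CK_plus_zero] \<psi>0 by (intro prob_spaceI_laplace L(1)) simp
  ultimately show thesis using that by blast
qed

text \<open>\<psi> / m is the limit exponent of another null array, whose row sums are realised by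
  truly independent entries. The root thus comes from the existence result for limit laws, applied
  to that array.\<close>

lemma root_law:
  assumes lim: "\<And>f. f \<in> CK_plus \<Longrightarrow> (\<lambda>n. \<Psi> n f) \<longlonglongrightarrow> \<psi> f"
    and cont: "\<And>f. f \<in> CK_plus \<Longrightarrow> (\<lambda>j. \<psi> (\<lambda>x. f x / real (Suc j))) \<longlonglongrightarrow> 0"
    and m: "0 < (m::nat)"
  obtains L where "prob_space L" "sets L = sets Mp_borel"
    "\<And>f. f \<in> CK_plus \<Longrightarrow> (\<integral>\<mu>. lap f \<mu> \<partial>L) = exp (- (\<psi> f / real m))"
proof -
  define p where "p = 1 / real m"
  have p: "0 \<le> p" "p \<le> 1" using m by (auto simp: p_def)
  have "\<exists>L. prob_space L \<and> sets L = sets Mp_borel \<and>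
    (\<forall>f\<in>CK_plus. (\<integral>\<mu>. lap f \<mu> \<partial>L) = 1 - p * (1 - (\<integral>\<mu>. lap f \<mu> \<partial>RR i n)))" for i n
    by (rule thinned_law[OF RR p]) blast
  then obtain T where T: "\<And>i n. prob_space (T i n)" "\<And>i n. sets (T i n) = sets Mp_borel"
    "\<And>i n f. f \<in> CK_plus \<Longrightarrow> (\<integral>\<mu>. lap f \<mu> \<partial>T i n) = 1 - p * (1 - (\<integral>\<mu>. lap f \<mu> \<partial>RR i n))"
    by metis
  have "\<exists>L. prob_space L \<and> sets L = sets Mp_borel \<and>
    (\<forall>f\<in>CK_plus. (\<integral>\<mu>. lap f \<mu> \<partial>L) = (\<Prod>i=1..k n. \<integral>\<mu>. lap f \<mu> \<partial>T i n))" for n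
    by (rule independent_sum_law[of "{1..k n}" "\<lambda>i. T i n"]) (use T in blast)+
  then obtain S where S: "\<And>n. prob_space (S n)" "\<And>n. sets (S n) = sets Mp_borel"
    "\<And>n f. f \<in> CK_plus \<Longrightarrow> (\<integral>\<mu>. lap f \<mu> \<partial>S n) = (\<Prod>i=1..k n. \<integral>\<mu>. lap f \<mu> \<partial>T i n)"
    by metis
  have arr: "null_array S T k"
  proof (intro null_array.intro null_array_axioms.intro lcsc_space_axioms)
    fix f :: "'a \<Rightarrow> real" and \<epsilon> :: real assume f: "f \<in> CK_plus"
    show "(\<lambda>n. (\<integral>\<mu>. lap f \<mu> \<partial>S n) - (\<Prod>i=1..k n. \<integral>\<mu>. lap f \<mu> \<partial>T i n)) \<longlonglongrightarrow> 0"
      using S(3)[OF f] by simp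
    assume \<epsilon>: "0 < \<epsilon>"
    show "eventually (\<lambda>n. \<forall>i\<in>{1..k n}. 1 - (\<integral>\<mu>. lap f \<mu> \<partial>T i n) \<le> \<epsilon>) sequentially"
      using negligible[OF f \<epsilon>]
    proof eventually_elim
      case (elim n)
      have "p * (1 - (\<integral>\<mu>. lap f \<mu> \<partial>RR i n)) \<le> 1 * (1 - (\<integral>\<mu>. lap f \<mu> \<partial>RR i n))" for i
        using p lap_RR_bounds[OF f] by (intro mult_right_mono) auto
      then show ?case using elim T(3)[OF f] by (auto intro: order_trans)
    qed
  qed (rule S T)+
  interpret T: null_array "TYPE('a)" S T k by (rule arr)
  have \<Psi>T: "T.\<Psi> n f = \<Psi> n f / real m" if "f \<in> CK_plus" for n f
    by (simp add: T.\<Psi>_def \<Psi>_def T(3)[OF that] p_def sum_divide_distrib)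
  show thesis
  proof (rule T.limit_law[of "\<lambda>f. \<psi> f / real m"])
    show "(\<lambda>n. T.\<Psi> n f) \<longlonglongrightarrow> \<psi> f / real m" if "f \<in> CK_plus" for f
      unfolding \<Psi>T[OF that] using m by (intro tendsto_divide lim[OF that] tendsto_const) simp
    show "(\<lambda>j. \<psi> (\<lambda>x. f x / real (Suc j)) / real m) \<longlonglongrightarrow> 0" if "f \<in> CK_plus" for f
      using tendsto_divide[OF cont[OF that] tendsto_const[of "real m"]] m by simp
  qed (rule that)
qed

definition intensity :: "nat \<Rightarrow> 'a measure measure" where
  "intensity n = sum_measure Mp_borel (\<lambda>i. RR i n) {1..k n}"

lemma sets_intensity [simp]: "sets (intensity n) = sets Mp_borel"
  by (simp add: intensity_def)

lemma nn_integral_intensity: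
  "f \<in> borel_measurable Mp_borel \<Longrightarrow> (\<integral>\<^sup>+\<mu>. f \<mu> \<partial>intensity n) = (\<Sum>i=1..k n. \<integral>\<^sup>+\<mu>. f \<mu> \<partial>RR i n)"
  unfolding intensity_def by (rule nn_integral_sum_measure) (use RR in auto)

lemma finite_intensity: "finite_measure (intensity n)"
proof (rule finite_measureI)
  have "emeasure (intensity n) (space (intensity n)) = (\<integral>\<^sup>+\<mu>. 1 \<partial>intensity n)" by simp
  also have "\<dots> = (\<Sum>i=1..k n. \<integral>\<^sup>+\<mu>. 1 \<partial>RR i n)" by (rule nn_integral_intensity) simp
  also have "\<dots> = of_nat (k n)" using prob_space.emeasure_space_1[OF RR(1)] by simp
  finally show "emeasure (intensity n) (space (intensity n)) \<noteq> \<infinity>" by simp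
qed

lemma integral_lap_intensity:
  assumes f: "f \<in> CK_plus"
  shows "(\<integral>\<mu>. lap f \<mu> \<partial>intensity n) = real (k n) - \<Psi> n f"
proof -
  have "ennreal (\<integral>\<mu>. lap f \<mu> \<partial>intensity n) = (\<integral>\<^sup>+\<mu>. ennreal (lap f \<mu>) \<partial>intensity n)"
    using integrable_lap[OF finite_intensity sets_intensity f] by (simp add: nn_integral_eq_integral)
  also have "\<dots> = (\<Sum>i=1..k n. \<integral>\<^sup>+\<mu>. ennreal (lap f \<mu>) \<partial>RR i n)"
    using measurable_lap[OF f] by (intro nn_integral_intensity) measurable
  also have "\<dots> = (\<Sum>i=1..k n. ennreal (\<integral>\<mu>. lap f \<mu> \<partial>RR i n))"
    using integrable_lap[OF RR_finite RR(2) f] by (simp add: nn_integral_eq_integral)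
  also have "\<dots> = ennreal (\<Sum>i=1..k n. \<integral>\<mu>. lap f \<mu> \<partial>RR i n)"
    using lap_RR_bounds[OF f] by (intro sum_ennreal) auto
  finally have "(\<integral>\<mu>. lap f \<mu> \<partial>intensity n) = (\<Sum>i=1..k n. \<integral>\<mu>. lap f \<mu> \<partial>RR i n)"
    using lap_RR_bounds[OF f] by (subst (asm) ennreal_inj) (auto intro!: sum_nonneg integral_nonneg_AE)
  then show ?thesis by (simp add: \<Psi>_def sum_subtractf)
qed

lemma laplace_exponent_intensity:
  assumes f: "f \<in> CK_plus"
  shows "laplace_exponent (intensity n) f = ennreal (\<Psi> n f)"
proof -
  have "laplace_exponent (intensity n) f = (\<Sum>i=1..k n. \<integral>\<^sup>+\<mu>. ennreal (1 - lap f \<mu>) \<partial>RR i n)"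
    unfolding laplace_exponent_lap using measurable_lap[OF f] by (intro nn_integral_intensity) measurable
  also have "\<dots> = (\<Sum>i=1..k n. ennreal (1 - (\<integral>\<mu>. lap f \<mu> \<partial>RR i n)))"
  proof (intro sum.cong refl)
    fix i
    interpret prob_space "RR i n" by (rule RR)
    have int: "integrable (RR i n) (lap f)" by (rule integrable_lap[OF RR_finite RR(2) f])
    have "(\<integral>\<^sup>+\<mu>. ennreal (1 - lap f \<mu>) \<partial>RR i n) = ennreal (\<integral>\<mu>. 1 - lap f \<mu> \<partial>RR i n)"
      using int by (intro nn_integral_eq_integral) auto
    then show "(\<integral>\<^sup>+\<mu>. ennreal (1 - lap f \<mu>) \<partial>RR i n) = ennreal (1 - (\<integral>\<mu>. lap f \<mu> \<partial>RR i n))"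
      using int by (simp add: prob_space)
  qed
  also have "\<dots> = ennreal (\<Psi> n f)"
    unfolding \<Psi>_def using lap_RR_bounds[OF f] by (intro sum_ennreal) auto
  finally show ?thesis .
qed

lemma \<Psi>_mono:
  assumes "f \<in> CK_plus" "g \<in> CK_plus" "\<And>x. f x \<le> g x"
  shows "\<Psi> n f \<le> \<Psi> n g"
  unfolding \<Psi>_def
  by (intro sum_mono diff_left_mono integral_mono integrable_lap RR_finite RR assms lap_mono)

text \<open>The difference of transforms is the integral of
  \<open>lap H \<mu> * (1 - lap f \<mu>)\<close>. As H \<ge> c on the support of \<open>f\<close>,
  this is exponentially small in \<open>c\<close> relative to 1 - \<open>lap h\<close>. The bound
  controls what the telescoping sum of weights leaves over.\<close>

lemma \<Psi>_increment_bound: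
  assumes f: "f \<in> CK_plus" and h: "h \<in> CK_plus" "\<And>x. f x \<noteq> 0 \<Longrightarrow> 1 \<le> h x"
    and H: "H \<in> CK_plus" "\<And>x. f x \<noteq> 0 \<Longrightarrow> c \<le> H x" and "0 \<le> c"
  shows "\<Psi> n (\<lambda>x. f x + H x) - \<Psi> n H \<le> 2 * exp (- c) * \<Psi> n h"
proof -
  have "(\<integral>\<mu>. lap H \<mu> \<partial>RR i n) - (\<integral>\<mu>. lap (\<lambda>x. f x + H x) \<mu> \<partial>RR i n) \<le> 2 * exp (- c) * (1 - (\<integral>\<mu>. lap h \<mu> \<partial>RR i n))" for i
  proof -
    interpret prob_space "RR i n" by (rule RR)
    have int: "integrable (RR i n) (lap H)" "integrable (RR i n) (lap (\<lambda>x. f x + H x))" "integrable (RR i n) (lap h)"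
      by (intro integrable_lap RR_finite RR(2) CK_plus_add f h(1) H(1))+
    have "(\<integral>\<mu>. lap H \<mu> \<partial>RR i n) - (\<integral>\<mu>. lap (\<lambda>x. f x + H x) \<mu> \<partial>RR i n)
        = (\<integral>\<mu>. lap H \<mu> - lap (\<lambda>x. f x + H x) \<mu> \<partial>RR i n)"
      using int by simp
    also have "\<dots> \<le> (\<integral>\<mu>. 2 * exp (- c) * (1 - lap h \<mu>) \<partial>RR i n)"
    proof (rule integral_mono)
      fix \<mu> assume "\<mu> \<in> space (RR i n)"
      then have \<mu>: "\<mu> \<in> Mp" using space_law[OF RR(2)] by simp
      have "lap H \<mu> - lap (\<lambda>x. f x + H x) \<mu> = lap H \<mu> * (1 - lap f \<mu>)"
        by (simp add: lap_add[OF \<mu> f H(1)] right_diff_distrib mult.commute)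
      also have "\<dots> \<le> 2 * exp (- c) * (1 - lap h \<mu>)"
        by (rule lap_bound_on_support[OF \<mu> f h(2) H(2) \<open>0 \<le> c\<close>])
      finally show "lap H \<mu> - lap (\<lambda>x. f x + H x) \<mu> \<le> 2 * exp (- c) * (1 - lap h \<mu>)" .
    qed (use int in auto)
    also have "\<dots> = 2 * exp (- c) * (1 - (\<integral>\<mu>. lap h \<mu> \<partial>RR i n))" using int(3) by (simp add: prob_space)
    finally show ?thesis .
  qed
  then have "(\<Sum>i=1..k n. (\<integral>\<mu>. lap H \<mu> \<partial>RR i n) - (\<integral>\<mu>. lap (\<lambda>x. f x + H x) \<mu> \<partial>RR i n))
      \<le> (\<Sum>i=1..k n. 2 * exp (- c) * (1 - (\<integral>\<mu>. lap h \<mu> \<partial>RR i n)))"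
    by (rule sum_mono)
  moreover have "\<Psi> n (\<lambda>x. f x + H x) - \<Psi> n H
      = (\<Sum>i=1..k n. (\<integral>\<mu>. lap H \<mu> \<partial>RR i n) - (\<integral>\<mu>. lap (\<lambda>x. f x + H x) \<mu> \<partial>RR i n))"
    unfolding \<Psi>_def by (simp add: sum_subtractf)
  ultimately show ?thesis by (simp add: \<Psi>_def sum_distrib_left)
qed

section \<open>Construction of the canonical measure\<close>

lemma canonical_measure_exists:
  assumes Q: "prob_space Q" "sets Q = sets Mp_borel"
    and lim: "\<And>f. f \<in> CK_plus \<Longrightarrow> (\<lambda>n. \<integral>\<mu>. lap f \<mu> \<partial>PN n) \<longlonglongrightarrow> (\<integral>\<mu>. lap f \<mu> \<partial>Q)"
  obtains \<nu> where "admissible_measure \<nu>"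
    "\<And>f. f \<in> CK_plus \<Longrightarrow> (\<lambda>n. \<Psi> n f) \<longlonglongrightarrow> - ln (\<integral>\<mu>. lap f \<mu> \<partial>Q)"
    "\<And>f. f \<in> CK_plus \<Longrightarrow> laplace_exponent \<nu> f = ennreal (- ln (\<integral>\<mu>. lap f \<mu> \<partial>Q))"
proof -
  define \<psi> where "\<psi> f = - ln (\<integral>\<mu>. lap f \<mu> \<partial>Q)" for f
  note Qpos = laplace_pos[OF Q]
  note Qfin = prob_space.finite_measure[OF Q(1)]
  have \<psi>: "(\<lambda>n. \<Psi> n f) \<longlonglongrightarrow> \<psi> f" if "f \<in> CK_plus" for f
    unfolding \<psi>_def by (rule \<Psi>_tendsto_ln[OF that lim[OF that] Qpos[OF that]])
  have \<psi>_zero: "\<psi> (\<lambda>_. 0) = 0" using \<psi>[OF CK_plus_zero] by (simp add: \<Psi>_zero LIMSEQ_const_iff)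
  have \<psi>_mono: "\<psi> f \<le> \<psi> g" if "f \<in> CK_plus" "g \<in> CK_plus" "\<And>x. f x \<le> g x" for f g
    using \<psi>[OF that(1)] \<psi>[OF that(2)] \<Psi>_mono[OF that] by (intro LIMSEQ_le) auto
  obtain h :: "nat \<Rightarrow> 'a \<Rightarrow> real" where h: "\<And>m. h m \<in> CK_plus" "\<And>m x. h m x \<le> 1"
    "\<And>x. incseq (\<lambda>m. h m x)" "\<And>K. compact K \<Longrightarrow> \<exists>m0. \<forall>m\<ge>m0. \<forall>x\<in>K. h m x = 1"
    using exhaustion by metis
  \<comment> \<open>The factor \<open>m\<close> drives \<open>H m\<close> to infinity on compact
    sets while \<open>h m\<close> keeps it a test function. Since \<open>H 0\<close> vanishes, the
    weights \<open>w m\<close> telescope from 1.\<close>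
  define H where "H m x = real m * h m x" for m x
  have H: "H m \<in> CK_plus" for m unfolding H_def by (intro CK_plus_scale h) simp
  have H0: "H 0 = (\<lambda>_. 0)" by (simp add: H_def fun_eq_iff)
  have H_inc: "H m x \<le> H (Suc m) x" for m x
    unfolding H_def using incseq_SucD[OF h(3)] CK_plusD(2)[OF h(1)] by (intro mult_mono) auto
  have fH: "(\<lambda>x. f x + H m x) \<in> CK_plus" if "f \<in> CK_plus" for f m by (rule CK_plus_add[OF that H])
  define w where "w m \<mu> = lap (H m) \<mu> - lap (H (Suc m)) \<mu>" for m \<mu>
  have w: "0 \<le> w m \<mu>" for m \<mu> unfolding w_def using lap_mono[of "H m" "H (Suc m)" \<mu>] H_inc by simp
  have wm: "w m \<in> borel_measurable Mp_borel" for m unfolding w_def using measurable_lap[OF H] by measurable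
  define D where "D m n = density (intensity n) (\<lambda>\<mu>. ennreal (w m \<mu>))" for m n
  have sD: "sets (D m n) = sets Mp_borel" for m n by (simp add: D_def)
  have wm': "w m \<in> borel_measurable (intensity n)" for m n using wm by (metis measurable_cong_sets sets_intensity)
  \<comment> \<open>By \<open>lap_add\<close>, weight times \<open>lap f\<close> is a difference of
    two transforms; the total masses \<open>k n\<close> cancel and only values of \<Psi>
    remain.\<close>
  have D_lap: "(\<integral>\<mu>. lap f \<mu> \<partial>D m n) = \<Psi> n (\<lambda>x. f x + H (Suc m) x) - \<Psi> n (\<lambda>x. f x + H m x)"
    if f: "f \<in> CK_plus" for f m n
  proof -
    have "(\<integral>\<mu>. lap f \<mu> \<partial>D m n) = (\<integral>\<mu>. w m \<mu> * lap f \<mu> \<partial>intensity n)"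
      unfolding D_def using w wm' measurable_lap_law[OF sets_intensity f] by (subst integral_density) auto
    also have "\<dots> = (\<integral>\<mu>. lap (\<lambda>x. f x + H m x) \<mu> - lap (\<lambda>x. f x + H (Suc m) x) \<mu> \<partial>intensity n)"
      using space_law[OF sets_intensity] f H
      by (intro Bochner_Integration.integral_cong) (simp_all add: w_def lap_add algebra_simps)
    also have "\<dots> = \<Psi> n (\<lambda>x. f x + H (Suc m) x) - \<Psi> n (\<lambda>x. f x + H m x)"
      using integrable_lap[OF finite_intensity sets_intensity fH[OF f]] by (simp add: integral_lap_intensity fH[OF f])
    finally show ?thesis .
  qed
  have D_fin: "finite_measure (D m n)" for m n
  proof (rule finite_measureI)
    interpret finite_measure "intensity n" by (rule finite_intensity)
    have "emeasure (D m n) (space (D m n)) = (\<integral>\<^sup>+\<mu>. 1 \<partial>D m n)" by simp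
    also have "\<dots> = (\<integral>\<^sup>+\<mu>. ennreal (w m \<mu>) \<partial>intensity n)"
      unfolding D_def using wm'[of m n] by (subst nn_integral_density) auto
    also have "\<dots> \<le> (\<integral>\<^sup>+\<mu>. 1 \<partial>intensity n)"
    proof (intro nn_integral_mono)
      fix \<mu> have "w m \<mu> \<le> 1" unfolding w_def using lap_bounds(1)[of "H (Suc m)" \<mu>] lap_bounds(2)[of "H m" \<mu>] by linarith
      then show "ennreal (w m \<mu>) \<le> 1" by simp
    qed
    also have "\<dots> < \<infinity>" by (simp add: emeasure_eq_measure)
    finally show "emeasure (D m n) (space (D m n)) \<noteq> \<infinity>" by simp
  qed
  define \<Theta> where "\<Theta> m f = \<psi> (\<lambda>x. f x + H (Suc m) x) - \<psi> (\<lambda>x. f x + H m x)" for m f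
  have "\<exists>L. finite_measure L \<and> sets L = sets Mp_borel \<and> (\<forall>f\<in>CK_plus. (\<integral>\<mu>. lap f \<mu> \<partial>L) = \<Theta> m f)" for m
  proof (rule laplace_limit[OF sequentially_bot D_fin[of m] sD[of m], where \<Theta> = "\<Theta> m"])
    fix f :: "'a \<Rightarrow> real" assume f: "f \<in> CK_plus"
    show "(\<lambda>n. \<integral>\<mu>. lap f \<mu> \<partial>D m n) \<longlonglongrightarrow> \<Theta> m f"
      unfolding D_lap[OF f] \<Theta>_def by (intro tendsto_diff \<psi> fH f)
    \<comment> \<open>Continuity of \<open>\<Theta> m\<close> comes from dominated convergence under
      the limit law \<open>Q\<close>, passed through the logarithm by positivity of
      transforms.\<close>
    have "(\<lambda>j. \<psi> (\<lambda>x. f x / real (Suc j) + H m x)) \<longlonglongrightarrow> \<psi> (H m)" for m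
      unfolding \<psi>_def using Qpos[OF H, of m] by (intro tendsto_minus tendsto_ln laplace_scale_tendsto Qfin Q f H) simp
    from tendsto_diff[OF this[of "Suc m"] this[of m]]
    show "(\<lambda>j. \<Theta> m (\<lambda>x. f x / real (Suc j))) \<longlonglongrightarrow> \<Theta> m (\<lambda>_. 0)"
      by (simp add: \<Theta>_def)
  qed blast
  then obtain L where L: "\<And>m. finite_measure (L m)" "\<And>m. sets (L m) = sets Mp_borel"
    "\<And>m f. f \<in> CK_plus \<Longrightarrow> (\<integral>\<mu>. lap f \<mu> \<partial>L m) = \<Theta> m f" by metis
  obtain \<nu>0 where \<nu>0: "sets \<nu>0 = sets Mp_borel"
    "\<And>f. f \<in> borel_measurable Mp_borel \<Longrightarrow> (\<integral>\<^sup>+\<mu>. f \<mu> \<partial>\<nu>0) = (\<Sum>i. \<integral>\<^sup>+\<mu>. f \<mu> \<partial>L i)"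
    by (rule countable_measure_sum[of L Mp_borel]) (use L(2) in auto)
  let ?o = "null_measure borel :: 'a measure"
  \<comment> \<open>Removing o secures the second clause of admissibility and leaves every exponent
    unchanged, because 1 - \<open>lap f\<close> vanishes at o.\<close>
  define \<nu> where "\<nu> = density \<nu>0 (indicator (- {?o}))"
  have o_ind: "indicator (- {?o}) \<in> borel_measurable \<nu>0"
  proof -
    have "{\<mu> \<in> space \<nu>0. \<mu> \<in> - {?o}} = space \<nu>0 - {?o}" by auto
    also have "\<dots> \<in> sets \<nu>0" using null_singleton_sets \<nu>0(1) by auto
    finally show ?thesis by (intro borel_measurable_indicator') (simp add: Int_def)
  qed
  have s\<nu>: "sets \<nu> = sets Mp_borel" by (simp add: \<nu>_def \<nu>0(1))
  have \<nu>_exp: "laplace_exponent \<nu> f = ennreal (\<psi> f)" if f: "f \<in> CK_plus" for f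
  proof -
    have m1: "(\<lambda>\<mu>. ennreal (1 - lap f \<mu>)) \<in> borel_measurable Mp_borel"
      using measurable_lap[OF f] by measurable
    have m2: "(\<lambda>\<mu>. ennreal (1 - lap f \<mu>)) \<in> borel_measurable \<nu>0" using m1 \<nu>0(1) by (metis measurable_cong_sets)
    have lo: "lap f ?o = 1" by (simp add: lap_def mint_def)
    have "laplace_exponent \<nu> f = (\<integral>\<^sup>+\<mu>. indicator (- {?o}) \<mu> * ennreal (1 - lap f \<mu>) \<partial>\<nu>0)"
      unfolding laplace_exponent_lap \<nu>_def by (rule nn_integral_density[OF o_ind m2])
    also have "\<dots> = (\<integral>\<^sup>+\<mu>. ennreal (1 - lap f \<mu>) \<partial>\<nu>0)"
      using lo by (intro nn_integral_cong) (auto simp: indicator_def)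
    also have "\<dots> = (\<Sum>i. \<integral>\<^sup>+\<mu>. ennreal (1 - lap f \<mu>) \<partial>L i)" by (rule \<nu>0(2)[OF m1])
    also have "\<dots> = (\<Sum>i. ennreal (\<Theta> i (\<lambda>_. 0) - \<Theta> i f))"
    proof (rule suminf_cong)
      fix i
      interpret finite_measure "L i" by (rule L)
      have int: "integrable (L i) (lap f)" by (rule integrable_lap[OF L(1,2) f])
      have "(\<integral>\<^sup>+\<mu>. ennreal (1 - lap f \<mu>) \<partial>L i) = ennreal (\<integral>\<mu>. 1 - lap f \<mu> \<partial>L i)"
        using int by (intro nn_integral_eq_integral) auto
      also have "(\<integral>\<mu>. 1 - lap f \<mu> \<partial>L i) = (\<integral>\<mu>. 1 \<partial>L i) - (\<integral>\<mu>. lap f \<mu> \<partial>L i)"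
        using int by (intro Bochner_Integration.integral_diff) auto
      also have "\<dots> = \<Theta> i (\<lambda>_. 0) - \<Theta> i f" using L(3)[OF f, of i] L(3)[OF CK_plus_zero, of i] by simp
      finally show "(\<integral>\<^sup>+\<mu>. ennreal (1 - lap f \<mu>) \<partial>L i) = ennreal (\<Theta> i (\<lambda>_. 0) - \<Theta> i f)" .
    qed
    also have "\<dots> = ennreal (\<psi> f)"
    proof -
      have nn: "0 \<le> \<Theta> i (\<lambda>_. 0) - \<Theta> i f" for i
      proof -
        interpret finite_measure "L i" by (rule L)
        have "(\<integral>\<mu>. lap f \<mu> \<partial>L i) \<le> (\<integral>\<mu>. lap (\<lambda>_. 0) \<mu> \<partial>L i)"
          using integrable_lap[OF L(1,2) f] by (intro integral_mono) auto
        then show ?thesis using L(3)[OF f, of i] L(3)[OF CK_plus_zero, of i] by simp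
      qed
      \<comment> \<open>The sum telescopes from \<open>H 0\<close>, the zero function; what remains
        is the increment of \<psi> from \<open>H n\<close> to \<open>f + H n\<close>.\<close>
      have part: "(\<Sum>i<n. \<Theta> i (\<lambda>_. 0) - \<Theta> i f) = \<psi> f - (\<psi> (\<lambda>x. f x + H n x) - \<psi> (H n))" for n
        by (induction n) (auto simp: \<Theta>_def H0 \<psi>_zero)
      obtain b where b: "b \<in> CK_plus" "\<And>x. b x \<le> 1" "\<And>x. f x \<noteq> 0 \<Longrightarrow> 1 \<le> b x"
        using bump_on_support[OF f] by metis
      obtain m0 where m0: "\<And>m x. m \<ge> m0 \<Longrightarrow> x \<in> closure {x. f x \<noteq> 0} \<Longrightarrow> h m x = 1"
        using h(4)[OF CK_plusD(3)[OF f]] by metis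
      \<comment> \<open>For m \<ge> m0 the function \<open>H m\<close> equals m on the support of
        \<open>f\<close>, so the increment bound applies with c = m and passes to the limit in
        n.\<close>
      have tail: "\<psi> (\<lambda>x. f x + H m x) - \<psi> (H m) \<le> 2 * exp (- real m) * \<psi> b" if m: "m \<ge> m0" for m
      proof -
        have "real m \<le> H m x" if "f x \<noteq> 0" for x
          using m0[OF m, of x] that closure_subset[of "{x. f x \<noteq> 0}"] by (auto simp: H_def)
        from \<Psi>_increment_bound[OF f b(1,3) H this]
        have le: "\<Psi> n (\<lambda>x. f x + H m x) - \<Psi> n (H m) \<le> 2 * exp (- real m) * \<Psi> n b" for n by simp
        have "(\<lambda>n. \<Psi> n (\<lambda>x. f x + H m x) - \<Psi> n (H m)) \<longlonglongrightarrow> \<psi> (\<lambda>x. f x + H m x) - \<psi> (H m)"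
          by (intro tendsto_diff \<psi> fH f H)
        moreover have "(\<lambda>n. 2 * exp (- real m) * \<Psi> n b) \<longlonglongrightarrow> 2 * exp (- real m) * \<psi> b"
          by (intro tendsto_mult tendsto_const \<psi> b)
        ultimately show ?thesis by (rule LIMSEQ_le) (use le in blast)
      qed
      have tail0: "0 \<le> \<psi> (\<lambda>x. f x + H m x) - \<psi> (H m)" for m
        using \<psi>_mono[OF H fH[OF f], of m m] CK_plusD(2)[OF f] by simp
      have "(\<lambda>m. \<psi> (\<lambda>x. f x + H m x) - \<psi> (H m)) \<longlonglongrightarrow> 0"
      proof (rule real_tendsto_sandwich[OF _ _ tendsto_const])
        show "eventually (\<lambda>m. \<psi> (\<lambda>x. f x + H m x) - \<psi> (H m) \<le> 2 * exp (- real m) * \<psi> b) sequentially"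
          using tail by (rule eventually_sequentiallyI)
        have "(\<lambda>m. exp (- real m)) \<longlonglongrightarrow> 0"
          by (rule filterlim_compose[OF exp_at_bot]) (simp add: filterlim_uminus_at_bot_at_top filterlim_real_sequentially filterlim_uminus_at_bot)
        from tendsto_mult_right[OF tendsto_mult_left[OF this, of 2], of "\<psi> b"]
        show "(\<lambda>m. 2 * exp (- real m) * \<psi> b) \<longlonglongrightarrow> 0" by simp
      qed (use tail0 in auto)
      from tendsto_diff[OF tendsto_const this, of "\<psi> f"]
      have "(\<lambda>i. \<Theta> i (\<lambda>_. 0) - \<Theta> i f) sums \<psi> f" by (simp add: sums_def part)
      then show ?thesis using nn by (simp add: suminf_ennreal2 sums_iff)
    qed
    finally show ?thesis .
  qed
  have "admissible_measure \<nu>"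
    unfolding admissible_measure_def
  proof (intro conjI ballI)
    show "sets \<nu> = sets Mp_borel" by (rule s\<nu>)
    have "{?o} \<in> sets \<nu>0" using null_singleton_sets \<nu>0(1) by simp
    then have "emeasure \<nu> {?o} = (\<integral>\<^sup>+\<mu>. indicator (- {?o}) \<mu> * indicator {?o} \<mu> \<partial>\<nu>0)"
      unfolding \<nu>_def using o_ind by (simp add: emeasure_density)
    also have "\<dots> = (\<integral>\<^sup>+\<mu>. 0 \<partial>\<nu>0)" by (intro nn_integral_cong) (auto simp: indicator_def)
    finally show "emeasure \<nu> {?o} = 0" by simp
    fix B :: "'a set" assume B: "B \<in> bounded_borel"
    obtain b where b: "b \<in> CK_plus" "\<And>x. x \<in> closure B \<Longrightarrow> b x = (1::real)"
      using B by (rule_tac bump[OF _ open_UNIV, of "closure B"]) (auto simp: bounded_borel_def)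
    have "(\<integral>\<^sup>+\<mu>. ennreal (1 - exp_neg (emeasure \<mu> B)) \<partial>\<nu>) \<le> laplace_exponent \<nu> b"
      unfolding laplace_exponent_def
    proof (intro nn_integral_mono ennreal_leI diff_left_mono exp_neg_antimono)
      fix \<mu> assume "\<mu> \<in> space \<nu>"
      then have \<mu>: "\<mu> \<in> Mp" using space_law[OF s\<nu>] by simp
      have "emeasure \<mu> B = (\<integral>\<^sup>+x. indicator B x \<partial>\<mu>)" using B Mp_sets[OF \<mu>] by (simp add: bounded_borel_def)
      also have "\<dots> \<le> mint \<mu> b"
        unfolding mint_def using b(2) closure_subset[of B] by (intro nn_integral_mono) (auto simp: indicator_def)
      finally show "emeasure \<mu> B \<le> mint \<mu> b" .
    qed
    also have "\<dots> < \<infinity>" using \<nu>_exp[OF b(1)] by simp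
    finally show "(\<integral>\<^sup>+\<mu>. ennreal (1 - exp_neg (emeasure \<mu> B)) \<partial>\<nu>) < \<infinity>" .
  qed
  then show thesis
    using that[of \<nu>] \<psi> \<nu>_exp unfolding \<psi>_def by blast
qed

end

section \<open>Extension to Borel functions\<close>

text \<open>The Laplace identity is not linear in \<open>f\<close>, so a vector-space monotone class
  argument does not fit it, but under a common majorant it survives pointwise limits. Generating
  functions from continuous ones by such limits alone gives a suitable induction.\<close>

inductive_set baire :: "('x::topological_space \<Rightarrow> real) set" where
  continuous: "continuous_on UNIV f \<Longrightarrow> f \<in> baire"
| limit: "(\<And>j. u j \<in> baire) \<Longrightarrow> (\<And>x. (\<lambda>j::nat. u j x) \<longlonglongrightarrow> f x) \<Longrightarrow> f \<in> baire"

lemma baire_measurable: "f \<in> baire \<Longrightarrow> f \<in> borel_measurable borel"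
proof (induction rule: baire.induct)
  case (continuous f)
  then show ?case by (rule borel_measurable_continuous_onI)
next
  case (limit u f)
  show ?case by (rule borel_measurable_LIMSEQ_real[OF limit(2)]) (use limit in auto)
qed

text \<open>Two inductions: over \<open>f\<close> with \<open>g\<close> continuous, where the base
  case is composition, and then over \<open>g\<close> with \<open>f\<close> an arbitrary member of
  the class.\<close>

lemma baire_binary:
  fixes F :: "real \<Rightarrow> real \<Rightarrow> real"
  assumes F: "continuous_on UNIV (\<lambda>p. F (fst p) (snd p))" and "f \<in> baire" "g \<in> baire"
  shows "(\<lambda>x. F (f x) (g x)) \<in> baire"
proof -
  have lim: "(\<lambda>j. F (u j) (v j)) \<longlonglongrightarrow> F a b" if "u \<longlonglongrightarrow> a" "v \<longlonglongrightarrow> b" for u v :: "nat \<Rightarrow> real" and a b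
    using continuous_on_tendsto_compose[OF F tendsto_Pair[OF that]] by simp
  have cont: "(\<lambda>x. F (f x) (g x)) \<in> baire" if f: "f \<in> baire" and g: "continuous_on UNIV g" for f g :: "'a \<Rightarrow> real"
    using f
  proof induction
    case (continuous f)
    show ?case
      using continuous_on_compose2[OF F continuous_on_Pair[OF continuous g]] by (intro baire.continuous) simp
  next
    case (limit u f)
    show ?case
      by (rule baire.limit[of "\<lambda>j x. F (u j x) (g x)", OF limit(3)]) (intro lim limit(2) tendsto_const)
  qed
  from \<open>g \<in> baire\<close> show ?thesis
  proof induction
    case (continuous g)
    show ?case by (rule cont[OF \<open>f \<in> baire\<close> continuous])
  next
    case (limit u g)
    show ?case
      by (rule baire.limit[of "\<lambda>j x. F (f x) (u j x)", OF limit(3)]) (intro lim limit(2) tendsto_const)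
  qed
qed

lemma baire_add: "f \<in> baire \<Longrightarrow> g \<in> baire \<Longrightarrow> (\<lambda>x. f x + g x) \<in> baire"
  by (rule baire_binary) (intro continuous_intros)

lemma baire_mult: "f \<in> baire \<Longrightarrow> g \<in> baire \<Longrightarrow> (\<lambda>x. f x * g x) \<in> baire"
  by (rule baire_binary) (intro continuous_intros)

lemma baire_max: "f \<in> baire \<Longrightarrow> g \<in> baire \<Longrightarrow> (\<lambda>x. max (f x) (g x)) \<in> baire"
  by (rule baire_binary) (intro continuous_intros)

lemma baire_const: "(\<lambda>_. c) \<in> baire"
  by (intro baire.continuous continuous_on_const)

context lcsc_space
begin

text \<open>Induction over the \<sigma>-field generated by positivity sets; ramps handle the
  generators, and countable unions are limits of finite ones, formed by maxima.\<close>

lemma baire_indicator: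
  assumes "A \<in> sets (borel :: 'a measure)"
  shows "indicat_real A \<in> baire"
proof -
  have "A \<in> sigma_sets UNIV {{x \<in> UNIV. 0 < \<phi> x} | \<phi> :: 'a \<Rightarrow> real. \<phi> \<in> {\<phi>. continuous_on UNIV \<phi> \<and> bounded (range \<phi>)}}"
    using assms borel_eq_continuous_positive by simp
  then show ?thesis
  proof induction
    case (Basic A)
    then obtain \<phi> :: "'a \<Rightarrow> real" where \<phi>: "A = {x. 0 < \<phi> x}" "continuous_on UNIV \<phi>" by auto
    show ?case
    proof (rule baire.limit)
      show "(\<lambda>x. min 1 (real j * max 0 (\<phi> x))) \<in> baire" for j
        using \<phi>(2) by (intro baire.continuous continuous_intros)
      fix x
      show "(\<lambda>j. min 1 (real j * max 0 (\<phi> x))) \<longlonglongrightarrow> indicat_real A x"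
        using ramp_tendsto_indicator[of "\<phi> x" 0] by (simp add: \<phi>(1) indicator_def)
    qed
  next
    case Empty
    show ?case using baire_const[of 0] by (simp add: indicator_def)
  next
    case (Compl A)
    have "(\<lambda>x. 1 + (-1) * indicat_real A x) = indicat_real (UNIV - A)" by (auto simp: indicator_def)
    then show ?case using baire_add[OF baire_const[of 1] baire_mult[OF baire_const[of "-1"] Compl.IH]] by simp
  next
    case (Union A)
    have fin: "indicat_real (\<Union>i<n. A i) \<in> baire" for n
    proof (induction n)
      case 0
      show ?case using baire_const[of 0] by (simp add: indicator_def)
    next
      case (Suc n)
      have "(\<lambda>x. max (indicat_real (\<Union>i<n. A i) x) (indicat_real (A n) x)) = indicat_real (\<Union>i<Suc n. A i)"
        by (auto simp: indicator_def less_Suc_eq fun_eq_iff)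
      then show ?case using baire_max[OF Suc Union.IH[of n]] by simp
    qed
    show ?case
    proof (rule baire.limit[OF fin])
      show "(\<lambda>n. indicat_real (\<Union>i<n. A i) x) \<longlonglongrightarrow> indicat_real (\<Union>i. A i) x" for x
        by (rule LIMSEQ_indicator_UN)
    qed
  qed
qed

lemma borel_nonneg_baire:
  fixes f :: "'a \<Rightarrow> real"
  assumes "f \<in> borel_measurable borel" "\<And>x. 0 \<le> f x"
  shows "f \<in> baire"
  using assms
proof (induction rule: borel_measurable_induct_real)
  case (set A)
  then show ?case by (rule baire_indicator)
next
  case (mult u c)
  then show ?case by (intro baire_mult baire_const)
next
  case (add u v)
  then show ?case by (intro baire_add)
next
  case (seq U)
  then show ?case by (rule_tac baire.limit[of U]) auto
qed

text \<open>The majorant \<open>b\<close> acts on two levels: it dominates the integrals under each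
  \<mu>, and then 1 - \<open>lap b\<close> dominates the exponents under \<nu>.\<close>

lemma laplace_identity_limit:
  fixes u :: "nat \<Rightarrow> 'a \<Rightarrow> real"
  assumes Q: "prob_space Q" "sets Q = sets Mp_borel" and \<nu>: "admissible_measure \<nu>"
    and b: "b \<in> CK_plus" and u: "\<And>j. u j \<in> borel_measurable borel" "\<And>j x. 0 \<le> u j x" "\<And>j x. u j x \<le> b x"
    and lim: "\<And>x. (\<lambda>j. u j x) \<longlonglongrightarrow> f x"
    and meas: "\<And>j. lap (u j) \<in> borel_measurable Mp_borel"
    and id: "\<And>j. (\<integral>\<mu>. lap (u j) \<mu> \<partial>Q) = exp_neg (laplace_exponent \<nu> (u j))"
  shows "lap f \<in> borel_measurable Mp_borel" "(\<integral>\<mu>. lap f \<mu> \<partial>Q) = exp_neg (laplace_exponent \<nu> f)"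
proof -
  interpret Q: prob_space Q by fact
  have s\<nu>: "sets \<nu> = sets Mp_borel" using \<nu> by (simp add: admissible_measure_def)
  have fm: "f \<in> borel_measurable borel" by (rule borel_measurable_LIMSEQ_real[OF lim u(1)])
  have lapl: "(\<lambda>j. lap (u j) \<mu>) \<longlonglongrightarrow> lap f \<mu>" if \<mu>: "\<mu> \<in> Mp" for \<mu>
    unfolding lap_def mint_def
  proof (intro tendsto_exp_neg nn_integral_dominated_convergence)
    have m: "g \<in> borel_measurable \<mu>" if "g \<in> borel_measurable borel" for g :: "'a \<Rightarrow> real"
      using that Mp_sets[OF \<mu>] by (metis measurable_cong_sets)
    show "(\<lambda>x. ennreal (u j x)) \<in> borel_measurable \<mu>" for j using m[OF u(1)] by measurable
    show "(\<lambda>x. ennreal (f x)) \<in> borel_measurable \<mu>" using m[OF fm] by measurable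
    show "(\<lambda>x. ennreal (b x)) \<in> borel_measurable \<mu>" using m[OF CK_plus_measurable[OF b]] by measurable
    show "(\<integral>\<^sup>+x. ennreal (b x) \<partial>\<mu>) < \<infinity>" using mint_CK_finite[OF \<mu> b] by (simp add: mint_def)
  qed (use u lim in \<open>auto intro!: AE_I2 ennreal_leI tendsto_ennrealI\<close>)
  show m: "lap f \<in> borel_measurable Mp_borel"
    by (rule borel_measurable_LIMSEQ_real[of _ "\<lambda>j. lap (u j)"]) (use lapl meas in auto)
  have mQ: "g \<in> borel_measurable Q" "g \<in> borel_measurable \<nu>" if "g \<in> borel_measurable Mp_borel" for g :: "'a measure \<Rightarrow> real"
    using that Q(2) s\<nu> by (metis measurable_cong_sets)+
  have "(\<lambda>j. \<integral>\<mu>. lap (u j) \<mu> \<partial>Q) \<longlonglongrightarrow> (\<integral>\<mu>. lap f \<mu> \<partial>Q)"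
  proof (rule integral_dominated_convergence)
    show "lap f \<in> borel_measurable Q" "lap (u j) \<in> borel_measurable Q" for j by (rule mQ(1)[OF m], rule mQ(1)[OF meas])
    show "integrable Q (\<lambda>_. 1)" by simp
    show "AE \<mu> in Q. (\<lambda>j. lap (u j) \<mu>) \<longlonglongrightarrow> lap f \<mu>"
      using lapl space_law[OF Q(2)] by (intro AE_I2) auto
  qed auto
  moreover have "(\<lambda>j. exp_neg (laplace_exponent \<nu> (u j))) \<longlonglongrightarrow> exp_neg (laplace_exponent \<nu> f)"
    unfolding laplace_exponent_lap
  proof (intro tendsto_exp_neg nn_integral_dominated_convergence)
    show "(\<lambda>\<mu>. ennreal (1 - lap (u j) \<mu>)) \<in> borel_measurable \<nu>" for j using mQ(2)[OF meas] by measurable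
    show "(\<lambda>\<mu>. ennreal (1 - lap f \<mu>)) \<in> borel_measurable \<nu>" using mQ(2)[OF m] by measurable
    show "(\<lambda>\<mu>. ennreal (1 - lap b \<mu>)) \<in> borel_measurable \<nu>" using mQ(2)[OF measurable_lap[OF b]] by measurable
    show "(\<integral>\<^sup>+\<mu>. ennreal (1 - lap b \<mu>) \<partial>\<nu>) < \<infinity>"
      using laplace_exponent_finite[OF \<nu> b] by (simp add: laplace_exponent_lap)
    show "AE \<mu> in \<nu>. ennreal (1 - lap (u j) \<mu>) \<le> ennreal (1 - lap b \<mu>)" for j
      using u(3) by (intro AE_I2 ennreal_leI diff_left_mono lap_mono)
    show "AE \<mu> in \<nu>. (\<lambda>j. ennreal (1 - lap (u j) \<mu>)) \<longlonglongrightarrow> ennreal (1 - lap f \<mu>)"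
      using lapl space_law[OF s\<nu>] by (intro AE_I2 tendsto_ennrealI tendsto_diff tendsto_const) auto
  qed
  ultimately show "(\<integral>\<mu>. lap f \<mu> \<partial>Q) = exp_neg (laplace_exponent \<nu> f)"
    unfolding id by (rule LIMSEQ_unique)
qed

theorem laplace_identity_extends:
  fixes f :: "'a \<Rightarrow> real"
  assumes Q: "prob_space Q" "sets Q = sets Mp_borel" and \<nu>: "admissible_measure \<nu>"
    and id: "\<And>f. f \<in> CK_plus \<Longrightarrow> (\<integral>\<mu>. lap f \<mu> \<partial>Q) = exp_neg (laplace_exponent \<nu> f)"
    and f: "f \<in> borel_measurable borel" "\<And>x. 0 \<le> f x"
  shows "lap f \<in> borel_measurable Mp_borel" "(\<integral>\<mu>. lap f \<mu> \<partial>Q) = exp_neg (laplace_exponent \<nu> f)"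
proof -
  interpret Q: prob_space Q by fact
  have s\<nu>: "sets \<nu> = sets Mp_borel" using \<nu> by (simp add: admissible_measure_def)
  \<comment> \<open>Members of the class may be signed and unbounded. Truncation and the factor
    \<open>b\<close> keep the inserted functions nonnegative and below \<open>C * b\<close>, so the
    induction can run over the whole class; measurability of \<open>lap\<close> is carried
    along.\<close>
  have trunc: "lap (\<lambda>x. min C (max 0 (g x)) * b x) \<in> borel_measurable Mp_borel \<and>
      (\<integral>\<mu>. lap (\<lambda>x. min C (max 0 (g x)) * b x) \<mu> \<partial>Q) = exp_neg (laplace_exponent \<nu> (\<lambda>x. min C (max 0 (g x)) * b x))"
    if "g \<in> baire" and C: "0 \<le> C" and b: "b \<in> CK_plus" for g :: "'a \<Rightarrow> real" and b C
    using \<open>g \<in> baire\<close>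
  proof induction
    case (continuous g)
    have "(\<lambda>x. min C (max 0 (g x)) * b x) \<in> CK_plus"
    proof (rule CK_plus_dominated[OF b])
      show "continuous_on UNIV (\<lambda>x. min C (max 0 (g x)) * b x)"
        by (intro continuous_intros continuous CK_plusD(1)[OF b])
    qed (use C CK_plusD(2)[OF b] in auto)
    then show ?case using id measurable_lap by blast
  next
    case (limit u g)
    have Cb: "(\<lambda>x. C * b x) \<in> CK_plus" by (rule CK_plus_scale[OF C b])
    have bound: "0 \<le> min C (max 0 (u j x)) * b x" "min C (max 0 (u j x)) * b x \<le> C * b x" for j x
      using C CK_plusD(2)[OF b] by (auto intro!: mult_right_mono)
    have meas: "(\<lambda>x. min C (max 0 (u j x)) * b x) \<in> borel_measurable borel" for j
      using baire_measurable[OF limit(1)] CK_plus_measurable[OF b] by measurable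
    have lim: "(\<lambda>j. min C (max 0 (u j x)) * b x) \<longlonglongrightarrow> min C (max 0 (g x)) * b x" for x
      by (intro tendsto_intros limit(2))
    show ?case
      using laplace_identity_limit[OF Q \<nu> Cb meas bound lim] limit(3) by blast
  qed
  obtain h :: "nat \<Rightarrow> 'a \<Rightarrow> real" where h: "\<And>m. h m \<in> CK_plus" "\<And>m x. h m x \<le> 1"
    "\<And>x. incseq (\<lambda>m. h m x)" "\<And>K. compact K \<Longrightarrow> \<exists>m0. \<forall>m\<ge>m0. \<forall>x\<in>K. h m x = 1"
    using exhaustion by metis
  define v where "v m x = min (real m) (max 0 (f x)) * h m x" for m x
  have v: "lap (v m) \<in> borel_measurable Mp_borel" "(\<integral>\<mu>. lap (v m) \<mu> \<partial>Q) = exp_neg (laplace_exponent \<nu> (v m))" for m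
    using trunc[OF borel_nonneg_baire[OF f] _ h(1), of "real m" m] unfolding v_def by auto
  have vmeas: "v m \<in> borel_measurable borel" for m
    unfolding v_def using f(1) CK_plus_measurable[OF h(1)] by measurable
  have vinc: "v m x \<le> v (Suc m) x" for m x
    unfolding v_def using incseq_SucD[OF h(3)] CK_plusD(2)[OF h(1)] f(2) by (intro mult_mono) auto
  have vlim: "(\<lambda>m. v m x) \<longlonglongrightarrow> f x" for x
  proof (rule tendsto_eventually)
    obtain m0 where m0: "\<And>m. m \<ge> m0 \<Longrightarrow> h m x = 1" using h(4)[of "{x}"] by auto
    obtain m1 where m1: "f x \<le> real m1" using real_arch_simple by auto
    show "eventually (\<lambda>m. v m x = f x) sequentially"
      using m0 m1 f(2)[of x] by (intro eventually_sequentiallyI[of "max m0 m1"]) (auto simp: v_def)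
  qed
  have mint_lim: "(\<lambda>m. mint \<mu> (v m)) \<longlonglongrightarrow> mint \<mu> f" if \<mu>: "\<mu> \<in> Mp" for \<mu>
    unfolding mint_def
  proof (rule nn_integral_LIMSEQ)
    show "incseq (\<lambda>m x. ennreal (v m x))" using vinc by (intro incseq_SucI le_funI ennreal_leI)
    have "v m \<in> borel_measurable \<mu>" for m using vmeas Mp_sets[OF \<mu>] by (metis measurable_cong_sets)
    then show "(\<lambda>x. ennreal (v m x)) \<in> borel_measurable \<mu>" for m by measurable
    show "(\<lambda>m. ennreal (v m x)) \<longlonglongrightarrow> ennreal (f x)" for x by (intro tendsto_ennrealI vlim)
  qed
  have lapl: "(\<lambda>m. lap (v m) \<mu>) \<longlonglongrightarrow> lap f \<mu>" if "\<mu> \<in> Mp" for \<mu>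
    unfolding lap_def by (intro tendsto_exp_neg mint_lim that)
  show m: "lap f \<in> borel_measurable Mp_borel"
    by (rule borel_measurable_LIMSEQ_real[of _ "\<lambda>j. lap (v j)"]) (use lapl v in auto)
  have mQ: "g \<in> borel_measurable Q" "g \<in> borel_measurable \<nu>" if "g \<in> borel_measurable Mp_borel" for g :: "'a measure \<Rightarrow> real"
    using that Q(2) s\<nu> by (metis measurable_cong_sets)+
  have "(\<lambda>j. \<integral>\<mu>. lap (v j) \<mu> \<partial>Q) \<longlonglongrightarrow> (\<integral>\<mu>. lap f \<mu> \<partial>Q)"
  proof (rule integral_dominated_convergence)
    show "lap f \<in> borel_measurable Q" "lap (v j) \<in> borel_measurable Q" for j by (rule mQ(1)[OF m], rule mQ(1)[OF v(1)])
    show "integrable Q (\<lambda>_. 1)" by simp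
    show "AE \<mu> in Q. (\<lambda>j. lap (v j) \<mu>) \<longlonglongrightarrow> lap f \<mu>"
      using lapl space_law[OF Q(2)] by (intro AE_I2) auto
  qed auto
  moreover have "(\<lambda>j. exp_neg (laplace_exponent \<nu> (v j))) \<longlonglongrightarrow> exp_neg (laplace_exponent \<nu> f)"
  proof (rule tendsto_exp_neg)
    \<comment> \<open>The exponent of \<open>f\<close> may be infinite, so domination gives way to
      monotone convergence, and continuity of \<open>exp_neg\<close> at infinity covers that
      case.\<close>
    have inc: "ennreal (1 - lap (v j) \<mu>) \<le> ennreal (1 - lap (v (Suc j)) \<mu>)" for j \<mu>
      using vinc by (intro ennreal_leI diff_left_mono lap_mono)
    have "(\<integral>\<^sup>+\<mu>. (SUP j. ennreal (1 - lap (v j) \<mu>)) \<partial>\<nu>) = (SUP j. \<integral>\<^sup>+\<mu>. ennreal (1 - lap (v j) \<mu>) \<partial>\<nu>)"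
    proof (rule nn_integral_monotone_convergence_SUP)
      show "incseq (\<lambda>j \<mu>. ennreal (1 - lap (v j) \<mu>))" using inc by (intro incseq_SucI le_funI)
      show "(\<lambda>\<mu>. ennreal (1 - lap (v j) \<mu>)) \<in> borel_measurable \<nu>" for j using mQ(2)[OF v(1)] by measurable
    qed
    moreover have "(\<integral>\<^sup>+\<mu>. (SUP j. ennreal (1 - lap (v j) \<mu>)) \<partial>\<nu>) = laplace_exponent \<nu> f"
      unfolding laplace_exponent_lap
    proof (rule nn_integral_cong)
      fix \<mu> assume "\<mu> \<in> space \<nu>"
      then have "(\<lambda>j. ennreal (1 - lap (v j) \<mu>)) \<longlonglongrightarrow> ennreal (1 - lap f \<mu>)"
        using lapl space_law[OF s\<nu>] by (intro tendsto_ennrealI tendsto_diff tendsto_const) auto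
      moreover have "(\<lambda>j. ennreal (1 - lap (v j) \<mu>)) \<longlonglongrightarrow> (SUP j. ennreal (1 - lap (v j) \<mu>))"
        using inc by (intro LIMSEQ_SUP incseq_SucI)
      ultimately show "(SUP j. ennreal (1 - lap (v j) \<mu>)) = ennreal (1 - lap f \<mu>)"
        by (rule LIMSEQ_unique[rotated])
    qed
    moreover have "(\<lambda>j. laplace_exponent \<nu> (v j)) \<longlonglongrightarrow> (SUP j. laplace_exponent \<nu> (v j))"
      unfolding laplace_exponent_lap using inc by (intro LIMSEQ_SUP incseq_SucI nn_integral_mono)
    ultimately show "(\<lambda>j. laplace_exponent \<nu> (v j)) \<longlonglongrightarrow> laplace_exponent \<nu> f"
      by (simp add: laplace_exponent_lap)
  qed
  ultimately show "(\<integral>\<mu>. lap f \<mu> \<partial>Q) = exp_neg (laplace_exponent \<nu> f)"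
    unfolding v(2) by (rule LIMSEQ_unique)
qed

end

section \<open>The limit theorem\<close>

lemma law_properties:
  assumes "point_process P N"
  shows "prob_space (law P N)" "sets (law P N) = sets Mp_borel"
  using assms by (auto simp: point_process_def law_def intro: prob_space.prob_space_distr)

context lcsc_space
begin

lemma laplace_eq_law:
  fixes N :: "'b \<Rightarrow> 'a measure"
  assumes "point_process P N" "lap f \<in> borel_measurable Mp_borel"
  shows "(\<integral>\<mu>. lap f \<mu> \<partial>law P N) = laplace P N f"
  using assms unfolding law_def laplace_eq_lap
  by (intro integral_distr) (auto simp: point_process_def)

lemma point_process_identity:
  fixes L :: "'a measure measure"
  assumes "prob_space L" "sets L = sets Mp_borel"
  shows "point_process L (\<lambda>\<mu>. \<mu>)" "law L (\<lambda>\<mu>. \<mu>) = L"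
proof -
  have "(\<lambda>\<mu>. \<mu>) \<in> measurable L Mp_borel" using assms(2) by (intro measurable_ident_sets)
  then show "point_process L (\<lambda>\<mu>. \<mu>)" using assms(1) by (simp add: point_process_def)
  show "law L (\<lambda>\<mu>. \<mu>) = L" unfolding law_def using assms(2) by (intro distr_id2) simp
qed

lemma conv_in_dist_iff_Cb:
  fixes N :: "nat \<Rightarrow> 'b \<Rightarrow> 'a measure" and N' :: "'c \<Rightarrow> 'a measure"
  shows "conv_in_dist P N Q N' \<longleftrightarrow>
    (\<forall>g\<in>Cb. (\<lambda>n. \<integral>\<mu>. g \<mu> \<partial>law (P (Suc n)) (N (Suc n))) \<longlonglongrightarrow> (\<integral>\<mu>. g \<mu> \<partial>law Q N'))"
proof -
  have "continuous_map vague_topology euclideanreal g \<and> bounded (g ` Mp) \<longleftrightarrow> g \<in> Cb" for g :: "'a measure \<Rightarrow> real"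
    by (auto simp: Cb_def bounded_iff)
  moreover have "(\<lambda>n. \<integral>\<mu>. g \<mu> \<partial>law (P (Suc n)) (N (Suc n))) \<longlonglongrightarrow> l \<longleftrightarrow>
      (\<lambda>n. \<integral>\<mu>. g \<mu> \<partial>law (P n) (N n)) \<longlonglongrightarrow> l" for g :: "'a measure \<Rightarrow> real" and l
    by (rule filterlim_sequentially_Suc)
  ultimately show ?thesis
    unfolding conv_in_dist_def vague_weak_conv_def by (simp add: Ball_def)
qed

text \<open>A configuration that does not charge the support of \<open>f\<close> has
  \<open>lap f\<close> equal to 1. This converts smallness of charging probabilities into the
  transform form used by \<open>null_array\<close>.\<close>

lemma one_minus_laplace_le:
  fixes N :: "'b \<Rightarrow> 'a measure"
  assumes N: "point_process P N" and f: "f \<in> CK_plus"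
  shows "1 - laplace P N f \<le> measure P {\<omega> \<in> space P. emeasure (N \<omega>) {x. f x \<noteq> (0::real)} > 0}"
proof -
  interpret prob_space P using N by (simp add: point_process_def)
  have Nm: "N \<in> measurable P Mp_borel" using N by (simp add: point_process_def)
  have NMp: "N \<omega> \<in> Mp" if "\<omega> \<in> space P" for \<omega> using measurable_space[OF Nm that] by simp
  let ?A = "{\<omega> \<in> space P. emeasure (N \<omega>) {x. f x \<noteq> 0} > 0}"
  have "?A = {\<omega> \<in> space P. mint (N \<omega>) f \<noteq> 0}"
    using mint_CK_eq_0_iff[OF NMp f] by (auto simp: zero_less_iff_neq_zero)
  also have "\<dots> \<in> sets P" using measurable_compose[OF Nm measurable_mint_CK[OF f]] by measurable
  finally have A: "?A \<in> sets P" .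
  have int: "integrable P (\<lambda>\<omega>. lap f (N \<omega>))"
    using measurable_compose[OF Nm measurable_lap[OF f]] by (intro integrable_const_bound[of _ 1]) auto
  have "1 - laplace P N f = (\<integral>\<omega>. 1 - lap f (N \<omega>) \<partial>P)"
    unfolding laplace_eq_lap using int by (simp add: prob_space)
  also have "\<dots> \<le> (\<integral>\<omega>. indicat_real ?A \<omega> \<partial>P)"
  proof (rule integral_mono)
    show "integrable P (indicat_real ?A)" using A by (intro integrable_real_indicator) (auto simp: emeasure_eq_measure)
    show "1 - lap f (N \<omega>) \<le> indicat_real ?A \<omega>" if "\<omega> \<in> space P" for \<omega>
      using mint_CK_eq_0_iff[OF NMp[OF that] f] that by (auto simp: indicator_def lap_def)
  qed (use int in auto)
  also have "\<dots> = measure P ?A" using A by (simp add: Int_absorb2)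
  finally show ?thesis .
qed

end

text \<open>The coordinates on a finite power of the root law are i.i.d., and their sum has
  transform exp(-\<psi>), which determines its law. Points of the power are functions on the
  naturals, hence of the sample type fixed in the definition.\<close>

lemma (in null_array) infinitely_divisible_limit:
  assumes N: "point_process Q N"
    and lim: "\<And>f. f \<in> CK_plus \<Longrightarrow> (\<lambda>n. \<Psi> n f) \<longlonglongrightarrow> \<psi> f"
    and cont: "\<And>f. f \<in> CK_plus \<Longrightarrow> (\<lambda>j. \<psi> (\<lambda>x. f x / real (Suc j))) \<longlonglongrightarrow> 0"
    and lap: "\<And>f. f \<in> CK_plus \<Longrightarrow> (\<integral>\<mu>. lap f \<mu> \<partial>law Q N) = exp (- \<psi> f)"
  shows "infinitely_divisible Q N"
  unfolding infinitely_divisible_def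
proof (intro conjI allI impI N)
  fix n :: nat assume n: "1 \<le> n"
  obtain S where S: "prob_space S" "sets S = sets Mp_borel"
    "\<And>f. f \<in> CK_plus \<Longrightarrow> (\<integral>\<mu>. lap f \<mu> \<partial>S) = exp (- (\<psi> f / real n))"
    using root_law[OF lim cont, of n] n by auto
  let ?P = "PiM {..<n} (\<lambda>_. S)" and ?X = "\<lambda>i \<omega>. \<omega> i :: 'a measure"
  interpret product_prob_space "\<lambda>_. S" "{..<n}" by (intro product_prob_spaceI S)
  interpret P: prob_space ?P by (intro prob_space_PiM S)
  have X: "?X i \<in> measurable ?P Mp_borel" if "i < n" for i
  proof -
    have "?X i \<in> measurable ?P S" using that by (intro measurable_component_singleton) simp
    then show ?thesis using S(2) by (metis measurable_cong_sets)
  qed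
  have distr: "distr ?P Mp_borel (?X i) = S" if "i < n" for i
  proof -
    have "distr ?P Mp_borel (?X i) = distr ?P S (?X i)" using S(2) by (intro distr_cong) auto
    then show ?thesis using PiM_component[of i] that by simp
  qed
  have sum: "(\<lambda>\<omega>. sum_measure borel (\<lambda>i. ?X i \<omega>) {..<n}) \<in> measurable ?P Mp_borel"
    using measurable_independent_sum[of "{..<n}" "\<lambda>_. S"] S by simp
  have sum_pp: "point_process ?P (\<lambda>\<omega>. sum_measure borel (\<lambda>i. ?X i \<omega>) {..<n})"
    using sum P.prob_space_axioms by (simp add: point_process_def)
  show "\<exists>(Q' :: (nat \<Rightarrow> 'a measure) measure) (X :: nat \<Rightarrow> (nat \<Rightarrow> 'a measure) \<Rightarrow> 'a measure).
        prob_space Q' \<and> (\<forall>i<n. point_process Q' (X i)) \<and>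
        prob_space.indep_vars Q' (\<lambda>_. Mp_borel) X {..<n} \<and>
        (\<forall>i<n. \<forall>j<n. law Q' (X i) = law Q' (X j)) \<and>
        law Q N = law Q' (\<lambda>\<omega>. sum_measure borel (\<lambda>i. X i \<omega>) {..<n})"
  proof (intro exI[of _ ?P] exI[of _ ?X] conjI allI impI)
    show "prob_space ?P" by (rule P.prob_space_axioms)
    show "point_process ?P (?X i)" if "i < n" for i
      using X[OF that] P.prob_space_axioms by (simp add: point_process_def)
    show "law ?P (?X i) = law ?P (?X j)" if "i < n" "j < n" for i j
      using distr that by (simp add: law_def)
    \<comment> \<open>Independence is equality of the joint law with the product of the marginals.
      On extensional points restriction to the index set is the identity, so the joint law is the
      product itself.\<close>
    have "distr ?P (PiM {..<n} (\<lambda>_. Mp_borel)) (\<lambda>\<omega>. \<lambda>i\<in>{..<n}. ?X i \<omega>) = distr ?P ?P (\<lambda>\<omega>. \<omega>)"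
    proof (rule distr_cong)
      show "sets (PiM {..<n} (\<lambda>_. Mp_borel)) = sets ?P" using S(2) by (intro sets_PiM_cong) auto
      show "(\<lambda>i\<in>{..<n}. ?X i \<omega>) = \<omega>" if "\<omega> \<in> space ?P" for \<omega>
        using that by (auto simp: space_PiM PiE_def extensional_restrict)
    qed simp
    also have "\<dots> = ?P" by simp
    also have "?P = PiM {..<n} (\<lambda>i. distr ?P Mp_borel (?X i))" using distr by (intro PiM_cong) auto
    finally show "P.indep_vars (\<lambda>_. Mp_borel) ?X {..<n}"
      using n X by (subst P.indep_vars_iff_distr_eq_PiM') (auto simp: lessThan_empty_iff)
    show "law Q N = law ?P (\<lambda>\<omega>. sum_measure borel (\<lambda>i. ?X i \<omega>) {..<n})"
    proof (rule laplace_unique)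
      fix f :: "'a \<Rightarrow> real" assume f: "f \<in> CK_plus"
      have "(\<integral>\<mu>. lap f \<mu> \<partial>law ?P (\<lambda>\<omega>. sum_measure borel (\<lambda>i. ?X i \<omega>) {..<n})) = (\<Prod>i<n. \<integral>\<mu>. lap f \<mu> \<partial>S)"
        using laplace_eq_law[OF sum_pp measurable_lap[OF f]] laplace_independent_sum[of "{..<n}" "\<lambda>_. S", OF _ S(1,2) f]
        by (simp add: laplace_eq_lap)
      also have "\<dots> = exp (- (\<psi> f / real n)) ^ n" using S(3)[OF f] by simp
      also have "\<dots> = exp (- \<psi> f)" using n by (simp flip: exp_of_nat_mult)
      finally show "(\<integral>\<mu>. lap f \<mu> \<partial>law Q N) = (\<integral>\<mu>. lap f \<mu> \<partial>law ?P (\<lambda>\<omega>. sum_measure borel (\<lambda>i. ?X i \<omega>) {..<n}))"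
        using lap[OF f] by simp
    qed (use law_properties[OF N] law_properties[OF sum_pp] in \<open>auto intro: prob_space.finite_measure\<close>)
  qed
qed

text \<open>Every law on M_p(E) is the law of the identity map, so in the equivalence the limit
  process may live on M_p(E) itself; the description of the limit is given for any sample
  space.\<close>

theorem theorem1p2:
  fixes P :: "nat \<Rightarrow> 'b measure"
    and N :: "nat \<Rightarrow> 'b \<Rightarrow> 'a::{t2_space, second_countable_topology} measure"
    and k :: "nat \<Rightarrow> nat"
    and R :: "nat \<Rightarrow> nat \<Rightarrow> 'c measure"
    and Y :: "nat \<Rightarrow> nat \<Rightarrow> 'c \<Rightarrow> 'a measure"
    and \<Lambda> :: "nat \<Rightarrow> 'a measure measure"
  assumes "locally_compact_space (euclidean :: 'a topology)"
    and "\<And>n. n \<ge> 1 \<Longrightarrow> point_process (P n) (N n)"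
    and "filterlim k at_top sequentially"
    and "\<And>n i. n \<ge> 1 \<Longrightarrow> i \<in> {1..k n} \<Longrightarrow> point_process (R i n) (Y i n)"
    and "\<And>B. B \<in> bounded_borel \<Longrightarrow>
           (\<lambda>n. Max ((\<lambda>i. measure (R i n) {\<omega> \<in> space (R i n). emeasure (Y i n \<omega>) B > 0}) ` {1..k n}))
             \<longlonglongrightarrow> 0"
    and "\<And>f. f \<in> CK_plus \<Longrightarrow>
           (\<lambda>n. \<bar>laplace (P n) (N n) f - (\<Prod>i=1..k n. laplace (R i n) (Y i n) f)\<bar>) \<longlonglongrightarrow> 0"
    and "\<And>n. \<Lambda> n = sum_measure Mp_borel (\<lambda>i. law (R i n) (Y i n)) {1..k n}"
  shows "((\<exists>(Q :: 'a measure measure) N'. point_process Q N' \<and> conv_in_dist P N Q N') \<longleftrightarrow>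
          (\<exists>\<nu>. admissible_measure \<nu> \<and>
             (\<forall>f\<in>CK_plus. (\<lambda>n. laplace_exponent (\<Lambda> n) f) \<longlonglongrightarrow> laplace_exponent \<nu> f))) \<and>
         (\<forall>(Q :: 'd measure) N' \<nu>.
            point_process Q N' \<and> conv_in_dist P N Q N' \<and> admissible_measure \<nu> \<and>
            (\<forall>f\<in>CK_plus. (\<lambda>n. laplace_exponent (\<Lambda> n) f) \<longlonglongrightarrow> laplace_exponent \<nu> f) \<longrightarrow>
            infinitely_divisible Q N' \<and> canonical_measure Q N' \<nu>)"
proof -
  interpret lcsc_space "TYPE('a)" by (rule lcsc_space.intro[OF assms(1)])
  \<comment> \<open>Nothing is assumed about index \<open>0\<close>, hence the shift; outside \<open>{1..k n}\<close> the rows are filled with \<open>o\<close>.\<close>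
  define PN where "PN n = law (P (Suc n)) (N (Suc n))" for n
  define RR where "RR i n = (if i \<in> {1..k (Suc n)} then law (R i (Suc n)) (Y i (Suc n))
    else return Mp_borel (null_measure borel))" for i n
  have pN: "point_process (P (Suc n)) (N (Suc n))" for n by (rule assms(2)) simp
  have pY: "point_process (R i (Suc n)) (Y i (Suc n))" if "i \<in> {1..k (Suc n)}" for i n
    using that by (intro assms(4)) auto
  have RR_lap: "(\<integral>\<mu>. lap f \<mu> \<partial>RR i n) = laplace (R i (Suc n)) (Y i (Suc n)) f"
    if "i \<in> {1..k (Suc n)}" "f \<in> CK_plus" for i n f
    using laplace_eq_law[OF pY measurable_lap] that by (simp add: RR_def)
  interpret null_array "TYPE('a)" PN RR "\<lambda>n. k (Suc n)"
  proof (intro null_array.intro null_array_axioms.intro lcsc_space_axioms)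
    show "prob_space (PN n)" "sets (PN n) = sets Mp_borel" for n
      unfolding PN_def by (rule law_properties[OF pN])+
    show "prob_space (RR i n)" "sets (RR i n) = sets Mp_borel" for i n
      using law_properties[OF pY, of i n] by (auto simp: RR_def intro: prob_space_return)
  next
    fix f :: "'a \<Rightarrow> real" and \<epsilon> :: real assume f: "f \<in> CK_plus" and \<epsilon>: "0 < \<epsilon>"
    let ?p = "\<lambda>i n. measure (R i n) {\<omega> \<in> space (R i n). emeasure (Y i n \<omega>) {x. f x \<noteq> 0} > 0}"
    have "eventually (\<lambda>n. Max ((\<lambda>i. ?p i (Suc n)) ` {1..k (Suc n)}) < \<epsilon>) sequentially"
      using LIMSEQ_Suc[OF assms(5)[OF CK_plus_support_bounded[OF f]]] \<epsilon> by (rule order_tendstoD(2))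
    then show "eventually (\<lambda>n. \<forall>i\<in>{1..k (Suc n)}. 1 - (\<integral>\<mu>. lap f \<mu> \<partial>RR i n) \<le> \<epsilon>) sequentially"
    proof eventually_elim
      case (elim n)
      show ?case
      proof
        fix i assume i: "i \<in> {1..k (Suc n)}"
        have "1 - (\<integral>\<mu>. lap f \<mu> \<partial>RR i n) \<le> ?p i (Suc n)"
          unfolding RR_lap[OF i f] by (rule one_minus_laplace_le[OF pY[OF i] f])
        also have "\<dots> \<le> Max ((\<lambda>i. ?p i (Suc n)) ` {1..k (Suc n)})" using i by (intro Max_ge) auto
        finally show "1 - (\<integral>\<mu>. lap f \<mu> \<partial>RR i n) \<le> \<epsilon>" using elim by linarith
      qed
    qed
  next
    fix f :: "'a \<Rightarrow> real" assume f: "f \<in> CK_plus"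
    have "(\<lambda>n. laplace (P n) (N n) f - (\<Prod>i=1..k n. laplace (R i n) (Y i n) f)) \<longlonglongrightarrow> 0"
      using assms(6)[OF f] by (simp add: tendsto_rabs_zero_iff)
    note LIMSEQ_Suc[OF this]
    moreover have "(\<Prod>i=1..k (Suc n). \<integral>\<mu>. lap f \<mu> \<partial>RR i n) = (\<Prod>i=1..k (Suc n). laplace (R i (Suc n)) (Y i (Suc n)) f)" for n
      by (intro prod.cong refl RR_lap f)
    moreover have "(\<integral>\<mu>. lap f \<mu> \<partial>PN n) = laplace (P (Suc n)) (N (Suc n)) f" for n
      unfolding PN_def by (rule laplace_eq_law[OF pN measurable_lap[OF f]])
    ultimately show "(\<lambda>n. (\<integral>\<mu>. lap f \<mu> \<partial>PN n) - (\<Prod>i=1..k (Suc n). \<integral>\<mu>. lap f \<mu> \<partial>RR i n)) \<longlonglongrightarrow> 0"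
      by simp
  qed
  have \<Lambda>: "\<Lambda> (Suc n) = intensity n" for n
    unfolding assms(7) intensity_def sum_measure_def
    by (intro arg_cong2[where f = "measure_of (space Mp_borel)"] refl ext sum.cong) (simp add: RR_def)
  have \<Lambda>_exp: "laplace_exponent (\<Lambda> (Suc n)) f = ennreal (\<Psi> n f)" if "f \<in> CK_plus" for n f
    unfolding \<Lambda> by (rule laplace_exponent_intensity[OF that])
  have \<Lambda>_lim: "(\<lambda>n. laplace_exponent (\<Lambda> n) f) \<longlonglongrightarrow> l \<longleftrightarrow> (\<lambda>n. ennreal (\<Psi> n f)) \<longlonglongrightarrow> l"
    if "f \<in> CK_plus" for f l
    using filterlim_sequentially_Suc[of "\<lambda>n. laplace_exponent (\<Lambda> n) f" "nhds l"] by (simp add: \<Lambda>_exp[OF that])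
  have conv: "conv_in_dist P N Q N' \<longleftrightarrow> (\<forall>g\<in>Cb. (\<lambda>n. \<integral>\<mu>. g \<mu> \<partial>PN n) \<longlonglongrightarrow> (\<integral>\<mu>. g \<mu> \<partial>law Q N'))"
    for Q :: "'e measure" and N'
    unfolding PN_def by (rule conv_in_dist_iff_Cb)
  \<comment> \<open>Finiteness of the exponents of an admissible measure moves the convergence from
    extended to real values, where the array lemmas apply.\<close>
  have \<psi>_facts: "(\<lambda>n. \<Psi> n f) \<longlonglongrightarrow> enn2real (laplace_exponent \<nu> f)"
      "(\<lambda>j. enn2real (laplace_exponent \<nu> (\<lambda>x. f x / real (Suc j)))) \<longlonglongrightarrow> 0"
      "exp (- enn2real (laplace_exponent \<nu> f)) = exp_neg (laplace_exponent \<nu> f)"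
    if \<nu>: "admissible_measure \<nu>" "\<forall>f\<in>CK_plus. (\<lambda>n. laplace_exponent (\<Lambda> n) f) \<longlonglongrightarrow> laplace_exponent \<nu> f"
      and f: "f \<in> CK_plus" for \<nu> f
  proof -
    have fin: "laplace_exponent \<nu> g < top" if "g \<in> CK_plus" for g
      using laplace_exponent_finite[OF \<nu>(1) that] by simp
    have "(\<lambda>n. ennreal (\<Psi> n f)) \<longlonglongrightarrow> ennreal (enn2real (laplace_exponent \<nu> f))"
      using \<Lambda>_lim[OF f, THEN iffD1, OF bspec[OF \<nu>(2) f]] fin[OF f] by (simp add: less_top)
    then show "(\<lambda>n. \<Psi> n f) \<longlonglongrightarrow> enn2real (laplace_exponent \<nu> f)"
      using \<Psi>_nonneg[OF f] by (subst (asm) tendsto_ennreal_iff) auto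
    have "(\<lambda>j. ennreal (enn2real (laplace_exponent \<nu> (\<lambda>x. f x / real (Suc j))))) \<longlonglongrightarrow> ennreal 0"
      using laplace_exponent_scale_tendsto[OF \<nu>(1) f] fin[OF CK_plus_divide[OF f]] by (simp add: less_top del: of_nat_Suc)
    then show "(\<lambda>j. enn2real (laplace_exponent \<nu> (\<lambda>x. f x / real (Suc j)))) \<longlonglongrightarrow> 0"
      by (subst (asm) tendsto_ennreal_iff) auto
    show "exp (- enn2real (laplace_exponent \<nu> f)) = exp_neg (laplace_exponent \<nu> f)"
      using fin[OF f] by (simp add: exp_neg_def less_top)
  qed
  show ?thesis
  proof (intro conjI iffI allI impI)
    assume "\<exists>(Q :: 'a measure measure) N'. point_process Q N' \<and> conv_in_dist P N Q N'"
    then obtain Q :: "'a measure measure" and N' where Q: "point_process Q N'" "conv_in_dist P N Q N'" by auto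
    have "(\<lambda>n. \<integral>\<mu>. lap f \<mu> \<partial>PN n) \<longlonglongrightarrow> (\<integral>\<mu>. lap f \<mu> \<partial>law Q N')" if "f \<in> CK_plus" for f
      using Q(2) Cb_lap[OF that] by (simp add: conv)
    from canonical_measure_exists[OF law_properties[OF Q(1)] this]
    obtain \<nu> where \<nu>: "admissible_measure \<nu>"
      "\<And>f. f \<in> CK_plus \<Longrightarrow> (\<lambda>n. \<Psi> n f) \<longlonglongrightarrow> - ln (\<integral>\<mu>. lap f \<mu> \<partial>law Q N')"
      "\<And>f. f \<in> CK_plus \<Longrightarrow> laplace_exponent \<nu> f = ennreal (- ln (\<integral>\<mu>. lap f \<mu> \<partial>law Q N'))"
      by metis
    then show "\<exists>\<nu>. admissible_measure \<nu> \<and>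
        (\<forall>f\<in>CK_plus. (\<lambda>n. laplace_exponent (\<Lambda> n) f) \<longlonglongrightarrow> laplace_exponent \<nu> f)"
      by (intro exI[of _ \<nu>]) (auto simp: \<Lambda>_lim intro: tendsto_ennrealI)
  next
    assume "\<exists>\<nu>. admissible_measure \<nu> \<and>
        (\<forall>f\<in>CK_plus. (\<lambda>n. laplace_exponent (\<Lambda> n) f) \<longlonglongrightarrow> laplace_exponent \<nu> f)"
    then obtain \<nu> where \<nu>: "admissible_measure \<nu>"
      "\<forall>f\<in>CK_plus. (\<lambda>n. laplace_exponent (\<Lambda> n) f) \<longlonglongrightarrow> laplace_exponent \<nu> f" by auto
    obtain L where L: "prob_space L" "sets L = sets Mp_borel"
      "\<And>f. f \<in> CK_plus \<Longrightarrow> (\<integral>\<mu>. lap f \<mu> \<partial>L) = exp (- enn2real (laplace_exponent \<nu> f))"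
      using limit_law[OF \<psi>_facts(1,2)[OF \<nu>]] by blast
    have "(\<lambda>n. \<integral>\<mu>. lap f \<mu> \<partial>PN n) \<longlonglongrightarrow> (\<integral>\<mu>. lap f \<mu> \<partial>L)" if "f \<in> CK_plus" for f
      unfolding L(3)[OF that] by (rule laplace_tendsto_exp[OF that \<psi>_facts(1)[OF \<nu> that]])
    from laplace_imp_weak_conv[OF PN_finite prob_space.finite_measure[OF L(1)] PN(2) L(2) this]
    have "conv_in_dist P N L (\<lambda>\<mu>. \<mu>)" by (simp add: conv point_process_identity[OF L(1,2)])
    then show "\<exists>(Q :: 'a measure measure) N'. point_process Q N' \<and> conv_in_dist P N Q N'"
      using point_process_identity(1)[OF L(1,2)] by blast
  next
    fix Q :: "'d measure" and N' \<nu>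
    assume *: "point_process Q N' \<and> conv_in_dist P N Q N' \<and> admissible_measure \<nu> \<and>
      (\<forall>f\<in>CK_plus. (\<lambda>n. laplace_exponent (\<Lambda> n) f) \<longlonglongrightarrow> laplace_exponent \<nu> f)"
    then have Q: "point_process Q N'" and \<nu>: "admissible_measure \<nu>"
      "\<forall>f\<in>CK_plus. (\<lambda>n. laplace_exponent (\<Lambda> n) f) \<longlonglongrightarrow> laplace_exponent \<nu> f" by auto
    \<comment> \<open>Here \<nu> is arbitrary, not the measure constructed before. The two
      convergences evaluate the limit of the same transforms, which ties \<nu> to the law of
      \<open>N'\<close>.\<close>
    have lap: "(\<integral>\<mu>. lap f \<mu> \<partial>law Q N') = exp (- enn2real (laplace_exponent \<nu> f))" if f: "f \<in> CK_plus" for f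
    proof (rule LIMSEQ_unique)
      show "(\<lambda>n. \<integral>\<mu>. lap f \<mu> \<partial>PN n) \<longlonglongrightarrow> (\<integral>\<mu>. lap f \<mu> \<partial>law Q N')"
        using * Cb_lap[OF f] by (simp add: conv)
      show "(\<lambda>n. \<integral>\<mu>. lap f \<mu> \<partial>PN n) \<longlonglongrightarrow> exp (- enn2real (laplace_exponent \<nu> f))"
        by (rule laplace_tendsto_exp[OF f \<psi>_facts(1)[OF \<nu> f]])
    qed
    show "infinitely_divisible Q N'"
      by (rule infinitely_divisible_limit[OF Q \<psi>_facts(1,2)[OF \<nu>] lap])
    show "canonical_measure Q N' \<nu>"
      unfolding canonical_measure_def
    proof (intro conjI ballI impI \<nu>(1))
      fix f :: "'a \<Rightarrow> real" assume f: "f \<in> borel_measurable borel" "\<forall>x. 0 \<le> f x"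
      have "(\<integral>\<mu>. lap g \<mu> \<partial>law Q N') = exp_neg (laplace_exponent \<nu> g)" if "g \<in> CK_plus" for g
        using lap[OF that] \<psi>_facts(3)[OF \<nu> that] by simp
      note ext = laplace_identity_extends[OF law_properties[OF Q] \<nu>(1) this f(1) f(2)[rule_format]]
      show "laplace Q N' f = exp_neg (laplace_exponent \<nu> f)"
        using ext(2) laplace_eq_law[OF Q ext(1)] by simp
    qed
  qed
qed

end
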